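(* Let $(I,\eta)=(I_n,\eta_n)_{n\in\mathbb{N}}$ be an erased-interval process and let $(S_n)_{n\in\mathbb{N}}$ and $(U_i)_{i\in\mathbb{N}}$ be the permutation process and the $U$-process corresponding to $\eta$. Let $I_\infty=\lim_{n\to\infty}n^{-1}I_n$ (almost sure limit in $(\mathrm{InSy}(\infty),d_{\mathrm{haus}})$, which exists). Define $H_n:=S_n(I_n)$. Then $$H_n=\Big\{\{j\in[n]:x<U_j<y\}:(x,y)\in I_\infty\Big\}\cup\{\{j\}:j\in[n]\}\cup\{\emptyset\}\quad\text{almost surely for every }n,$$ and $H=(H_n)_{n\in\mathbb{N}}$ is an exchangeable interval hypergraph on $\mathbb{N}$. The map $$\mathtt{ErInPr}\longrightarrow\mathtt{ExInHy},\quad \mathrm{Law}((I,\eta))\longmapsto\mathrm{Law}(H)$$ is a continuous affine surjection.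
   Context: Interval hypergraphs: an interval hypergraph on $[n]=\{1,\dots,n\}$ is a set $\mathtt{H}$ of subsets of $[n]$ containing $\emptyset$ and all singletons $\{j\}$, $j\in[n]$, such that for some linear order $l$ on $[n]$ every $e\in\mathtt{H}$ is an interval with respect to $l$. $\mathrm{InHy}(n)$ is the finite set of these. For $k\le n$ let $\mathtt{H}_{|k}:=\{[k]\cap e:e\in\mathtt{H}\}$, and for a permutation $\pi$ of $[n]$ let $\pi(\mathtt{H}):=\{\pi(e):e\in\mathtt{H}\}$. An exchangeable interval hypergraph on $\mathbb{N}$ is a process $(H_n)_{n\in\mathbb{N}}$ with $H_n\in\mathrm{InHy}(n)$, $H_n=(H_{n+1})_{|n}$ a.s., and $\pi(H_n)\overset{d}{=}H_n$ for all $n$ and all permutations $\pi$ of $[n]$. $\mathtt{ExInHy}$ is the set of laws of such processes, with the topology of weak convergence of Borel probability measures on $\prod_n\mathrm{InHy}(n)$ (each factor discrete). Interval systems: $\mathrm{InSy}(n)\subseteq\mathrm{InHy}(n)$ is the set of interval hypergraphs on $[n]$ with respect to the usual order; its non-empty elements are of the form $[a,b]=\{i:a\le i\le b\}$. For $[a,b]\subseteq[n+1]$ and $k\in[n+1]$ let $[a,b]-\{k\}\subseteq[n]$ be $[a-1,b-1]$ if $k<a$; $[a,b-1]$ if $a\le k\le b$ (empty if $a=b$); $[a,b]$ if $b<k$. For $\mathtt{I}\in\mathrm{InSy}(n+1)$ let $\phi^{n+1}_n(\mathtt{I},k):=\{[a,b]-\{k\}:[a,b]\in\mathtt{I}\}\cup\{\emptyset\}\in\mathrm{InSy}(n)$.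 Erased-interval process (EIP): a process $(I_n,\eta_n)_{n\in\mathbb{N}}$ such that for all $n$: (i) $(I_n,\eta_n)\in\mathrm{InSy}(n)\times[n+1]$ a.s.; (ii) $\eta_n$ is uniform on $[n+1]$ and independent of $\sigma(I_m,\eta_m:m\ge n+1)$; (iii) $I_n=\phi^{n+1}_n(I_{n+1},\eta_n)$ a.s. $\mathtt{ErInPr}$ is the set of laws of EIPs, with the topology of weak convergence of Borel probability measures on $\prod_n\mathrm{InSy}(n)\times[n+1]$. Both $\mathtt{ErInPr}$ and $\mathtt{ExInHy}$ are convex sets of probability measures. Limit space: $\mathrm{InSy}(\infty)$ is the set of compact $K\subseteq\{(x,y):0\le x\le y\le1\}$ containing $\Delta:=\{(x,x):0\le x\le1\}$, with the Hausdorff distance $d_{\mathrm{haus}}$ induced by the $\ell^1$-metric on $\mathbb{R}^2$. For $\mathtt{I}\in\mathrm{InSy}(n)$, $n^{-1}\mathtt{I}:=\{(\frac{a-1}{n},\frac bn):\emptyset\ne[a,b]\in\mathtt{I}\}\cup\Delta$. Corresponding processes: given the eraser process $\eta$ (independent, $\eta_n$ uniform on $[n+1]$), the corresponding permutation process $(S_n)$ is defined by: $S_1$ is the permutation of $[1]$, and the one-line notation $(S_{n+1}(1),\dots,S_{n+1}(n+1))$ is obtained from that of $S_n$ by inserting $n+1$ so that it stands at position $\eta_n$. The corresponding $U$-process is $U_i:=\lim_n S_n^{-1}(i)/n$, which exists a.s. and is an i.i.d. sequence of uniform random variables on $[0,1]$. *)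

theory Defs
  imports "HOL-Probability.Probability" "HOL-Combinatorics.Permutations"
begin

text \<open>
  The index set of all processes is \<open>{1..}\<close>, and the vertex set \<open>[n]\<close> is \<open>{1..n}\<close>.
  The values of a process at index 0 are never constrained and never used.
\<close>

definition interval_wrt :: "(nat \<times> nat) set \<Rightarrow> nat set \<Rightarrow> nat set \<Rightarrow> bool" where
  "interval_wrt l V e \<longleftrightarrow>
     e \<subseteq> V \<and> (\<forall>a\<in>e. \<forall>b\<in>e. \<forall>c\<in>V. (a, c) \<in> l \<and> (c, b) \<in> l \<longrightarrow> c \<in> e)"

definition interval_hypergraph_wrt :: "(nat \<times> nat) set \<Rightarrow> nat \<Rightarrow> nat set set \<Rightarrow> bool" where
  "interval_hypergraph_wrt l n H \<longleftrightarrow>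
     {} \<in> H \<and> (\<forall>j\<in>{1..n}. {j} \<in> H) \<and> (\<forall>e\<in>H. interval_wrt l {1..n} e)"

definition InHy :: "nat \<Rightarrow> nat set set set" where
  "InHy n = {H. \<exists>l. linear_order_on {1..n} l \<and> interval_hypergraph_wrt l n H}"

definition InSy :: "nat \<Rightarrow> nat set set set" where
  "InSy n = {H. interval_hypergraph_wrt {(i, j). i \<in> {1..n} \<and> j \<in> {1..n} \<and> i \<le> j} n H}"

definition restrict_hypergraph :: "nat set set \<Rightarrow> nat \<Rightarrow> nat set set" where
  "restrict_hypergraph H k = {{1..k} \<inter> e | e. e \<in> H}"

definition permute_hypergraph :: "(nat \<Rightarrow> nat) \<Rightarrow> nat set set \<Rightarrow> nat set set" where
  "permute_hypergraph p H = {p ` e | e. e \<in> H}"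

definition erase_point :: "nat \<Rightarrow> nat \<Rightarrow> nat \<Rightarrow> nat set" where
  "erase_point a b k =
     (if k < a then {a - 1..b - 1}
      else if k \<le> b then (if a = b then {} else {a..b - 1})
      else {a..b})"

text \<open>The map \<open>\<phi>\<^sup>n\<^sup>+\<^sup>1\<^sub>n\<close>; its formula does not depend on \<open>n\<close>.\<close>

definition erase_system :: "nat set set \<Rightarrow> nat \<Rightarrow> nat set set" where
  "erase_system J k = {erase_point a b k | a b. a \<le> b \<and> {a..b} \<in> J} \<union> {{}}"

definition path_space :: "(nat \<Rightarrow> 'b set) \<Rightarrow> (nat \<Rightarrow> 'b) measure" where
  "path_space A = PiM {1..} (\<lambda>n. count_space (A n))"

definition path_topology :: "(nat \<Rightarrow> 'b set) \<Rightarrow> (nat \<Rightarrow> 'b) topology" where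
  "path_topology A = product_topology (\<lambda>n. discrete_topology (A n)) {1..}"

text \<open>The processes below take their values in \<^term>\<open>A n\<close> only almost surely, hence the path
  map need not be a measurable map into \<^term>\<open>path_space A\<close>. The value
  \<^term>\<open>emeasure M (X -` B \<inter> space M)\<close> that \<^const>\<open>distr\<close> assigns to a
  measurable set \<^term>\<open>B\<close> is nevertheless the probability that the path lies in \<^term>\<open>B\<close>, and
  this is a probability measure.\<close>

definition process_law :: "'a measure \<Rightarrow> (nat \<Rightarrow> 'b set) \<Rightarrow> (nat \<Rightarrow> 'a \<Rightarrow> 'b) \<Rightarrow> (nat \<Rightarrow> 'b) measure" where
  "process_law M A X = distr M (path_space A) (\<lambda>\<omega>. \<lambda>n\<in>{1..}. X n \<omega>)"

text \<open>The topology of weak convergence on a set \<open>P\<close> of Borel probability measures on \<open>X\<close>: the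
  coarsest one making \<open>\<mu> \<mapsto> \<integral> f d\<mu>\<close> continuous for every bounded continuous \<open>f\<close>.\<close>

definition weak_topology :: "'b topology \<Rightarrow> 'b measure set \<Rightarrow> 'b measure topology" where
  "weak_topology X P = topology_generated_by
     {{\<mu> \<in> P. (\<integral>x. f x \<partial>\<mu>) \<in> U} | f U.
        continuous_map X euclideanreal f \<and> bounded (f ` topspace X) \<and> open U}"

definition mixture :: "real \<Rightarrow> 'b measure \<Rightarrow> 'b measure \<Rightarrow> 'b measure" where
  "mixture t \<mu> \<nu> = measure_of (space \<mu>) (sets \<mu>)
     (\<lambda>B. ennreal t * emeasure \<mu> B + ennreal (1 - t) * emeasure \<nu> B)"

definition affine_map_on :: "'b measure set \<Rightarrow> ('b measure \<Rightarrow> 'c measure) \<Rightarrow> bool" where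
  "affine_map_on P F \<longleftrightarrow>
     (\<forall>\<mu>\<in>P. \<forall>\<nu>\<in>P. \<forall>t\<in>{0..1}. F (mixture t \<mu> \<nu>) = mixture t (F \<mu>) (F \<nu>))"

definition exchangeable_interval_hypergraph ::
    "'a measure \<Rightarrow> (nat \<Rightarrow> 'a \<Rightarrow> nat set set) \<Rightarrow> bool" where
  "exchangeable_interval_hypergraph M H \<longleftrightarrow>
     prob_space M \<and>
     (\<forall>n\<ge>1. H n \<in> measurable M (count_space UNIV)) \<and>
     (\<forall>n\<ge>1. AE \<omega> in M. H n \<omega> \<in> InHy n) \<and>
     (\<forall>n\<ge>1. AE \<omega> in M. H n \<omega> = restrict_hypergraph (H (n + 1) \<omega>) n) \<and>
     (\<forall>n\<ge>1. \<forall>p. p permutes {1..n} \<longrightarrow>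
        distr M (count_space UNIV) (\<lambda>\<omega>. permute_hypergraph p (H n \<omega>)) =
        distr M (count_space UNIV) (H n))"

text \<open>A set of laws cannot range over all sample space types. Taking the path space type as the
  sample space type loses nothing, since every law is the law of the coordinate process.\<close>

definition ExInHy :: "(nat \<Rightarrow> nat set set) measure set" where
  "ExInHy = {process_law M InHy H |
     (M :: (nat \<Rightarrow> nat set set) measure) H. exchangeable_interval_hypergraph M H}"

abbreviation pair_process ::
    "(nat \<Rightarrow> 'a \<Rightarrow> 'b) \<Rightarrow> (nat \<Rightarrow> 'a \<Rightarrow> 'c) \<Rightarrow> nat \<Rightarrow> 'a \<Rightarrow> 'b \<times> 'c" where
  "pair_process X Y \<equiv> \<lambda>n \<omega>. (X n \<omega>, Y n \<omega>)"

definition EIP_states :: "nat \<Rightarrow> (nat set set \<times> nat) set" where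
  "EIP_states n = InSy n \<times> {1..n + 1}"

definition erased_interval_process ::
    "'a measure \<Rightarrow> (nat \<Rightarrow> 'a \<Rightarrow> nat set set) \<Rightarrow> (nat \<Rightarrow> 'a \<Rightarrow> nat) \<Rightarrow> bool" where
  "erased_interval_process M I \<eta> \<longleftrightarrow>
     prob_space M \<and>
     (\<forall>n\<ge>1. pair_process I \<eta> n \<in> measurable M (count_space UNIV)) \<and>
     (\<forall>n\<ge>1. AE \<omega> in M. pair_process I \<eta> n \<omega> \<in> EIP_states n) \<and>
     (\<forall>n\<ge>1. distr M (count_space UNIV) (\<eta> n) = measure_pmf (pmf_of_set {1..n + 1})) \<and>
     (\<forall>n\<ge>1. prob_space.indep_set M
        {\<eta> n -` B \<inter> space M | B. True}
        (sigma_sets (space M)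
          {pair_process I \<eta> m -` B \<inter> space M | m B. m \<ge> n + 1})) \<and>
     (\<forall>n\<ge>1. AE \<omega> in M. I n \<omega> = erase_system (I (n + 1) \<omega>) (\<eta> n \<omega>))"

definition ErInPr :: "(nat \<Rightarrow> nat set set \<times> nat) measure set" where
  "ErInPr = {process_law M EIP_states (pair_process I \<eta>) |
     (M :: (nat \<Rightarrow> nat set set \<times> nat) measure) I \<eta>. erased_interval_process M I \<eta>}"

definition diag :: "(real \<times> real) set" where
  "diag = {(x, x) | x. 0 \<le> x \<and> x \<le> 1}"

definition InSy_inf :: "(real \<times> real) set set" where
  "InSy_inf = {K. compact K \<and> K \<subseteq> {(x, y). 0 \<le> x \<and> x \<le> y \<and> y \<le> 1} \<and> diag \<subseteq> K}"

definition l1_dist :: "real \<times> real \<Rightarrow> real \<times> real \<Rightarrow> real" where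
  "l1_dist p q = \<bar>fst p - fst q\<bar> + \<bar>snd p - snd q\<bar>"

definition d_haus :: "(real \<times> real) set \<Rightarrow> (real \<times> real) set \<Rightarrow> real" where
  "d_haus K L = max (SUP p\<in>K. INF q\<in>L. l1_dist p q) (SUP q\<in>L. INF p\<in>K. l1_dist p q)"

definition scaled_system :: "nat \<Rightarrow> nat set set \<Rightarrow> (real \<times> real) set" where
  "scaled_system n J =
     {((real a - 1) / real n, real b / real n) | a b. a \<le> b \<and> {a..b} \<in> J} \<union> diag"

definition scaling_limit :: "(nat \<Rightarrow> nat set set) \<Rightarrow> (real \<times> real) set \<Rightarrow> bool" where
  "scaling_limit J K \<longleftrightarrow>
     K \<in> InSy_inf \<and> (\<lambda>n. d_haus (scaled_system n (J n)) K) \<longlonglongrightarrow> 0"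

definition limit_system :: "(nat \<Rightarrow> nat set set) \<Rightarrow> (real \<times> real) set" where
  "limit_system J = (THE K. scaling_limit J K)"

text \<open>One-line notations; at \<open>n = 0\<close> the second equation gives \<open>[1]\<close> for every value of \<open>h 0\<close>.\<close>

primrec one_line :: "(nat \<Rightarrow> nat) \<Rightarrow> nat \<Rightarrow> nat list" where
  "one_line h 0 = []"
| "one_line h (Suc n) =
     take (h n - 1) (one_line h n) @ Suc n # drop (h n - 1) (one_line h n)"

definition perm_of :: "(nat \<Rightarrow> nat) \<Rightarrow> nat \<Rightarrow> nat \<Rightarrow> nat" where
  "perm_of h n i = (if i \<in> {1..n} then one_line h n ! (i - 1) else i)"

definition U_of :: "(nat \<Rightarrow> nat) \<Rightarrow> nat \<Rightarrow> real" where
  "U_of h i = lim (\<lambda>n. real (inv (perm_of h n) i) / real n)"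

definition hypergraph_process ::
    "(nat \<Rightarrow> 'a \<Rightarrow> nat set set) \<Rightarrow> (nat \<Rightarrow> 'a \<Rightarrow> nat) \<Rightarrow> nat \<Rightarrow> 'a \<Rightarrow> nat set set" where
  "hypergraph_process I \<eta> n \<omega> = permute_hypergraph (perm_of (\<lambda>m. \<eta> m \<omega>) n) (I n \<omega>)"

text \<open>The map \<open>Law (I, \<eta>) \<mapsto> Law H\<close>, realised by the coordinate process; it commutes with taking
  laws on any other sample space, which is part of the theorem.\<close>

definition hypergraph_law ::
    "(nat \<Rightarrow> nat set set \<times> nat) measure \<Rightarrow> (nat \<Rightarrow> nat set set) measure" where
  "hypergraph_law \<mu> =
     process_law \<mu> InHy (hypergraph_process (\<lambda>n x. fst (x n)) (\<lambda>n x. snd (x n)))"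

text \<open>The measurable sets of \<^term>\<open>path_space A\<close> are the Borel sets of the product of
  finite discrete spaces:\<close>

lemma sets_path_space_borel:
  assumes fin: "\<And>n. finite (A n)"
  shows "sets (path_space A) =
    sigma_sets (topspace (path_topology A)) {U. openin (path_topology A) U}"
proof
  have top: "topspace (path_topology A) = PiE {1..} A"
    by (simp add: path_topology_def topspace_product_topology)
  have sp: "space (path_space A) = PiE {1..} A"
    by (simp add: path_space_def space_PiM)
  show "sets (path_space A) \<subseteq> sigma_sets (topspace (path_topology A)) {U. openin (path_topology A) U}"
    unfolding path_space_def sets_PiM_single top
  proof (simp only: space_count_space sets_count_space, rule sigma_sets_mono', safe)
    fix i :: nat and B assume i: "1 \<le> i" "B \<subseteq> A i"
    have "continuous_map (path_topology A) (discrete_topology (A i)) (\<lambda>x. x i)"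
      unfolding path_topology_def using i by (intro continuous_map_product_projection) auto
    then have "openin (path_topology A) {x \<in> topspace (path_topology A). x i \<in> B}"
      using i by (intro openin_continuous_map_preimage) auto
    then show "openin (path_topology A) {f \<in> PiE {1..} A. f i \<in> B}"
      by (simp add: top)
  qed
  have "U \<in> sets (path_space A)" if U: "openin (path_topology A) U" for U
  proof -
    define C where "C F g = {y \<in> PiE {1..} A. \<forall>i\<in>F. y i = g i}" for F :: "nat set" and g :: "nat \<Rightarrow> 'a"
    define T where "T = (SIGMA m:(UNIV::nat set). PiE {1..m} A)"
    define T' where "T' = {(m, g) \<in> T. C {1..m} g \<subseteq> U}"
    have "countable (PiE {1..m} A)" for m
      using fin by (simp add: countable_finite finite_PiE)
    then have "countable T" unfolding T_def by simp
    then have cT: "countable T'" by (rule countable_subset[rotated]) (auto simp: T'_def)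
    have Cm: "C {1..m} g \<in> sets (path_space A)" if "g \<in> PiE {1..m} A" for m g
    proof -
      have "C {1..m} g = PiE {1..} (\<lambda>i. if i \<in> {1..m} then {g i} else A i)"
        (is "_ = ?R")
      proof (rule set_eqI, rule iffI)
        fix y assume "y \<in> C {1..m} g"
        then show "y \<in> ?R" by (auto simp: C_def PiE_iff)
      next
        fix y assume y: "y \<in> ?R"
        have *: "y i \<in> (if i \<in> {1..m} then {g i} else A i)" if "i \<in> {1..}" for i
          using y that by (rule PiE_mem)
        have "y i \<in> A i" if "i \<in> {1..}" for i
          using *[OF that] PiE_mem[OF \<open>g \<in> PiE {1..m} A\<close>, of i] by (cases "i \<in> {1..m}") auto
        moreover have "y i = g i" if "i \<in> {1..m}" for i
          using *[of i] that by auto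
        ultimately show "y \<in> C {1..m} g"
          using y unfolding C_def PiE_iff by blast
      qed
      also have "\<dots> \<in> sets (path_space A)"
        unfolding path_space_def
      proof (rule sets_PiM_I_countable)
        show "(if i \<in> {1..m} then {g i} else A i) \<in> sets (count_space (A i))" for i
          using that by (auto simp: PiE_iff)
      qed simp
      finally show ?thesis .
    qed
    have "U = (\<Union>(m, g)\<in>T'. C {1..m} g)"
    proof (intro equalityI subsetI)
      fix x assume x: "x \<in> U"
      from U[unfolded path_topology_def openin_product_topology_alt] x
      obtain V where V: "finite {i \<in> {1..}. V i \<noteq> topspace (discrete_topology (A i))}"
        "\<forall>i\<in>{1..}. openin (discrete_topology (A i)) (V i)" "x \<in> PiE {1..} V" "PiE {1..} V \<subseteq> U"
        by blast
      from V(1) obtain m where m: "\<forall>i\<in>{i \<in> {1..}. V i \<noteq> A i}. i \<le> m"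
        using finite_nat_set_iff_bounded_le by auto
      have xA: "x \<in> PiE {1..} A" using x U openin_subset top by blast
      have "C {1..m} (restrict x {1..m}) \<subseteq> PiE {1..} V"
      proof
        fix y assume y: "y \<in> C {1..m} (restrict x {1..m})"
        have "y i \<in> V i" if "i \<in> {1..}" for i
        proof (cases "i \<le> m")
          case True then show ?thesis using y that V(3) by (auto simp: C_def PiE_iff)
        next
          case False then have "V i = A i" using m that by (metis (mono_tags, lifting) mem_Collect_eq)
          then show ?thesis using y that by (auto simp: C_def PiE_iff)
        qed
        then show "y \<in> PiE {1..} V" using y by (auto simp: C_def PiE_iff)
      qed
      then have "(m, restrict x {1..m}) \<in> T'" using V(4) xA by (auto simp: T'_def T_def)
      moreover have "x \<in> C {1..m} (restrict x {1..m})" using xA by (auto simp: C_def)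
      ultimately show "x \<in> (\<Union>(m, g)\<in>T'. C {1..m} g)" by auto
    qed (auto simp: T'_def)
    also have "\<dots> \<in> sets (path_space A)"
      using cT by (rule sets.countable_UN') (use Cm in \<open>auto simp: T'_def T_def\<close>)
    finally show ?thesis .
  qed
  then show "sigma_sets (topspace (path_topology A)) {U. openin (path_topology A) U} \<subseteq> sets (path_space A)"
    unfolding top sp[symmetric] by (intro sets.sigma_sets_subset subsetI) simp
qed

end

theory Submission
  imports Defs
begin

text \<open>
  Relabelling positions by \<open>S\<^sub>n\<close> turns erasing the point \<open>\<eta>\<^sub>n\<close> into forgetting the vertex \<open>n + 1\<close>, so
  \<open>H\<close> is consistent; \<open>S\<^sub>n\<close> is uniform and independent of \<open>I\<^sub>n\<close>, so \<open>H\<close> is exchangeable. The relative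
  position of a vertex is a martingale with increments of order \<open>1 / n\<close>, which gives the limits
  \<open>U\<^sub>i\<close>; they are almost surely distinct and dense. Let \<open>E\<close> be the set of all \<open>e \<subseteq> \<nat>\<close> whose traces on
  \<open>{1..n}\<close> lie in \<open>H\<^sub>n\<close> for all \<open>n\<close>. Then \<open>n\<^sup>-\<^sup>1 I\<^sub>n\<close> converges to the closure of the points
  \<open>(inf U(e), sup U(e))\<close>, \<open>e \<in> E\<close>, together with the diagonal. The formula for \<open>H\<^sub>n\<close> can only fail when
  a vertex \<open>j \<le> n\<close> is, for every \<open>m > n\<close>, extremal among the left (or right) endpoints of the edges of
  \<open>H\<^sub>m\<close> with a given trace on \<open>{1..n} - {j}\<close>. By exchangeability each of the \<open>m - n + 1\<close> vertices that
  are \<open>j\<close> or larger than \<open>n\<close> plays this role equally often, so this has probability zero.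

  For surjectivity, \<open>H\<^sub>N\<close> has the law of a uniform relabelling of its sorted version, independent of
  it. Compactness yields laws \<open>q\<^sub>n\<close> on \<open>InSy n\<close> that are consistent under uniform erasing and whose
  relabellings have the laws of the \<open>H\<^sub>n\<close>; running the erasing backwards as a Markov chain realises
  them by an erased-interval process.
\<close>

section \<open>Permutations built by insertion\<close>

text \<open>The obstacle is the boundary. The formula for \<open>H\<^sub>n\<close> uses strict
  inequalities, while the limit is a closed set, so a coordinate of one of its points may coincide
  with some \<open>U j\<close>, and edges approximating that point may or may not contain
  \<open>j\<close>. Conversely, the extremal vertices of an edge must not be end points of the
  limiting interval. Both difficulties concern one path at a time and are settled deterministically
  in the locale \<open>typical_path\<close>; probability only shows that almost every path is
  typical. There conditional expectations are avoided by counting: given \<open>I n\<close>, the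
  erasers before level \<open>n\<close> are uniform on a set of \<open>n!\<close> sequences that is
  in bijection with the permutations of \<open>{1..n}\<close>, so a probability is a weighted number
  of permutations. For surjectivity, an interval hypergraph can usually be sorted in several ways,
  for instance in reverse order, so sorting at every level separately need not give laws that are
  consistent under erasing. Sorting at one level \<open>N\<close> and erasing downwards is
  consistent below \<open>N\<close>, and this is why a limit in \<open>N\<close> is taken.\<close>

abbreviation label_pos :: "(nat \<Rightarrow> nat) \<Rightarrow> nat \<Rightarrow> nat \<Rightarrow> nat" where
  "label_pos h n i \<equiv> inv (perm_of h n) i"

lemma length_one_line [simp]: "length (one_line h n) = n"
  by (induction n) auto

lemma set_one_line: "set (one_line h n) = {1..n}"
proof (induction n)
  case (Suc n)
  have "set (take k xs) \<union> set (drop k xs) = set xs" for k and xs :: "nat list"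
    by (metis append_take_drop_id set_append)
  with Suc show ?case by (auto simp: atLeastAtMostSuc_conv)
qed simp

lemma distinct_one_line: "distinct (one_line h n)"
  by (rule card_distinct) (simp add: set_one_line)

lemma perm_of_permutes: "perm_of h n permutes {1..n}"
proof (rule bij_imp_permutes)
  have "bij_betw ((!) (one_line h n)) {..<n} {1..n}"
    by (rule bij_betw_nth) (auto simp: distinct_one_line set_one_line)
  moreover have "bij_betw (\<lambda>i. i - 1) {1..n} {..<n}"
    by (rule bij_betwI[where g = Suc]) auto
  ultimately have "bij_betw ((!) (one_line h n) \<circ> (\<lambda>i. i - 1)) {1..n} {1..n}"
    by (rule bij_betw_trans[rotated])
  then show "bij_betw (perm_of h n) {1..n} {1..n}"
    by (rule bij_betw_cong[THEN iffD1, rotated]) (auto simp: perm_of_def)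
qed (auto simp: perm_of_def)

lemma perm_of_label_pos [simp]: "perm_of h n (label_pos h n i) = i"
  by (rule permutes_inverses[OF perm_of_permutes])

lemma label_pos_perm_of [simp]: "label_pos h n (perm_of h n i) = i"
  by (rule permutes_inverses[OF perm_of_permutes])

lemma label_pos_eq_iff: "label_pos h n i = p \<longleftrightarrow> perm_of h n p = i"
  by auto

lemma label_pos_inj [simp]: "label_pos h n i = label_pos h n j \<longleftrightarrow> i = j"
  by (metis perm_of_label_pos)

lemma label_pos_in_iff: "label_pos h n i \<in> {1..n} \<longleftrightarrow> i \<in> {1..n}"
  using permutes_in_image[OF permutes_inv[OF perm_of_permutes]] .

lemma label_pos_bounds: "1 \<le> i \<Longrightarrow> i \<le> n \<Longrightarrow> 1 \<le> label_pos h n i \<and> label_pos h n i \<le> n"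
  using label_pos_in_iff[of h n i] by auto

lemma perm_of_image: "X \<subseteq> {1..n} \<Longrightarrow> perm_of h n ` X = {i \<in> {1..n}. label_pos h n i \<in> X}"
  using permutes_in_image[OF perm_of_permutes, of h n] by (force simp: image_iff)

lemma one_line_cong: "(\<And>m. 1 \<le> m \<Longrightarrow> m < n \<Longrightarrow> h m = h' m) \<Longrightarrow> one_line h n = one_line h' n"
proof (induction n)
  case (Suc n) then show ?case by (cases "n = 0") auto
qed simp

lemma perm_of_cong: "(\<And>m. 1 \<le> m \<Longrightarrow> m < n \<Longrightarrow> h m = h' m) \<Longrightarrow> perm_of h n = perm_of h' n"
  using one_line_cong[of n h h'] by (simp add: perm_of_def fun_eq_iff)

lemma label_pos_Suc_new:
  assumes "1 \<le> n" "h n \<in> {1..Suc n}"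
  shows "label_pos h (Suc n) (Suc n) = h n"
  unfolding label_pos_eq_iff using assms by (auto simp: perm_of_def nth_append)

text \<open>Inserting \<open>Suc n\<close> pushes the entries from place \<open>h n\<close> on one
  place to the right. Order preservation, monotonicity in time, the erasing identity and the
  martingale computation all come from this recursion.\<close>

lemma label_pos_Suc_old:
  assumes "i \<in> {1..n}" "h n \<in> {1..Suc n}"
  shows "label_pos h (Suc n) i = (if h n \<le> label_pos h n i then Suc (label_pos h n i) else label_pos h n i)"
proof -
  define p where "p = label_pos h n i"
  have p: "1 \<le> p" "p \<le> n" "perm_of h n p = i"
    using label_pos_bounds[of i n h] assms by (auto simp: p_def)
  then have l: "one_line h n ! (p - 1) = i" by (simp add: perm_of_def)
  have "perm_of h (Suc n) (if h n \<le> p then Suc p else p) = i"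
  proof (cases "h n \<le> p")
    case True
    then have "p - (h n - 1) = Suc (p - h n)" "h n - 1 + (p - h n) = p - 1" using assms by auto
    then show ?thesis using assms True p l by (auto simp: perm_of_def nth_append min_def)
  next
    case False
    then show ?thesis using assms p l by (auto simp: perm_of_def nth_append min_def)
  qed
  then show ?thesis unfolding label_pos_eq_iff p_def .
qed

lemma label_pos_mono_Suc:
  assumes "i \<in> {1..n}" "j \<in> {1..n}" "h n \<in> {1..Suc n}"
  shows "label_pos h (Suc n) i < label_pos h (Suc n) j \<longleftrightarrow> label_pos h n i < label_pos h n j"
  using assms by (simp add: label_pos_Suc_old)

section \<open>Interval systems, interval hypergraphs and erasing\<close>

lemma InSy_iff:
  "J \<in> InSy n \<longleftrightarrow> {} \<in> J \<and> (\<forall>j\<in>{1..n}. {j} \<in> J) \<and>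
     (\<forall>e\<in>J. e = {} \<or> (\<exists>a b. 1 \<le> a \<and> a \<le> b \<and> b \<le> n \<and> e = {a..b}))"
proof -
  have "interval_wrt {(i, j). i \<in> {1..n} \<and> j \<in> {1..n} \<and> i \<le> j} {1..n} e \<longleftrightarrow>
     (e = {} \<or> (\<exists>a b. 1 \<le> a \<and> a \<le> b \<and> b \<le> n \<and> e = {a..b}))" (is "?L \<longleftrightarrow> ?R") for e
  proof
    assume L: ?L
    show ?R
    proof (cases "e = {}")
      case False
      from L have sub: "e \<subseteq> {1..n}" by (simp add: interval_wrt_def)
      then have fin: "finite e" by (rule finite_subset) simp
      have M: "Min e \<in> e" "Max e \<in> e" using fin False by auto
      have "e = {Min e..Max e}"
      proof
        show "{Min e..Max e} \<subseteq> e"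
        proof
          fix c assume "c \<in> {Min e..Max e}"
          with M sub have "c \<in> {1..n}" "Min e \<in> {1..n}" "Max e \<in> {1..n}" "Min e \<le> c" "c \<le> Max e" by fastforce+
          with L M show "c \<in> e" unfolding interval_wrt_def by blast
        qed
      qed (use fin in auto)
      moreover have "1 \<le> Min e" "Min e \<le> Max e" "Max e \<le> n" using M sub fin by fastforce+
      ultimately show ?thesis by blast
    qed simp
  qed (auto simp: interval_wrt_def)
  then show ?thesis by (simp add: InSy_def interval_hypergraph_wrt_def)
qed

lemma InSy_intervalD: "J \<in> InSy n \<Longrightarrow> a \<le> b \<Longrightarrow> {a..b} \<in> J \<Longrightarrow> 1 \<le> a \<and> b \<le> n"
  by (fastforce simp: InSy_iff)

lemma InSy_cases:
  assumes "J \<in> InSy n" "e \<in> J" "e \<noteq> {}"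
  obtains a b where "1 \<le> a" "a \<le> b" "b \<le> n" "e = {a..b}"
  using assms by (auto simp: InSy_iff)

lemma InSy_subset: "J \<in> InSy n \<Longrightarrow> e \<in> J \<Longrightarrow> e \<subseteq> {1..n}"
  by (fastforce simp: InSy_iff)

lemma finite_InSy: "finite (InSy n)"
  by (rule finite_subset[of _ "Pow (Pow {1..n})"]) (use InSy_subset in blast, simp)

lemma finite_InHy: "finite (InHy n)"
  by (rule finite_subset[of _ "Pow (Pow {1..n})"])
     (auto simp: InHy_def interval_hypergraph_wrt_def interval_wrt_def)

lemma InSy_1: "J \<in> InSy 1 \<longleftrightarrow> J = {{}, {1}}"
proof
  assume J: "J \<in> InSy 1"
  then have "e = {} \<or> e = {1}" if "e \<in> J" for e using InSy_subset[OF J that] by auto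
  then show "J = {{}, {1}}" using J by (auto simp: InSy_iff)
next
  have "{1} = {1..1::nat}" by simp
  moreover assume "J = {{}, {1}}"
  ultimately show "J \<in> InSy 1" unfolding InSy_iff by (metis atLeastAtMost_singleton insertE insertI1 insertI2 le_refl singletonD)
qed

lemma InSy_nonempty: "{{}} \<union> {{j} | j. j \<in> {1..n}} \<in> InSy n"
  unfolding InSy_iff by (auto, metis atLeastAtMost_singleton le_refl)

lemma erase_system_InSy:
  assumes "J \<in> InSy (Suc n)" "k \<in> {1..Suc n}"
  shows "erase_system J k \<in> InSy n"
  unfolding InSy_iff
proof (intro conjI ballI)
  show "{} \<in> erase_system J k" by (simp add: erase_system_def)
next
  fix j assume j: "j \<in> {1..n}"
  \<comment> \<open>The singleton \<open>{j}\<close> is its own image if the erased point lies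
    behind it; otherwise it is the image of \<open>{Suc j}\<close>, shifted to the left.\<close>
  have "{j} = erase_point j j k \<and> {j..j} \<in> J" if "j < k"
    using j that assms by (auto simp: erase_point_def InSy_iff)
  moreover have "{j} = erase_point (Suc j) (Suc j) k \<and> {Suc j..Suc j} \<in> J" if "k \<le> j"
    using j that assms by (auto simp: erase_point_def InSy_iff)
  ultimately show "{j} \<in> erase_system J k"
    unfolding erase_system_def using linorder_not_le by blast
next
  fix e assume "e \<in> erase_system J k"
  then consider "e = {}" | a b where "a \<le> b" "{a..b} \<in> J" "e = erase_point a b k"
    by (auto simp: erase_system_def)
  then show "e = {} \<or> (\<exists>a b. 1 \<le> a \<and> a \<le> b \<and> b \<le> n \<and> e = {a..b})"
  proof cases
    case (2 a b)
    with InSy_intervalD[OF assms(1) 2(1,2)] have ab: "1 \<le> a" "b \<le> Suc n" by auto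
    show ?thesis
    proof (cases "e = {}")
      case False
      moreover obtain a' b' where "e = {a'..b'}" "1 \<le> a'" "b' \<le> n"
      proof -
        consider "k < a" | "a \<le> k" "k \<le> b" "a \<noteq> b" | "b < k"
          using 2 False by (fastforce simp: erase_point_def split: if_splits)
        then show ?thesis
        proof cases
          case 1 then show ?thesis using that[of "a-1" "b-1"] 2 ab assms by (auto simp: erase_point_def)
        next
          case mid: 2 then show ?thesis using that[of "a" "b-1"] 2 ab assms by (auto simp: erase_point_def)
        next
          case 3 then show ?thesis using that[of "a" "b"] 2 ab assms by (auto simp: erase_point_def)
        qed
      qed
      ultimately show ?thesis by auto
    qed simp
  qed simp
qed

text \<open>The witnessing order is the usual one carried over by \<open>p\<close>: vertices are
  compared by their places \<open>inv p i\<close>, and the relabelled interval consists of the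
  vertices whose place lies in \<open>{a..b}\<close>.\<close>

lemma permute_InHy:
  assumes p: "p permutes {1..n}" and J: "J \<in> InSy n"
  shows "permute_hypergraph p J \<in> InHy n"
proof -
  define l where "l = {(i, j). i \<in> {1..n} \<and> j \<in> {1..n} \<and> inv p i \<le> inv p j}"
  have inj: "inv p i = inv p j \<longleftrightarrow> i = j" for i j by (metis permutes_inverses(1)[OF p])
  have "linear_order_on {1..n} l"
    unfolding order_on_defs
    by (auto simp: l_def refl_on_def antisym_def trans_def total_on_def inj)
  moreover have "interval_hypergraph_wrt l n (permute_hypergraph p J)"
    unfolding interval_hypergraph_wrt_def
  proof (intro conjI ballI)
    show "{} \<in> permute_hypergraph p J" using J by (auto simp: permute_hypergraph_def InSy_iff)
  next
    fix j assume "j \<in> {1..n}"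
    then have "inv p j \<in> {1..n}" using permutes_in_image[OF permutes_inv[OF p]] by blast
    then have "{inv p j} \<in> J" "p ` {inv p j} = {j}"
      using J permutes_inverses[OF p] by (auto simp: InSy_iff)
    then show "{j} \<in> permute_hypergraph p J" by (force simp: permute_hypergraph_def)
  next
    fix e assume "e \<in> permute_hypergraph p J"
    then obtain e' where e': "e' \<in> J" "e = p ` e'" by (auto simp: permute_hypergraph_def)
    show "interval_wrt l {1..n} e"
    proof (cases "e' = {}")
      case False
      then obtain a b where ab: "1 \<le> a" "a \<le> b" "b \<le> n" "e' = {a..b}"
        using InSy_cases[OF J e'(1)] by metis
      have "e \<subseteq> {1..n}"
      proof -
        have "e' \<subseteq> {1..n}" using ab by auto
        then have "p ` e' \<subseteq> p ` {1..n}" by (rule image_mono)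
        then show ?thesis using e' permutes_image[OF p] by simp
      qed
      moreover have "i \<in> e \<longleftrightarrow> inv p i \<in> {a..b}" for i
        unfolding e'(2) ab(4) using permutes_inverses[OF p] by (metis imageE imageI)
      ultimately show ?thesis by (auto simp: interval_wrt_def l_def)
    qed (simp add: e' interval_wrt_def)
  qed
  ultimately show ?thesis by (auto simp: InHy_def)
qed

lemma restrict_hypergraph_restrict: "n \<le> m \<Longrightarrow> restrict_hypergraph (restrict_hypergraph G m) n = restrict_hypergraph G n"
proof -
  assume "n \<le> m"
  then have "{1..n} \<inter> ({1..m} \<inter> e) = {1..n} \<inter> e" for e by auto
  then show ?thesis unfolding restrict_hypergraph_def by (simp add: Setcompr_eq_image image_image)
qed

lemma permute_hypergraph_image: "permute_hypergraph p G = (`) p ` G"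
  by (auto simp: permute_hypergraph_def)

lemma permute_hypergraph_comp: "permute_hypergraph p (permute_hypergraph q G) = permute_hypergraph (p \<circ> q) G"
  by (simp add: permute_hypergraph_image image_image comp_def)

text \<open>The position of a vertex is the size of its initial segment.\<close>

lemma InHy_sort:
  assumes "G \<in> InHy n"
  obtains p where "p permutes {1..n}" "permute_hypergraph p G \<in> InSy n"
proof -
  obtain l where l: "linear_order_on {1..n} l" "interval_hypergraph_wrt l n G"
    using assms by (auto simp: InHy_def)
  have refl: "i \<in> {1..n} \<Longrightarrow> (i, i) \<in> l" and tr: "(i, j) \<in> l \<Longrightarrow> (j, k) \<in> l \<Longrightarrow> (i, k) \<in> l"
    and as: "(i, j) \<in> l \<Longrightarrow> (j, i) \<in> l \<Longrightarrow> i = j"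
    and tot: "i \<in> {1..n} \<Longrightarrow> j \<in> {1..n} \<Longrightarrow> (i, j) \<in> l \<or> (j, i) \<in> l" for i j k
    using l(1) unfolding order_on_defs refl_on_def trans_def antisym_def total_on_def by metis+
  define D where "D i = {j \<in> {1..n}. (j, i) \<in> l}" for i
  define p where "p i = (if i \<in> {1..n} then card (D i) else i)" for i
  have mono: "(i, j) \<in> l \<longleftrightarrow> p i \<le> p j" if ij: "i \<in> {1..n}" "j \<in> {1..n}" for i j
  proof
    assume "(i, j) \<in> l"
    then have "D i \<subseteq> D j" unfolding D_def using tr by blast
    then show "p i \<le> p j" using ij by (auto simp: p_def D_def intro!: card_mono)
  next
    assume le: "p i \<le> p j"
    show "(i, j) \<in> l"
    proof (rule ccontr)
      assume n: "(i, j) \<notin> l"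
      then have "(j, i) \<in> l" using tot ij by blast
      \<comment> \<open>The initial segment of \<open>i\<close> contains \<open>i\<close> itself,
        that of \<open>j\<close> does not; hence the inclusion is strict.\<close>
      then have "D j \<subset> D i" unfolding D_def using tr n refl ij by blast
      then have "card (D j) < card (D i)" by (intro psubset_card_mono) (auto simp: D_def)
      then show False using le ij by (simp add: p_def)
    qed
  qed
  have "inj_on p {1..n}"
    by (rule inj_onI) (metis mono as le_refl)
  moreover have "p ` {1..n} \<subseteq> {1..n}"
  proof (safe, goal_cases)
    case (1 x i)
    have "card (D i) \<le> card {1..n}" by (rule card_mono) (auto simp: D_def)
    moreover have "i \<in> D i" using refl 1 by (simp add: D_def)
    then have "card (D i) > 0" by (simp add: D_def card_gt_0_iff) blast
    ultimately show ?case using 1 by (simp add: p_def)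
  qed
  ultimately have "bij_betw p {1..n} {1..n}"
    by (simp add: bij_betw_def endo_inj_surj)
  then have p: "p permutes {1..n}"
    by (rule bij_imp_permutes) (auto simp: p_def)
  have "permute_hypergraph p G \<in> InSy n"
    unfolding InSy_def mem_Collect_eq interval_hypergraph_wrt_def
  proof (intro conjI ballI)
    show "{} \<in> permute_hypergraph p G" using l(2) by (auto simp: permute_hypergraph_def interval_hypergraph_wrt_def)
  next
    fix j assume j: "j \<in> {1..n}"
    then have "inv p j \<in> {1..n}" using permutes_in_image[OF permutes_inv[OF p]] by blast
    then have "{inv p j} \<in> G" using l(2) by (auto simp: interval_hypergraph_wrt_def)
    moreover have "p ` {inv p j} = {j}" using permutes_inverses[OF p] by auto
    ultimately show "{j} \<in> permute_hypergraph p G" by (force simp: permute_hypergraph_def)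
  next
    fix e assume "e \<in> permute_hypergraph p G"
    then obtain e' where e': "e' \<in> G" "e = p ` e'" by (auto simp: permute_hypergraph_def)
    then have iv: "interval_wrt l {1..n} e'" using l(2) by (auto simp: interval_hypergraph_wrt_def)
    then have sub: "e' \<subseteq> {1..n}" by (simp add: interval_wrt_def)
    show "interval_wrt {(i, j). i \<in> {1..n} \<and> j \<in> {1..n} \<and> i \<le> j} {1..n} e"
      unfolding interval_wrt_def
    proof (intro conjI ballI impI)
      show "e \<subseteq> {1..n}" using e' sub image_mono[OF sub, of p] permutes_image[OF p] by simp
    next
      fix a b c assume abc: "a \<in> e" "b \<in> e" "c \<in> {1..n}"
        "(a, c) \<in> {(i, j). i \<in> {1..n} \<and> j \<in> {1..n} \<and> i \<le> j} \<and> (c, b) \<in> {(i, j). i \<in> {1..n} \<and> j \<in> {1..n} \<and> i \<le> j}"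
      obtain a' b' where ab': "a' \<in> e'" "b' \<in> e'" "a = p a'" "b = p b'" using abc e' by auto
      obtain c' where c': "c' \<in> {1..n}" "c = p c'" using abc permutes_image[OF p] by blast
      have "(a', c') \<in> l" "(c', b') \<in> l" using abc ab' c' sub mono by auto
      then have "c' \<in> e'" using iv ab' c' unfolding interval_wrt_def by blast
      then show "c \<in> e" using e' c' by auto
    qed
  qed
  with p that show ?thesis by blast
qed

text \<open>Vertex \<open>Suc n\<close> stands at the erased place. An old vertex at place
  \<open>p\<close> stands at \<open>p\<close> or \<open>Suc p\<close> after the insertion, and
  comparing this with \<open>{a..b}\<close> gives exactly the three cases of
  \<open>erase_point\<close>.\<close>

lemma restrict_permute:
  assumes J: "J \<in> InSy (Suc n)" and k: "h n \<in> {1..Suc n}"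
  shows "restrict_hypergraph (permute_hypergraph (perm_of h (Suc n)) J) n =
    permute_hypergraph (perm_of h n) (erase_system J (h n))"
proof -
  have key: "{1..n} \<inter> perm_of h (Suc n) ` {a..b} = perm_of h n ` erase_point a b (h n)"
    if ab: "1 \<le> a" "a \<le> b" "b \<le> Suc n" for a b
  proof -
    have sub: "erase_point a b (h n) \<subseteq> {1..n}"
      using ab k by (auto simp: erase_point_def)
    have sub2: "{a..b} \<subseteq> {1..Suc n}" using ab by auto
    have "label_pos h (Suc n) i \<in> {a..b} \<longleftrightarrow> label_pos h n i \<in> erase_point a b (h n)" if "i \<in> {1..n}" for i
      using label_pos_bounds[of i n h] that ab k by (auto simp: label_pos_Suc_old erase_point_def)
    then have "{i \<in> {1..n}. label_pos h (Suc n) i \<in> {a..b}} = {i \<in> {1..n}. label_pos h n i \<in> erase_point a b (h n)}"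
      by blast
    moreover have "{1..n} \<inter> {i \<in> {1..Suc n}. P i} = {i \<in> {1..n}. P i}" for P by auto
    ultimately show ?thesis unfolding perm_of_image[OF sub] perm_of_image[OF sub2] by metis
  qed
  show ?thesis
  proof (intro equalityI subsetI)
    fix e assume "e \<in> restrict_hypergraph (permute_hypergraph (perm_of h (Suc n)) J) n"
    then obtain e' where e': "e' \<in> J" "e = {1..n} \<inter> perm_of h (Suc n) ` e'"
      by (auto simp: restrict_hypergraph_def permute_hypergraph_def)
    show "e \<in> permute_hypergraph (perm_of h n) (erase_system J (h n))"
    proof (cases "e' = {}")
      case True then show ?thesis using e' by (auto simp: permute_hypergraph_def erase_system_def)
    next
      case False
      then obtain a b where ab: "1 \<le> a" "a \<le> b" "b \<le> Suc n" "e' = {a..b}" using InSy_cases[OF J e'(1)] by metis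
      then have "erase_point a b (h n) \<in> erase_system J (h n)" using e' unfolding erase_system_def by blast
      then show ?thesis using e' ab key unfolding permute_hypergraph_def by blast
    qed
  next
    fix e assume "e \<in> permute_hypergraph (perm_of h n) (erase_system J (h n))"
    then consider "e = {}" | a b where "a \<le> b" "{a..b} \<in> J" "e = perm_of h n ` erase_point a b (h n)"
      unfolding permute_hypergraph_def erase_system_def by blast
    then show "e \<in> restrict_hypergraph (permute_hypergraph (perm_of h (Suc n)) J) n"
    proof cases
      case 1
      have "{} \<in> J" using J by (simp add: InSy_iff)
      with 1 show ?thesis by (force simp: restrict_hypergraph_def permute_hypergraph_def)
    next
      case 2
      then have "e = {1..n} \<inter> perm_of h (Suc n) ` {a..b}" using key InSy_intervalD[OF J 2(1,2)] by simp
      then show ?thesis using 2 unfolding restrict_hypergraph_def permute_hypergraph_def by blast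
    qed
  qed
qed

section \<open>Eraser sequences as a code for permutations\<close>

abbreviation erasers :: "nat \<Rightarrow> (nat \<Rightarrow> nat) set" where
  "erasers n \<equiv> PiE {1..<n} (\<lambda>m. {1..Suc m})"

lemma erasers_Suc:
  assumes "1 \<le> n"
  shows "erasers (Suc n) = (\<lambda>(e, k). e(n := k)) ` (erasers n \<times> {1..Suc n})"
    and "inj_on (\<lambda>(e, k). e(n := k)) (erasers n \<times> {1..Suc n})"
proof -
  have eq: "{1..<Suc n} = insert n {1..<n}" using assms by auto
  show "erasers (Suc n) = (\<lambda>(e, k). e(n := k)) ` (erasers n \<times> {1..Suc n})"
    unfolding eq PiE_insert_eq by (auto simp: image_iff intro!: bexI)
  show "inj_on (\<lambda>(e, k). e(n := k)) (erasers n \<times> {1..Suc n})"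
  proof (rule inj_onI, clarify, rule conjI)
    fix e k e' k' assume e: "e \<in> erasers n" "e' \<in> erasers n" and eq: "e(n := k) = e'(n := k')"
    show "k = k'" using fun_cong[OF eq, of n] by simp
    have "e i = e' i" for i
      using fun_cong[OF eq, of i] PiE_arb[OF e(1), of i] PiE_arb[OF e(2), of i]
      by (cases "i = n") auto
    then show "e = e'" by auto
  qed
qed

lemma sum_erasers_Suc:
  assumes "1 \<le> n"
  shows "(\<Sum>e\<in>erasers (Suc n). f e) = (\<Sum>e\<in>erasers n. \<Sum>k\<in>{1..Suc n}. f (e(n := k)))"
  unfolding erasers_Suc(1)[OF assms] sum.reindex[OF erasers_Suc(2)[OF assms]]
  by (simp only: sum.cartesian_product case_prod_unfold comp_def)

lemma finite_erasers [simp]: "finite (erasers n)"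
  by (intro finite_PiE) auto

lemma card_erasers: "card (erasers n) = fact n"
proof (induction n)
  case (Suc n)
  show ?case
  proof (cases "n = 0")
    case False
    have "card (erasers (Suc n)) = card (erasers n \<times> {1..Suc n})"
      using False by (subst erasers_Suc(1)) (simp, rule card_image, rule erasers_Suc(2), simp)
    then show ?thesis using Suc by (simp add: card_cartesian_product)
  qed simp
qed simp

lemma eraser_le: "e \<in> erasers n \<Longrightarrow> 1 \<le> m \<Longrightarrow> m < n \<Longrightarrow> e m \<in> {1..Suc m}"
  by (auto simp: PiE_iff)

text \<open>The erasers can be read off from the permutation: the last one is the place of the
  largest entry, and deleting this entry gives the previous permutation.\<close>

lemma perm_of_inj_erasers: "inj_on (\<lambda>e. perm_of e n) (erasers n)"
proof (induction n)
  case 0 then show ?case by simp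
next
  case (Suc n)
  show ?case
  proof (cases "n = 0")
    case False
    show ?thesis
    proof (rule inj_onI)
      fix e e' assume e: "e \<in> erasers (Suc n)" "e' \<in> erasers (Suc n)" and eq: "perm_of e (Suc n) = perm_of e' (Suc n)"
      have k: "e n \<in> {1..Suc n}" "e' n \<in> {1..Suc n}" using e False by (auto simp: PiE_iff)
      have en: "e n = e' n" using label_pos_Suc_new[of n e] label_pos_Suc_new[of n e'] k False eq by simp
      have "label_pos e n i = label_pos e' n i" if "i \<in> {1..n}" for i
        using label_pos_Suc_old[of i n e, OF that k(1)] label_pos_Suc_old[of i n e', OF that k(2)] eq en
        by (simp split: if_splits)
      then have lp: "label_pos e n i = label_pos e' n i" for i
        using permutes_not_in[OF permutes_inv[OF perm_of_permutes], of i n] by metis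
      have "perm_of e n = perm_of e' n"
        using lp by (intro ext) (metis label_pos_eq_iff lp)
      \<comment> \<open>The induction hypothesis is about functions on \<open>{1..<n}\<close>, while
        \<open>e\<close> also has a value at \<open>n\<close>; the permutation at level
        \<open>n\<close> does not depend on that value.\<close>
      moreover have "perm_of e n = perm_of (restrict e {1..<n}) n" "perm_of e' n = perm_of (restrict e' {1..<n}) n"
        by (rule perm_of_cong; simp)+
      moreover have "restrict e {1..<n} \<in> erasers n" "restrict e' {1..<n} \<in> erasers n"
        using e by (auto simp: PiE_iff)
      ultimately have "restrict e {1..<n} = restrict e' {1..<n}" using inj_onD[OF Suc.IH] by metis
      then have "e i = e' i" if "i \<in> {1..<n}" for i using that by (metis restrict_apply')
      moreover have "e i = e' i" if "i \<notin> {1..<Suc n}" for i using e that by (auto simp: PiE_iff extensional_def)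
      ultimately show "e = e'" using en by (metis (no_types, lifting) ext atLeastLessThan_iff less_Suc_eq)
    qed
  qed (auto simp: inj_on_def)
qed

text \<open>Injectivity plus equal cardinality \<open>n!\<close>. Through this bijection uniform
  erasers become a uniform permutation.\<close>

lemma bij_erasers: "bij_betw (\<lambda>e. perm_of e n) (erasers n) {p. p permutes {1..n}}"
proof -
  have "(\<lambda>e. perm_of e n) ` erasers n \<subseteq> {p. p permutes {1..n}}" using perm_of_permutes by auto
  moreover have "card ((\<lambda>e. perm_of e n) ` erasers n) = card {p. p permutes {1..n}}"
    using card_image[OF perm_of_inj_erasers[of n]] card_erasers[of n] card_permutations[of "{1..n}" n] by simp
  ultimately have "(\<lambda>e. perm_of e n) ` erasers n = {p. p permutes {1..n}}"
    by (intro card_subset_eq finite_permutations) auto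
  then show ?thesis using perm_of_inj_erasers by (simp add: bij_betw_def)
qed

section \<open>Scaling limits along typical paths\<close>

lemma l1_dist_nonneg: "0 \<le> l1_dist p q"
  by (simp add: l1_dist_def)

lemma l1_dist_triangle: "l1_dist p r \<le> l1_dist p q + l1_dist q r"
  by (simp add: l1_dist_def)

lemma l1_dist_commute: "l1_dist p q = l1_dist q p"
  by (simp add: l1_dist_def)

lemma dist_le_l1: "dist p q \<le> l1_dist p q"
  by (cases p, cases q) (simp add: dist_Pair_Pair dist_real_def l1_dist_def sqrt_sum_squares_le_sum_abs)

lemma l1_le_dist: "l1_dist p q \<le> 2 * dist p q"
proof -
  have "\<bar>fst p - fst q\<bar> \<le> dist p q" "\<bar>snd p - snd q\<bar> \<le> dist p q"
    using dist_fst_le[of p q] dist_snd_le[of p q] by (auto simp: dist_real_def)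
  then show ?thesis by (simp add: l1_dist_def)
qed

text \<open>The reals are only conditionally complete, so the suprema and infima in
  \<open>d_haus\<close> are meaningful only once boundedness is known. Here the pointwise conditions
  supply it.\<close>

lemma d_haus_bounds:
  assumes "K \<noteq> {}" "L \<noteq> {}"
    and 1: "\<And>p. p \<in> K \<Longrightarrow> \<exists>q\<in>L. l1_dist p q \<le> C"
    and 2: "\<And>q. q \<in> L \<Longrightarrow> \<exists>p\<in>K. l1_dist p q \<le> C"
  shows "0 \<le> d_haus K L" "d_haus K L \<le> C"
proof -
  have bdd: "bdd_below (g ` S)" if "\<And>x. 0 \<le> g x" for g :: "real \<times> real \<Rightarrow> real" and S
    by (rule bdd_belowI[of _ 0]) (use that in auto)
  have A: "(INF q\<in>L. l1_dist p q) \<le> C" if "p \<in> K" for p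
    using 1[OF that] cINF_lower2[OF bdd] l1_dist_nonneg by metis
  have B: "(INF p\<in>K. l1_dist p q) \<le> C" if "q \<in> L" for q
    using 2[OF that] cINF_lower2[of "\<lambda>p. l1_dist p q", OF bdd] l1_dist_nonneg by metis
  show "d_haus K L \<le> C"
    unfolding d_haus_def using A B assms(1,2) by (auto intro!: cSUP_least)
  obtain p where p: "p \<in> K" using assms(1) by blast
  have "0 \<le> (INF q\<in>L. l1_dist p q)" using assms(2) by (intro cINF_greatest l1_dist_nonneg)
  also have "\<dots> \<le> (SUP p\<in>K. INF q\<in>L. l1_dist p q)"
    by (rule cSUP_upper[OF p]) (use A in \<open>auto intro!: bdd_aboveI[of _ C]\<close>)
  finally show "0 \<le> d_haus K L" unfolding d_haus_def by linarith
qed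

lemma d_haus_lessD:
  assumes "K \<noteq> {}" "L \<noteq> {}" "K \<subseteq> {0..1} \<times> {0..1}" "L \<subseteq> {0..1} \<times> {0..1}" and less: "d_haus K L < c"
  shows "p \<in> K \<Longrightarrow> \<exists>q\<in>L. l1_dist p q < c" "q \<in> L \<Longrightarrow> \<exists>p\<in>K. l1_dist p q < c"
proof -
  have bdd: "bdd_below (g ` S)" if "\<And>x. 0 \<le> g x" for g :: "real \<times> real \<Rightarrow> real" and S
    by (rule bdd_belowI[of _ 0]) (use that in auto)
  \<comment> \<open>The \<open>l1\<close> diameter of the unit square; it bounds the infima over
    which the suprema in \<open>d_haus\<close> are taken.\<close>
  have le2: "l1_dist p q \<le> 2" if "p \<in> {0..1} \<times> {0..1}" "q \<in> {0..1} \<times> {0..1}" for p q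
    using that by (auto simp: l1_dist_def)
  have A: "(INF q\<in>L. l1_dist p q) \<le> 2" if "p \<in> K" for p
  proof -
    obtain q where "q \<in> L" using assms(2) by blast
    then show ?thesis using that assms(3,4) by (intro cINF_lower2[of _ _ q] bdd l1_dist_nonneg le2) auto
  qed
  have B: "(INF p\<in>K. l1_dist p q) \<le> 2" if "q \<in> L" for q
  proof -
    obtain p where "p \<in> K" using assms(1) by blast
    then show ?thesis using that assms(3,4) by (intro cINF_lower2[of _ _ p] bdd l1_dist_nonneg le2) auto
  qed
  show "\<exists>q\<in>L. l1_dist p q < c" if p: "p \<in> K"
  proof -
    have "(INF q\<in>L. l1_dist p q) \<le> (SUP p\<in>K. INF q\<in>L. l1_dist p q)"
      by (rule cSUP_upper[OF p]) (use A in \<open>auto intro!: bdd_aboveI[of _ 2]\<close>)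
    then have "(INF q\<in>L. l1_dist p q) < c" using less unfolding d_haus_def by linarith
    then show ?thesis using cINF_less_iff[OF assms(2) bdd, of "l1_dist p" c] l1_dist_nonneg by blast
  qed
  show "\<exists>p\<in>K. l1_dist p q < c" if q: "q \<in> L"
  proof -
    have "(INF p\<in>K. l1_dist p q) \<le> (SUP q\<in>L. INF p\<in>K. l1_dist p q)"
      by (rule cSUP_upper[OF q]) (use B in \<open>auto intro!: bdd_aboveI[of _ 2]\<close>)
    then have "(INF p\<in>K. l1_dist p q) < c" using less unfolding d_haus_def by linarith
    then show ?thesis using cINF_less_iff[OF assms(1) bdd, of "\<lambda>p. l1_dist p q" c] l1_dist_nonneg by blast
  qed
qed

lemma diag_nonempty: "diag \<noteq> {}"
  by (auto simp: diag_def intro!: exI[of _ 0])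

lemma scaled_system_unit:
  assumes "1 \<le> n" "J \<in> InSy n"
  shows "scaled_system n J \<subseteq> {0..1} \<times> {0..1}"
proof
  fix p assume "p \<in> scaled_system n J"
  then consider a b where "p = ((real a - 1) / real n, real b / real n)" "a \<le> b" "{a..b} \<in> J" | "p \<in> diag"
    unfolding scaled_system_def by blast
  then show "p \<in> {0..1} \<times> {0..1}"
  proof cases
    case (1 a b)
    have "1 \<le> a" "b \<le> n" using InSy_intervalD[OF assms(2) 1(2,3)] by auto
    with 1 assms(1) show ?thesis by (auto simp: divide_le_eq_1)
  qed (auto simp: diag_def)
qed

text \<open>Both limits are close to the same scaled system, hence to each other, and the second is
  closed. Exchanging the roles gives the uniqueness that the \<open>THE\<close> in
  \<open>limit_system\<close> requires.\<close>

lemma scaling_limit_subset: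
  assumes J: "\<And>n. 1 \<le> n \<Longrightarrow> J n \<in> InSy n" and K: "scaling_limit J K" and L: "scaling_limit J L"
  shows "K \<subseteq> L"
proof
  fix p assume p: "p \<in> K"
  have K': "K \<noteq> {}" "L \<noteq> {}" "K \<subseteq> {0..1} \<times> {0..1}" "L \<subseteq> {0..1} \<times> {0..1}" "compact L"
    using K L diag_nonempty by (auto simp: scaling_limit_def InSy_inf_def)
  have "\<exists>r\<in>L. dist r p < e" if e: "e > 0" for e
  proof -
    have "\<forall>\<^sub>F n in sequentially. d_haus (scaled_system n (J n)) X < e / 2" if "scaling_limit J X" for X
      using that half_gt_zero[OF e] unfolding scaling_limit_def by (metis order_tendstoD(2))
    note this[OF K] this[OF L]
    then have "\<forall>\<^sub>F n in sequentially. d_haus (scaled_system n (J n)) K < e / 2 \<and> d_haus (scaled_system n (J n)) L < e / 2 \<and> 1 \<le> n"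
      using eventually_ge_at_top[of 1] by eventually_elim auto
    then obtain n where n: "d_haus (scaled_system n (J n)) K < e / 2" "d_haus (scaled_system n (J n)) L < e / 2" "1 \<le> n"
      by (metis (mono_tags, lifting) eventually_happens' sequentially_bot)
    have S: "scaled_system n (J n) \<noteq> {}" "scaled_system n (J n) \<subseteq> {0..1} \<times> {0..1}"
      using scaled_system_unit[OF n(3) J[OF n(3)]] diag_nonempty by (auto simp: scaled_system_def)
    obtain q where q: "q \<in> scaled_system n (J n)" "l1_dist q p < e / 2"
      using d_haus_lessD(2)[OF S(1) K'(1) S(2) K'(3) n(1)] p by blast
    obtain r where r: "r \<in> L" "l1_dist q r < e / 2"
      using d_haus_lessD(1)[OF S(1) K'(2) S(2) K'(4) n(2)] q by blast
    have "dist r p \<le> l1_dist q r + l1_dist q p"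
      using dist_le_l1[of r p] l1_dist_triangle[of r p q] by (simp add: l1_dist_commute)
    then show ?thesis using q r by (intro bexI[of _ r]) auto
  qed
  then have "p \<in> closure L" by (simp add: closure_approachable)
  then show "p \<in> L" using K'(5) by (simp add: compact_imp_closed)
qed

lemma limit_systemI:
  assumes "\<And>n. 1 \<le> n \<Longrightarrow> J n \<in> InSy n" "scaling_limit J K"
  shows "limit_system J = K"
  unfolding limit_system_def using assms(2)
  by (rule the_equality) (use scaling_limit_subset[of J, OF assms(1)] assms(2) in blast)

text \<open>End points, as places, of the intervals whose relabelling meets \<open>V\<close> in
  \<open>f\<close>. With \<open>V = {1..n} - {j}\<close> this set depends on \<open>p\<close> only
  through the places of the vertices in \<open>V\<close>, so it is unchanged when \<open>j\<close>
  is exchanged with a vertex beyond \<open>n\<close>.\<close>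

definition trace_ends :: "(nat \<Rightarrow> nat) \<Rightarrow> nat set set \<Rightarrow> nat set \<Rightarrow> nat set \<Rightarrow> (nat \<times> nat) set" where
  "trace_ends p J V f = {(a, b). a \<le> b \<and> {a..b} \<in> J \<and> p ` {a..b} \<inter> V = f}"

lemma finite_trace_ends: "J \<in> InSy n \<Longrightarrow> finite (trace_ends p J V f)"
  by (rule finite_subset[of _ "{1..n} \<times> {1..n}"]) (auto simp: trace_ends_def dest!: InSy_intervalD)

lemma finite_min_gap:
  assumes "finite A" "0 < (d::real)"
  obtains d' where "0 < d'" "d' \<le> d" "\<And>a. a \<in> A \<Longrightarrow> 0 < a \<Longrightarrow> d' \<le> a"
proof
  let ?A = "insert d {a \<in> A. 0 < a}"
  show "0 < Min ?A" using assms by (subst Min_gr_iff) auto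
  show "Min ?A \<le> d" "\<And>a. a \<in> A \<Longrightarrow> 0 < a \<Longrightarrow> Min ?A \<le> a" using assms by auto
qed

lemma finite_arg_min:
  assumes "finite S" "S \<noteq> {}"
  obtains l where "l \<in> S" "\<And>i. i \<in> S \<Longrightarrow> (u l :: real) \<le> u i"
proof -
  have "Min (u ` S) \<in> u ` S" using assms by (intro Min_in) auto
  then obtain l where "l \<in> S" "u l = Min (u ` S)" by auto
  with assms(1) show ?thesis using that[of l] by simp
qed

lemma finite_arg_max:
  assumes "finite S" "S \<noteq> {}"
  obtains l where "l \<in> S" "\<And>i. i \<in> S \<Longrightarrow> (u i :: real) \<le> u l"
  using finite_arg_min[OF assms, of "\<lambda>i. - u i"] by auto

text \<open>One realisation of an erased-interval process off the exceptional null sets; no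
  probability is involved.\<close>

locale erased_path =
  fixes J :: "nat \<Rightarrow> nat set set" and h :: "nat \<Rightarrow> nat"
  assumes J_InSy: "1 \<le> n \<Longrightarrow> J n \<in> InSy n"
    and h_range: "1 \<le> n \<Longrightarrow> h n \<in> {1..Suc n}"
    and J_erase: "1 \<le> n \<Longrightarrow> J n = erase_system (J (Suc n)) (h n)"
begin

abbreviation pos :: "nat \<Rightarrow> nat \<Rightarrow> nat" where "pos n i \<equiv> label_pos h n i"

definition H :: "nat \<Rightarrow> nat set set" where
  "H n = permute_hypergraph (perm_of h n) (J n)"

lemma H_restrict_Suc: "1 \<le> n \<Longrightarrow> H n = restrict_hypergraph (H (Suc n)) n"
  unfolding H_def by (simp only: restrict_permute[OF J_InSy h_range] le_SucI J_erase[of n, symmetric])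

lemma H_subset: "1 \<le> n \<Longrightarrow> e \<in> H n \<Longrightarrow> e \<subseteq> {1..n}"
  using InSy_subset[OF J_InSy] permutes_image[OF perm_of_permutes[of h n]]
  unfolding H_def permute_hypergraph_def by blast

lemma H_InHy: "1 \<le> n \<Longrightarrow> H n \<in> InHy n"
  unfolding H_def by (rule permute_InHy[OF perm_of_permutes J_InSy])

lemma H_restrict: "1 \<le> n \<Longrightarrow> n \<le> m \<Longrightarrow> H n = restrict_hypergraph (H m) n"
proof (induction m)
  case (Suc m)
  show ?case
  proof (cases "n = Suc m")
    case True
    have "{1..Suc m} \<inter> e = e" if "e \<in> H (Suc m)" for e using H_subset[of "Suc m" e] that by auto
    then show ?thesis unfolding True restrict_hypergraph_def by (simp add: Setcompr_eq_image)
  next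
    case False
    then have "H n = restrict_hypergraph (H m) n" "H m = restrict_hypergraph (H (Suc m)) m"
      using Suc H_restrict_Suc[of m] by auto
    then show ?thesis using restrict_hypergraph_restrict[of n m "H (Suc m)"] Suc.prems False by simp
  qed
qed simp

lemma H_trace: "1 \<le> n \<Longrightarrow> n \<le> m \<Longrightarrow> e \<in> H m \<Longrightarrow> e \<inter> {1..n} \<in> H n"
  using H_restrict[of n m] by (auto simp: restrict_hypergraph_def)

lemma H_lift:
  assumes "1 \<le> n" "n \<le> m" "e \<in> H n"
  obtains e' where "e' \<in> H m" "e' \<inter> {1..n} = e"
proof -
  have "e \<in> {{1..n} \<inter> e' | e'. e' \<in> H m}"
    using H_restrict[OF assms(1,2)] assms(3) unfolding restrict_hypergraph_def by simp
  then show ?thesis using that by blast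
qed

lemma H_intervalI:
  assumes "1 \<le> n" "a \<le> b" "{a..b} \<in> J n"
  shows "{i \<in> {1..n}. pos n i \<in> {a..b}} \<in> H n" "perm_of h n ` {a..b} = {i \<in> {1..n}. pos n i \<in> {a..b}}"
proof -
  have "{a..b} \<subseteq> {1..n}" using InSy_subset[OF J_InSy] assms by blast
  from perm_of_image[OF this, of h] show "perm_of h n ` {a..b} = {i \<in> {1..n}. pos n i \<in> {a..b}}" .
  with assms(3) show "{i \<in> {1..n}. pos n i \<in> {a..b}} \<in> H n" unfolding H_def permute_hypergraph_def by blast
qed

lemma H_intervalE:
  assumes "1 \<le> n" "e \<in> H n" "e \<noteq> {}"
  obtains a b where "1 \<le> a" "a \<le> b" "b \<le> n" "{a..b} \<in> J n" "e = {i \<in> {1..n}. pos n i \<in> {a..b}}"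
proof -
  obtain e' where e': "e' \<in> J n" "e = perm_of h n ` e'" "e' \<noteq> {}"
    using assms unfolding H_def permute_hypergraph_def by blast
  then obtain a b where "1 \<le> a" "a \<le> b" "b \<le> n" "e' = {a..b}" using InSy_cases[OF J_InSy] assms(1) by metis
  then show ?thesis using that e' perm_of_image[of "{a..b}" n h] by auto
qed

lemma trace_endsD:
  assumes "1 \<le> m" "(a, b) \<in> trace_ends (perm_of h m) (J m) V f"
  shows "{i \<in> {1..m}. pos m i \<in> {a..b}} \<in> H m" "{i \<in> {1..m}. pos m i \<in> {a..b}} \<inter> V = f" "1 \<le> a" "a \<le> b" "b \<le> m"
proof -
  have ab: "a \<le> b" "{a..b} \<in> J m" "perm_of h m ` {a..b} \<inter> V = f" using assms(2) by (auto simp: trace_ends_def)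
  then show "{i \<in> {1..m}. pos m i \<in> {a..b}} \<in> H m" "{i \<in> {1..m}. pos m i \<in> {a..b}} \<inter> V = f" "1 \<le> a" "a \<le> b" "b \<le> m"
    using H_intervalI[OF assms(1) ab(1,2)] InSy_intervalD[OF J_InSy[OF assms(1)] ab(1,2)] by simp_all
qed

lemma trace_endsI:
  assumes "1 \<le> m" "e \<in> H m" "e \<inter> V = f" "f \<noteq> {}"
  obtains a b where "(a, b) \<in> trace_ends (perm_of h m) (J m) V f" "e = {i \<in> {1..m}. pos m i \<in> {a..b}}"
proof -
  have "e \<noteq> {}" using assms by auto
  then obtain a b where "1 \<le> a" "a \<le> b" "b \<le> m" "{a..b} \<in> J m" "e = {i \<in> {1..m}. pos m i \<in> {a..b}}"
    by (rule H_intervalE[OF assms(1,2)])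
  then show ?thesis using that[of a b] H_intervalI(2)[OF assms(1), of a b] assms(3) by (auto simp: trace_ends_def)
qed

lemma pos_less_iff:
  assumes "i \<in> {1..n}" "j \<in> {1..n}" "n \<le> m"
  shows "pos m i < pos m j \<longleftrightarrow> pos n i < pos n j"
  using assms(3)
proof (induction m rule: dec_induct)
  case (step m)
  then have "pos (Suc m) i < pos (Suc m) j \<longleftrightarrow> pos m i < pos m j"
    using assms h_range[of m] by (intro label_pos_mono_Suc) auto
  with step show ?case by simp
qed simp

lemma pos_mono: "1 \<le> i \<Longrightarrow> i \<le> n \<Longrightarrow> n \<le> m \<Longrightarrow> pos n i \<le> pos m i"
proof (induction m)
  case (Suc m)
  then show ?case using label_pos_Suc_old[of i m h] h_range[of m] by (cases "n = Suc m") auto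
qed simp

end

text \<open>In \<open>escape\<close> the selector \<open>c\<close> picks an extremal end among the
  edges with trace \<open>f\<close>, and the vertex standing there is not always \<open>j\<close>.
  \<open>Min\<close> of left ends and \<open>Max\<close> of right ends serve to push an edge beyond
  its extremal vertex; \<open>Max\<close> of left ends and \<open>Min\<close> of right ends serve to
  cut an extremal vertex off. A nonempty \<open>f\<close> ensures that the edges concerned are
  genuine intervals.\<close>

locale typical_path = erased_path +
  fixes U :: "nat \<Rightarrow> real"
  assumes U_lim: "1 \<le> i \<Longrightarrow> (\<lambda>n. real (pos n i) / real n) \<longlonglongrightarrow> U i"
    and U_inj: "inj_on U {1..}"
    and U_dense: "0 \<le> a \<Longrightarrow> a < b \<Longrightarrow> b \<le> 1 \<Longrightarrow> \<exists>i\<ge>1. a < U i \<and> U i < b"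
    and escape: "j \<in> {1..n} \<Longrightarrow> f \<subseteq> {1..n} - {j} \<Longrightarrow> f \<noteq> {} \<Longrightarrow>
      c \<in> {\<lambda>S. Min (fst ` S), \<lambda>S. Max (fst ` S), \<lambda>S. Min (snd ` S), \<lambda>S. Max (snd ` S)} \<Longrightarrow>
      \<exists>m>n. perm_of h m (c (trace_ends (perm_of h m) (J m) ({1..n} - {j}) f)) \<noteq> j"
begin

lemma U_range: "1 \<le> i \<Longrightarrow> 0 \<le> U i \<and> U i \<le> 1"
proof
  assume i: "1 \<le> i"
  show "0 \<le> U i" by (rule tendsto_lowerbound[OF U_lim[OF i]]) auto
  have "\<forall>\<^sub>F n in sequentially. real (pos n i) / real n \<le> 1"
    using eventually_ge_at_top[of i] by eventually_elim (use label_pos_bounds[of i _ h] i in \<open>auto simp: divide_le_eq_1\<close>)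
  then show "U i \<le> 1" by (rule tendsto_upperbound[OF U_lim[OF i]]) auto
qed

text \<open>The order of two vertices never changes with the level, so it passes to the limits as a
  weak inequality; distinctness of the limits makes it strict.\<close>

lemma U_less_iff:
  assumes "i \<in> {1..n}" "j \<in> {1..n}"
  shows "U i < U j \<longleftrightarrow> pos n i < pos n j"
proof -
  have le: "U i < U j" if "i \<in> {1..n}" "j \<in> {1..n}" "pos n i < pos n j" for i j
  proof -
    have "\<forall>\<^sub>F m in sequentially. real (pos m i) / real m \<le> real (pos m j) / real m"
      using eventually_ge_at_top[of n]
    proof eventually_elim
      case (elim m)
      then have "pos m i < pos m j" using pos_less_iff[of i n j m] that by simp
      then show ?case by (intro divide_right_mono) auto
    qed
    then have "U i \<le> U j" using that by (intro tendsto_le[OF _ U_lim U_lim]) auto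
    moreover have "U i \<noteq> U j" using U_inj that by (auto dest: inj_onD)
    ultimately show ?thesis by simp
  qed
  show ?thesis
  proof
    assume "U i < U j"
    then show "pos n i < pos n j" using le[of j i] assms by (metis label_pos_inj linorder_neqE_nat order.asym)
  qed (rule le[OF assms])
qed

lemma U_le_iff:
  assumes "i \<in> {1..n}" "j \<in> {1..n}"
  shows "U i \<le> U j \<longleftrightarrow> pos n i \<le> pos n j"
  using U_less_iff[OF assms(2,1)] by linarith

lemma H_convex:
  assumes "1 \<le> n" "e \<in> H n" "i \<in> e" "k \<in> e" "j \<in> {1..n}" "U i \<le> U j" "U j \<le> U k"
  shows "j \<in> e"
proof -
  have "e \<noteq> {}" using assms by auto
  then obtain a b where "e = {i \<in> {1..n}. pos n i \<in> {a..b}}" using H_intervalE[OF assms(1,2)] by metis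
  then show ?thesis using assms U_le_iff[of i n j] U_le_iff[of j n k] by auto
qed

section \<open>Edges on all of the natural numbers and their end points\<close>

definition E :: "nat set set" where
  "E = {e. e \<subseteq> {1..} \<and> (\<forall>n\<ge>1. e \<inter> {1..n} \<in> H n)}"

text \<open>The edge is prolonged one vertex at a time by dependent choice. The prolongations are
  traces of each other, so their union has all of them as traces; below level \<open>n\<close> the
  traces of \<open>e\<close> itself are edges.\<close>

lemma E_lift:
  assumes "1 \<le> n" "e \<in> H n"
  obtains e' where "e' \<in> E" "e' \<inter> {1..n} = e"
proof -
  have "\<exists>f. (f 0 = e \<and> f 0 \<in> H (n + 0)) \<and> (\<forall>k. f (Suc k) \<in> H (n + Suc k) \<and> f (Suc k) \<inter> {1..n + k} = f k)"
  proof -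
    have "\<exists>f. \<forall>k. (f k \<in> H (n + k) \<and> (k = 0 \<longrightarrow> f k = e)) \<and> f (Suc k) \<inter> {1..n + k} = f k"
    proof (rule dependent_nat_choice)
      show "\<exists>x. x \<in> H (n + 0) \<and> ((0::nat) = 0 \<longrightarrow> x = e)" using assms by auto
    next
      fix x and k :: nat assume "x \<in> H (n + k) \<and> (k = 0 \<longrightarrow> x = e)"
      then have "x \<in> H (n + k)" by simp
      then obtain e' where "e' \<in> H (Suc (n + k))" "e' \<inter> {1..n+k} = x"
        using H_lift[of "n + k" "Suc (n + k)" x] assms(1) by auto
      then show "\<exists>y. (y \<in> H (n + Suc k) \<and> (Suc k = 0 \<longrightarrow> y = e)) \<and> y \<inter> {1..n + k} = x" by auto
    qed
    then obtain f where "\<forall>k. (f k \<in> H (n + k) \<and> (k = 0 \<longrightarrow> f k = e)) \<and> f (Suc k) \<inter> {1..n + k} = f k" by blast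
    then show ?thesis by (intro exI[of _ f]) (metis add_0_right)
  qed
  then obtain f where f0: "f 0 = e" and f: "\<And>k. f k \<in> H (n + k)" "\<And>k. f (Suc k) \<inter> {1..n + k} = f k"
    using assms by (metis not0_implies_Suc)
  have tr: "f (k + d) \<inter> {1..n + k} = f k" for k d
  proof (induction d)
    case 0 then show ?case using H_subset[OF _ f(1), of k] assms(1) by auto
  next
    case (Suc d)
    have "f (k + Suc d) \<inter> {1..n + k} = f (Suc (k + d)) \<inter> {1..n + (k + d)} \<inter> {1..n+k}" by auto
    also have "\<dots> = f k" using f(2)[of "k + d"] Suc by simp
    finally show ?case .
  qed
  define g where "g = (\<Union>k. f k)"
  have g: "g \<inter> {1..n + k} = f k" for k
  proof
    show "g \<inter> {1..n + k} \<subseteq> f k"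
    proof
      fix x assume x: "x \<in> g \<inter> {1..n + k}"
      then obtain d where d: "x \<in> f d" by (auto simp: g_def)
      show "x \<in> f k"
      proof (cases "k \<le> d")
        case True
        then have "f d \<inter> {1..n + k} = f k" using tr[of k "d - k"] by simp
        then show ?thesis using d x by blast
      next
        case False
        then have "f k \<inter> {1..n + d} = f d" using tr[of d "k - d"] by simp
        then show ?thesis using d by blast
      qed
    qed
    show "f k \<subseteq> g \<inter> {1..n + k}" using H_subset[OF _ f(1), of k] assms(1) by (auto simp: g_def)
  qed
  have "g \<inter> {1..m} \<in> H m" if "1 \<le> m" for m
  proof (cases "n \<le> m")
    case True
    then obtain k where "m = n + k" using le_iff_add by blast
    then show ?thesis using g[of k] f(1)[of k] by simp
  next
    case False
    then have "{1..m} = {1..n + 0} \<inter> {1..m}" by auto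
    then have "g \<inter> {1..m} = f 0 \<inter> {1..m}" using g[of 0] by blast
    then show ?thesis using H_trace[of m n "f 0"] f(1)[of 0] that False by simp
  qed
  moreover have "f k \<subseteq> {1..}" for k using g[of k] by auto
  then have "g \<subseteq> {1..}" unfolding g_def by blast
  ultimately have "g \<in> E" by (simp add: E_def)
  then show ?thesis using that[of g] g[of 0] f0 by simp
qed

lemma E_ge1: "e \<in> E \<Longrightarrow> i \<in> e \<Longrightarrow> 1 \<le> i"
  by (auto simp: E_def)

lemma E_convex:
  assumes e: "e \<in> E" "i \<in> e" "k \<in> e" and j: "1 \<le> j" "U i \<le> U j" "U j \<le> U k"
  shows "j \<in> e"
proof -
  define m where "m = Max {i, j, k}"
  have m: "i \<le> m" "j \<le> m" "k \<le> m" by (auto simp: m_def)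
  have i1: "1 \<le> i" "1 \<le> k" using e E_ge1 by auto
  have "e \<inter> {1..m} \<in> H m" using e j m unfolding E_def by auto
  then have "j \<in> e \<inter> {1..m}" using m i1 j e by (intro H_convex[of m "e \<inter> {1..m}" i k j]) auto
  then show ?thesis by simp
qed

text \<open>Meaningful for nonempty edges; the infimum and supremum of the empty set of reals carry
  no information.\<close>

definition lo :: "nat set \<Rightarrow> real" where "lo e = Inf (U ` e)"
definition hi :: "nat set \<Rightarrow> real" where "hi e = Sup (U ` e)"

lemma lo_le: "e \<in> E \<Longrightarrow> i \<in> e \<Longrightarrow> lo e \<le> U i"
  unfolding lo_def by (rule cINF_lower) (auto intro!: bdd_belowI[of _ 0] dest: E_ge1 U_range)

lemma hi_ge: "e \<in> E \<Longrightarrow> i \<in> e \<Longrightarrow> U i \<le> hi e"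
  unfolding hi_def by (rule cSUP_upper) (auto intro!: bdd_aboveI[of _ 1] dest: E_ge1 U_range)

lemma lo_lessD: "e \<noteq> {} \<Longrightarrow> lo e < x \<Longrightarrow> \<exists>i\<in>e. U i < x"
  unfolding lo_def using cInf_lessD[of "U ` e" x] by auto

lemma hi_lessD: "e \<noteq> {} \<Longrightarrow> x < hi e \<Longrightarrow> \<exists>i\<in>e. x < U i"
  unfolding hi_def using less_cSupD[of "U ` e" x] by auto

lemma lo_hi_range:
  assumes "e \<in> E" "e \<noteq> {}"
  shows "0 \<le> lo e" "lo e \<le> hi e" "hi e \<le> 1"
proof -
  show "0 \<le> lo e" unfolding lo_def using assms U_range E_ge1 by (intro cINF_greatest) auto
  show "hi e \<le> 1" unfolding hi_def using assms U_range E_ge1 by (intro cSUP_least) auto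
  obtain i where "i \<in> e" using assms by blast
  then show "lo e \<le> hi e" using lo_le[OF assms(1)] hi_ge[OF assms(1)] order_trans by blast
qed

lemma E_memI:
  assumes "e \<in> E" "e \<noteq> {}" "1 \<le> i" "lo e < U i" "U i < hi e"
  shows "i \<in> e"
proof -
  obtain s t where "s \<in> e" "t \<in> e" "U s < U i" "U i < U t" using lo_lessD[OF assms(2,4)] hi_lessD[OF assms(2,5)] by auto
  then show ?thesis using E_convex[OF assms(1), of s t i] assms(3) by simp
qed

text \<open>The first \<open>n\<close> limit positions are \<open>d\<close>-dense in the unit
  interval. As edges are convex, the trace on \<open>{1..n}\<close> then determines the ends of an
  edge up to \<open>d\<close>.\<close>

definition mesh :: "nat \<Rightarrow> real \<Rightarrow> bool" where
  "mesh n d \<longleftrightarrow> (\<forall>a b. 0 \<le> a \<longrightarrow> b \<le> 1 \<longrightarrow> a + d \<le> b \<longrightarrow> (\<exists>i\<in>{1..n}. a < U i \<and> U i < b))"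

lemma meshD: "mesh n d \<Longrightarrow> 0 \<le> a \<Longrightarrow> b \<le> 1 \<Longrightarrow> a + d \<le> b \<Longrightarrow> \<exists>i\<in>{1..n}. a < U i \<and> U i < b"
  by (simp add: mesh_def)

text \<open>The unit interval is cut into \<open>k\<close> cells so short that every interval of
  length \<open>d\<close> contains a whole cell; density provides a vertex in each of these finitely
  many cells.\<close>

lemma eventually_mesh:
  assumes "0 < d"
  shows "\<forall>\<^sub>F n in sequentially. mesh n d"
proof -
  obtain k :: nat where k: "k > 0" "2 / real k < d"
  proof -
    obtain k :: nat where "2 / d < real k" using reals_Archimedean2 by blast
    moreover from this assms have "k > 0" by (metis divide_pos_pos gr0I of_nat_0 order.asym zero_less_numeral)
    ultimately show ?thesis using that[of k] assms by (simp add: field_simps)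
  qed
  have "\<forall>t\<in>{..<k}. \<exists>i\<ge>1. real t / real k < U i \<and> U i < (real t + 1) / real k"
  proof
    fix t assume t: "t \<in> {..<k}"
    then have "(real t + 1) / real k \<le> 1" using k by (simp add: field_simps)
    then show "\<exists>i\<ge>1. real t / real k < U i \<and> U i < (real t + 1) / real k"
      using k by (intro U_dense) (auto simp: divide_strict_right_mono)
  qed
  then obtain g where g: "\<And>t. t < k \<Longrightarrow> 1 \<le> g t \<and> real t / real k < U (g t) \<and> U (g t) < (real t + 1) / real k"
    by (metis lessThan_iff)
  define N where "N = Max (g ` {..<k})"
  have "mesh n d" if n: "N \<le> n" for n
    unfolding mesh_def
  proof (intro allI impI)
    fix a b :: real assume ab: "0 \<le> a" "b \<le> 1" "a + d \<le> b"
    \<comment> \<open>The first grid point at or behind \<open>a\<close> is \<open>t / k\<close>;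
      the cell starting there ends before \<open>a + 2 / k\<close>, hence before
      \<open>b\<close>.\<close>
    define t where "t = nat \<lceil>a * real k\<rceil>"
    have t0: "a * real k \<le> real t" "real t < a * real k + 1"
      using ab k unfolding t_def by (auto simp: of_nat_nat) linarith
    have t1: "a \<le> real t / real k" using t0 k by (simp add: field_simps)
    have "real t + 1 < a * real k + 2" using t0 by simp
    then have "(real t + 1) / real k < (a * real k + 2) / real k" using k by (intro divide_strict_right_mono) auto
    then have "(real t + 1) / real k < a + 2 / real k" using k by (simp add: add_divide_distrib)
    then have t2: "(real t + 1) / real k < b" using k ab by linarith
    then have "(real t + 1) / real k < 1" using ab by linarith
    then have "t < k" using k by (simp add: field_simps)
    moreover from this have "g t \<le> N" unfolding N_def by (intro Max_ge) auto
    ultimately have "g t \<in> {1..n}" "a < U (g t)" "U (g t) < b"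
      using g[of t] t1 t2 n by auto
    then show "\<exists>i\<in>{1..n}. a < U i \<and> U i < b" by blast
  qed
  then show ?thesis by (auto simp: eventually_sequentially)
qed

text \<open>Convergence is given for each vertex separately, but places are monotone in
  \<open>U\<close>. A vertex is squeezed between mesh vertices within \<open>d / 2\<close>, and only
  finitely many of these have to be close to their limits. This is the argument that makes pointwise
  convergence of monotone functions uniform.\<close>

lemma eventually_uniform:
  assumes "0 < d"
  shows "\<forall>\<^sub>F n in sequentially. \<forall>i\<in>{1..n}. \<bar>real (pos n i) / real n - U i\<bar> \<le> d"
proof -
  obtain N where N: "mesh N (d/2)" using eventually_mesh[of "d/2"] assms by (metis eventually_happens' half_gt_zero sequentially_bot)
  have "\<forall>\<^sub>F n in sequentially. \<forall>s\<in>{1..N}. \<bar>real (pos n s) / real n - U s\<bar> < d/2"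
    using tendstoD[OF U_lim, of _ "d/2"] assms by (intro eventually_ball_finite) (auto simp: dist_real_def)
  then show ?thesis using eventually_ge_at_top[of "max 1 N"]
  proof eventually_elim
    case (elim n)
    show ?case
    proof
      fix i assume i: "i \<in> {1..n}"
      have r: "0 \<le> U i" "U i \<le> 1" using U_range i by auto
      have p: "real (pos n i) / real n \<le> 1" "0 \<le> real (pos n i) / real n"
        using label_pos_bounds[of i n h] i by (auto simp: divide_le_eq_1)
      have "real (pos n i) / real n \<le> U i + d"
      proof (cases "U i + d/2 \<le> 1")
        case True
        then obtain s where s: "s \<in> {1..N}" "U i < U s" "U s < U i + d/2" using meshD[OF N, of "U i" "U i + d/2"] r by auto
        then have "pos n i < pos n s" using U_less_iff[of i n s] i elim(2) by auto
        then have "real (pos n i) / real n \<le> real (pos n s) / real n" by (intro divide_right_mono) auto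
        moreover have "\<bar>real (pos n s) / real n - U s\<bar> < d/2" using elim(1) s by blast
        ultimately show ?thesis using s by linarith
      qed (use p assms in linarith)
      moreover have "U i - d \<le> real (pos n i) / real n"
      proof (cases "0 \<le> U i - d/2")
        case True
        then obtain s where s: "s \<in> {1..N}" "U i - d/2 < U s" "U s < U i" using meshD[OF N, of "U i - d/2" "U i"] r by auto
        then have "pos n s < pos n i" using U_less_iff[of s n i] i elim(2) by auto
        then have "real (pos n s) / real n \<le> real (pos n i) / real n" by (intro divide_right_mono) auto
        moreover have "\<bar>real (pos n s) / real n - U s\<bar> < d/2" using elim(1) s by blast
        ultimately show ?thesis using s by linarith
      qed (use p assms in linarith)
      ultimately show "\<bar>real (pos n i) / real n - U i\<bar> \<le> d" by (simp add: abs_le_iff)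
    qed
  qed
qed

text \<open>If \<open>lo e\<close> were more than \<open>d\<close> to the left of
  \<open>U l\<close>, a mesh vertex strictly between a vertex of \<open>e\<close> and
  \<open>l\<close> would lie in \<open>e\<close> by convexity, against the minimality of
  \<open>l\<close>. The right end and edges with empty trace are treated in the same way.\<close>

lemma lo_trace:
  assumes e: "e \<in> E" and m: "mesh n d" and l: "l \<in> e \<inter> {1..n}" "\<And>i. i \<in> e \<inter> {1..n} \<Longrightarrow> U l \<le> U i"
  shows "lo e \<le> U l" "U l \<le> lo e + d"
proof -
  show "lo e \<le> U l" using lo_le e l by auto
  show "U l \<le> lo e + d"
  proof (rule ccontr)
    assume "\<not> U l \<le> lo e + d"
    then have "lo e < U l - d" by linarith
    then obtain t where t: "t \<in> e" "U t < U l - d" using lo_lessD[of e] l by blast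
    then obtain i where i: "i \<in> {1..n}" "U t < U i" "U i < U l"
      using meshD[OF m, of "U t" "U l"] U_range E_ge1[OF e] l by (metis IntD1 add.commute le_diff_eq less_eq_real_def)
    then have "i \<in> e" using E_convex[OF e t(1), of l i] l by auto
    then show False using l(2)[of i] i by auto
  qed
qed

lemma hi_trace:
  assumes e: "e \<in> E" and m: "mesh n d" and l: "l \<in> e \<inter> {1..n}" "\<And>i. i \<in> e \<inter> {1..n} \<Longrightarrow> U i \<le> U l"
  shows "U l \<le> hi e" "hi e \<le> U l + d"
proof -
  show "U l \<le> hi e" using hi_ge e l by auto
  show "hi e \<le> U l + d"
  proof (rule ccontr)
    assume "\<not> hi e \<le> U l + d"
    then have "U l + d < hi e" by linarith
    then obtain t where t: "t \<in> e" "U l + d < U t" using hi_lessD[of e] l by blast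
    then obtain i where i: "i \<in> {1..n}" "U l < U i" "U i < U t"
      using meshD[OF m, of "U l" "U t"] U_range E_ge1[OF e] l by (metis IntD1 less_eq_real_def)
    then have "i \<in> e" using E_convex[OF e _ t(1), of l i] l by auto
    then show False using l(2)[of i] i by auto
  qed
qed

lemma lo_hi_short:
  assumes e: "e \<in> E" "e \<noteq> {}" and m: "mesh n d" and "e \<inter> {1..n} = {}"
  shows "hi e \<le> lo e + d"
proof (rule ccontr)
  assume "\<not> hi e \<le> lo e + d"
  then have "lo e < hi e - d" by linarith
  then obtain t where t: "t \<in> e" "U t < hi e - d" using lo_lessD[OF e(2)] by blast
  then have "U t + d < hi e" by linarith
  then obtain s where s: "s \<in> e" "U t + d < U s" using hi_lessD[OF e(2)] by blast
  then obtain i where i: "i \<in> {1..n}" "U t < U i" "U i < U s"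
    using meshD[OF m, of "U t" "U s"] U_range E_ge1[OF e(1)] t by (metis less_eq_real_def)
  then have "i \<in> e" using E_convex[OF e(1) t(1) s(1)] by auto
  then show False using i assms(4) by auto
qed

section \<open>The scaling limit of a typical path\<close>

definition K0 :: "(real \<times> real) set" where "K0 = {(lo e, hi e) | e. e \<in> E \<and> e \<noteq> {}}"
definition K :: "(real \<times> real) set" where "K = closure K0 \<union> diag"

lemma K_InSy_inf: "K \<in> InSy_inf"
proof -
  let ?T = "{(x, y). 0 \<le> x \<and> x \<le> y \<and> y \<le> (1::real)}"
  have "?T = {p. 0 \<le> fst p} \<inter> {p. fst p \<le> snd p} \<inter> {p. snd p \<le> 1}" by auto
  then have cT: "closed ?T" by (auto intro!: closed_Int closed_Collect_le continuous_intros)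
  have "?T \<subseteq> cbox (0, 0) (1, 1)" by (auto simp: cbox_Pair_eq)
  then have bT: "bounded ?T" by (rule bounded_subset[OF bounded_cbox])
  have "K0 \<subseteq> ?T" using lo_hi_range by (auto simp: K0_def)
  then have c: "closure K0 \<subseteq> ?T" using cT by (rule closure_minimal)
  have d: "diag \<subseteq> ?T" by (auto simp: diag_def)
  have "diag = (\<lambda>x. (x, x)) ` {0..1}" by (auto simp: diag_def)
  moreover have "compact ((\<lambda>x. (x, x)) ` {0..1::real})"
    by (intro compact_continuous_image continuous_intros compact_Icc)
  ultimately have "compact diag" by simp
  moreover have "compact (closure K0)" using c bT by (auto simp: compact_eq_bounded_closed intro: bounded_subset)
  ultimately have "compact K" unfolding K_def by (intro compact_Un)
  with c d show ?thesis unfolding InSy_inf_def K_def by auto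
qed

text \<open>The left end contributes \<open>3 * d\<close>: the uniform error, the shift
  \<open>1 / n\<close>, and the distance from the first vertex of the trace to the infimum. The
  right end has no shift and contributes \<open>2 * d\<close>.\<close>

lemma ends_close:
  assumes n: "1 \<le> n" and m: "mesh n d" and u: "\<And>i. i \<in> {1..n} \<Longrightarrow> \<bar>real (pos n i) / real n - U i\<bar> \<le> d"
    and dn: "1 / real n \<le> d"
    and e: "e \<in> E" and ab: "1 \<le> a" "a \<le> b" "b \<le> n" and eq: "e \<inter> {1..n} = {i \<in> {1..n}. pos n i \<in> {a..b}}"
  shows "l1_dist ((real a - 1) / real n, real b / real n) (lo e, hi e) \<le> 5 * d"
proof -
  define l r where "l = perm_of h n a" and "r = perm_of h n b"
  have pl: "pos n l = a" "pos n r = b" by (simp_all add: l_def r_def)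
  have lr: "l \<in> {1..n}" "r \<in> {1..n}"
    using label_pos_in_iff[of h n l] label_pos_in_iff[of h n r] ab pl by auto
  have le: "l \<in> e \<inter> {1..n}" "r \<in> e \<inter> {1..n}" using lr pl ab eq by auto
  have lm: "U l \<le> U i" if "i \<in> e \<inter> {1..n}" for i using U_le_iff[of l n i] lr that pl unfolding eq by auto
  have rm: "U i \<le> U r" if "i \<in> e \<inter> {1..n}" for i using U_le_iff[of i n r] lr that pl unfolding eq by auto
  have "\<bar>real a / real n - U l\<bar> \<le> d" "\<bar>real b / real n - U r\<bar> \<le> d"
    using u[OF lr(1)] u[OF lr(2)] pl by auto
  moreover have "(real a - 1) / real n = real a / real n - 1 / real n" by (simp add: diff_divide_distrib)
  moreover have "0 \<le> 1 / real n" by simp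
  ultimately show ?thesis
    using lo_trace[OF e m le(1) lm] hi_trace[OF e m le(2) rm] dn unfolding l1_dist_def fst_conv snd_conv by linarith
qed

lemma scaling_limit_K: "scaling_limit J K"
  unfolding scaling_limit_def
proof (intro conjI K_InSy_inf LIMSEQ_I)
  fix r :: real assume "0 < r"
  \<comment> \<open>The total error is at most \<open>7 * d\<close>: \<open>5 * d\<close> from
    \<open>ends_close\<close>, and \<open>2 * d\<close> for moving from the closure into
    \<open>K0\<close>, the \<open>l1\<close> distance being at most twice the Euclidean one.\<close>
  define d where "d = r / 8"
  have d: "0 < d" using \<open>0 < r\<close> by (simp add: d_def)
  have "\<forall>\<^sub>F n in sequentially. 1 / real n < d" using lim_1_over_n d by (rule order_tendstoD(2))
  then have "\<forall>\<^sub>F n in sequentially. norm (d_haus (scaled_system n (J n)) K - 0) < r"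
    using eventually_mesh[OF d] eventually_uniform[OF d] eventually_ge_at_top[of 1]
  proof eventually_elim
    case (elim n)
    note close = ends_close[OF elim(4,2) _ less_imp_le[OF elim(1)]]
    have refl: "l1_dist p p \<le> 7 * d" for p using d by (simp add: l1_dist_def)
    have 1: "\<exists>q\<in>K. l1_dist p q \<le> 7 * d" if p: "p \<in> scaled_system n (J n)" for p
    proof (cases "p \<in> diag")
      case True then show ?thesis using refl[of p] by (intro bexI[of _ p]) (auto simp: K_def)
    next
      case False
      then obtain a b where ab: "p = ((real a - 1) / real n, real b / real n)" "a \<le> b" "{a..b} \<in> J n"
        using p by (auto simp: scaled_system_def)
      obtain e where e: "e \<in> E" "e \<inter> {1..n} = {i \<in> {1..n}. pos n i \<in> {a..b}}"
        using E_lift[OF elim(4) H_intervalI(1)[OF elim(4) ab(2,3)]] by metis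
      have b: "1 \<le> a" "b \<le> n" using InSy_intervalD[OF J_InSy[OF elim(4)] ab(2,3)] by auto
      have "l1_dist p (lo e, hi e) \<le> 5 * d" unfolding ab(1) by (rule close) (use elim(3) e b ab in auto)
      moreover have "e \<noteq> {}"
      proof
        assume "e = {}"
        moreover have "perm_of h n a \<in> {i \<in> {1..n}. pos n i \<in> {a..b}}" using ab b label_pos_in_iff[of h n "perm_of h n a"] by auto
        ultimately show False using e(2) by blast
      qed
      ultimately show ?thesis using e d closure_subset[of K0] by (intro bexI[of _ "(lo e, hi e)"]) (auto simp: K_def K0_def)
    qed
    have 2: "\<exists>p\<in>scaled_system n (J n). l1_dist p q \<le> 7 * d" if q: "q \<in> K" for q
    proof (cases "q \<in> diag")
      case True then show ?thesis using refl[of q] by (intro bexI[of _ q]) (auto simp: scaled_system_def)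
    next
      case False
      then have "q \<in> closure K0" using q by (simp add: K_def)
      then obtain q' where q': "q' \<in> K0" "dist q' q < d" using d by (auto simp: closure_approachable)
      then obtain e where e: "e \<in> E" "e \<noteq> {}" "q' = (lo e, hi e)" by (auto simp: K0_def)
      have qq: "l1_dist q' q \<le> 2 * d" using l1_le_dist[of q' q] q' by linarith
      have "\<exists>p\<in>scaled_system n (J n). l1_dist p q' \<le> 5 * d"
      proof (cases "e \<inter> {1..n} = {}")
        case True
        \<comment> \<open>An edge without vertices up to \<open>n\<close> is at most
          \<open>d\<close> long, so it is represented by a point of the diagonal, which every scaled
          system contains.\<close>
        have "l1_dist (lo e, lo e) q' \<le> 5 * d" using lo_hi_short[OF e(1,2) elim(2) True] lo_hi_range[OF e(1,2)] d
          unfolding e l1_dist_def by simp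
        moreover have "(lo e, lo e) \<in> diag" using lo_hi_range[OF e(1,2)] by (auto simp: diag_def)
        ultimately show ?thesis by (auto simp: scaled_system_def)
      next
        case False
        have "e \<inter> {1..n} \<in> H n" using e elim(4) by (simp add: E_def)
        then obtain a b where ab: "1 \<le> a" "a \<le> b" "b \<le> n" "{a..b} \<in> J n" "e \<inter> {1..n} = {i \<in> {1..n}. pos n i \<in> {a..b}}"
          using H_intervalE[OF elim(4) _ False] by metis
        have "l1_dist ((real a - 1) / real n, real b / real n) q' \<le> 5 * d"
          unfolding e(3) by (rule close) (use elim(3) e ab in auto)
        moreover have "((real a - 1) / real n, real b / real n) \<in> scaled_system n (J n)"
          using ab unfolding scaled_system_def by blast
        ultimately show ?thesis by blast
      qed
      then obtain p where p: "p \<in> scaled_system n (J n)" "l1_dist p q' \<le> 5 * d" by blast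
      have "l1_dist p q \<le> 7 * d" using l1_dist_triangle[of p q q'] p qq by linarith
      then show ?thesis using p by blast
    qed
    have "K \<noteq> {}" "scaled_system n (J n) \<noteq> {}" using diag_nonempty by (auto simp: K_def scaled_system_def)
    from d_haus_bounds[OF this(2,1) 1 2] show ?case using d by (simp add: d_def)
  qed
  then show "\<exists>no. \<forall>n\<ge>no. norm (d_haus (scaled_system n (J n)) K - 0) < r"
    by (simp only: eventually_sequentially)
qed

text \<open>At some later level the leftmost start among edges with trace \<open>e - {l}\<close> on
  the other vertices is not the place of \<open>l\<close>. As a lift of \<open>e\<close> reaches
  \<open>l\<close>, it lies strictly to the left of \<open>l\<close>. The edge starting there also
  contains a vertex of \<open>e\<close> at or behind \<open>l\<close>, hence \<open>l\<close> by
  convexity, and so its trace is all of \<open>e\<close>.\<close>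

lemma extend_left:
  assumes n: "1 \<le> n" and e: "e \<in> H n" and l: "l \<in> e" "\<And>i. i \<in> e \<Longrightarrow> U l \<le> U i" and ne: "e \<noteq> {l}"
  obtains m e' t where "n < m" "e' \<in> H m" "e' \<inter> {1..n} = e" "t \<in> e'" "U t < U l"
proof -
  define f where "f = e - {l}"
  have en: "e \<subseteq> {1..n}" using H_subset[OF n e] .
  have f: "f \<subseteq> {1..n} - {l}" "f \<noteq> {}" "l \<in> {1..n}" using en l ne by (auto simp: f_def)
  obtain m where m: "n < m" "perm_of h m (Min (fst ` trace_ends (perm_of h m) (J m) ({1..n} - {l}) f)) \<noteq> l"
    using escape[OF f(3,1,2), of "\<lambda>S. Min (fst ` S)"] by auto
  define T where "T = trace_ends (perm_of h m) (J m) ({1..n} - {l}) f"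
  have m1: "1 \<le> m" using m n by simp
  have finT: "finite (fst ` T)" unfolding T_def using finite_trace_ends[OF J_InSy[OF m1]] by blast
  obtain e1 where e1: "e1 \<in> H m" "e1 \<inter> {1..n} = e" using H_lift[OF n _ e, of m] m by auto
  have "e1 \<inter> ({1..n} - {l}) = f" using e1 f_def by auto
  then obtain a b where ab: "(a, b) \<in> T" "e1 = {i \<in> {1..m}. pos m i \<in> {a..b}}"
    using trace_endsI[OF m1 e1(1) _ f(2)] unfolding T_def by metis
  have "l \<in> e1" using e1 l by auto
  then have "a \<le> pos m l" using ab by auto
  moreover have "Min (fst ` T) \<le> a" using ab finT by (force intro!: Min_le simp: image_iff)
  moreover have "Min (fst ` T) \<noteq> pos m l" using m(2) unfolding T_def by (metis perm_of_label_pos)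
  ultimately have lt: "Min (fst ` T) < pos m l" by simp
  have "Min (fst ` T) \<in> fst ` T" using finT ab by (intro Min_in) auto
  then obtain a' b' where ab': "(a', b') \<in> T" "a' = Min (fst ` T)" by auto
  define e2 where "e2 = {i \<in> {1..m}. pos m i \<in> {a'..b'}}"
  note D = trace_endsD[OF m1 ab'(1)[unfolded T_def], folded e2_def]
  obtain r where r: "r \<in> f" using f by blast
  have rm: "r \<in> {1..m}" "l \<in> {1..m}" using r f m by auto
  have "U l \<le> U r" using r l by (auto simp: f_def)
  then have "pos m l \<le> pos m r" using U_le_iff rm by blast
  moreover have "r \<in> e2" using r D(2) by blast
  ultimately have "l \<in> e2" using lt ab' rm unfolding e2_def by auto
  then have "e2 \<inter> {1..n} = insert l (e2 \<inter> ({1..n} - {l}))" using f by auto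
  then have "e2 \<inter> {1..n} = e" using D(2) l by (auto simp: f_def)
  moreover define t where "t = perm_of h m a'"
  have pt: "pos m t = a'" by (simp add: t_def)
  then have "t \<in> {1..m}" using label_pos_in_iff[of h m t] D by auto
  then have "t \<in> e2" "U t < U l" using pt D U_less_iff[of t m l] lt ab' rm by (auto simp: e2_def)
  ultimately show ?thesis using that D(1) m by blast
qed

text \<open>Mirror image of \<open>extend_left\<close>, with the rightmost right end.\<close>

lemma extend_right:
  assumes n: "1 \<le> n" and e: "e \<in> H n" and l: "l \<in> e" "\<And>i. i \<in> e \<Longrightarrow> U i \<le> U l" and ne: "e \<noteq> {l}"
  obtains m e' t where "n < m" "e' \<in> H m" "e' \<inter> {1..n} = e" "t \<in> e'" "U l < U t"
proof -
  define f where "f = e - {l}"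
  have en: "e \<subseteq> {1..n}" using H_subset[OF n e] .
  have f: "f \<subseteq> {1..n} - {l}" "f \<noteq> {}" "l \<in> {1..n}" using en l ne by (auto simp: f_def)
  obtain m where m: "n < m" "perm_of h m (Max (snd ` trace_ends (perm_of h m) (J m) ({1..n} - {l}) f)) \<noteq> l"
    using escape[OF f(3,1,2), of "\<lambda>S. Max (snd ` S)"] by auto
  define T where "T = trace_ends (perm_of h m) (J m) ({1..n} - {l}) f"
  have m1: "1 \<le> m" using m n by simp
  have finT: "finite (snd ` T)" unfolding T_def using finite_trace_ends[OF J_InSy[OF m1]] by blast
  obtain e1 where e1: "e1 \<in> H m" "e1 \<inter> {1..n} = e" using H_lift[OF n _ e, of m] m by auto
  have "e1 \<inter> ({1..n} - {l}) = f" using e1 f_def by auto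
  then obtain a b where ab: "(a, b) \<in> T" "e1 = {i \<in> {1..m}. pos m i \<in> {a..b}}"
    using trace_endsI[OF m1 e1(1) _ f(2)] unfolding T_def by metis
  have "l \<in> e1" using e1 l by auto
  then have "pos m l \<le> b" using ab by auto
  moreover have "b \<le> Max (snd ` T)" using ab finT by (force intro!: Max_ge simp: image_iff)
  moreover have "Max (snd ` T) \<noteq> pos m l" using m(2) unfolding T_def by (metis perm_of_label_pos)
  ultimately have lt: "pos m l < Max (snd ` T)" by simp
  have "Max (snd ` T) \<in> snd ` T" using finT ab by (intro Max_in) auto
  then obtain a' b' where ab': "(a', b') \<in> T" "b' = Max (snd ` T)" by auto
  define e2 where "e2 = {i \<in> {1..m}. pos m i \<in> {a'..b'}}"
  note D = trace_endsD[OF m1 ab'(1)[unfolded T_def], folded e2_def]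
  obtain r where r: "r \<in> f" using f by blast
  have rm: "r \<in> {1..m}" "l \<in> {1..m}" using r f m by auto
  have "U r \<le> U l" using r l by (auto simp: f_def)
  then have "pos m r \<le> pos m l" using U_le_iff rm by blast
  moreover have "r \<in> e2" using r D(2) by blast
  ultimately have "l \<in> e2" using lt ab' rm unfolding e2_def by auto
  then have "e2 \<inter> {1..n} = insert l (e2 \<inter> ({1..n} - {l}))" using f by auto
  then have "e2 \<inter> {1..n} = e" using D(2) l by (auto simp: f_def)
  moreover define t where "t = perm_of h m b'"
  have pt: "pos m t = b'" by (simp add: t_def)
  then have "t \<in> {1..m}" using label_pos_in_iff[of h m t] D by auto
  then have "t \<in> e2" "U l < U t" using pt D U_less_iff[of l m t] lt ab' rm by (auto simp: e2_def)
  ultimately show ?thesis using that D(1) m by blast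
qed

text \<open>Approximation of \<open>(x, y)\<close> by ends of edges, together with a property of
  their traces. The property is carried along so that vertices sitting exactly at \<open>x\<close>
  or \<open>y\<close> can be removed one after the other.\<close>

definition approx :: "real \<Rightarrow> real \<Rightarrow> nat \<Rightarrow> (nat set \<Rightarrow> bool) \<Rightarrow> bool" where
  "approx x y n P \<longleftrightarrow> (\<forall>\<epsilon>>0. \<exists>e\<in>E. e \<noteq> {} \<and> \<bar>lo e - x\<bar> < \<epsilon> \<and> \<bar>hi e - y\<bar> < \<epsilon> \<and> P (e \<inter> {1..n}))"

lemma approx_mono: "approx x y n P \<Longrightarrow> (\<And>s. P s \<Longrightarrow> Q s) \<Longrightarrow> approx x y n Q"
  unfolding approx_def by blast

text \<open>If an approximating edge contains \<open>j\<close>, then \<open>j\<close> is its first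
  vertex at every relevant level. By \<open>escape\<close> some edge with the same trace on the
  other vertices starts strictly behind \<open>j\<close>; it replaces the given one and differs from
  it only by \<open>j\<close> on \<open>{1..n'}\<close>.\<close>

lemma avoid_left:
  assumes xy: "x < y" and j: "j \<in> {1..n}" "U j = x" and App: "approx x y n P"
  shows "approx x y n (\<lambda>s. \<exists>s'. P s' \<and> s = s' - {j})"
  unfolding approx_def
proof (intro allI impI)
  fix \<epsilon> :: real assume eps: "0 < \<epsilon>"
  \<comment> \<open>The bound \<open>\<epsilon> / 4\<close> leaves room for up to three errors of
    size \<open>d\<close>; \<open>(y - x) / 8\<close> keeps \<open>x + d\<close> below
    \<open>hi e\<close>, so that a mesh vertex just behind \<open>x\<close> belongs to the
    edge.\<close>
  define d where "d = min (\<epsilon> / 4) ((y - x) / 8)"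
  have d: "0 < d" "d \<le> \<epsilon> / 4" "d \<le> (y - x) / 8" using eps xy min.cobounded1[of "\<epsilon> / 4" "(y - x) / 8"] min.cobounded2[of "\<epsilon> / 4" "(y - x) / 8"] unfolding d_def by auto
  obtain n' where n': "mesh n' d" "n \<le> n'"
    using eventually_conj[OF eventually_mesh[OF d(1)] eventually_ge_at_top[of n]] by (metis (mono_tags, lifting) eventually_happens' sequentially_bot)
  define V where "V = {1..n'} - {j}"
  have jn: "j \<in> {1..n'}" using j n' by auto
  have "\<forall>f\<in>Pow V - {{}}. \<exists>m>n'. perm_of h m (Max (fst ` trace_ends (perm_of h m) (J m) V f)) \<noteq> j"
    using escape[OF jn, of _ "\<lambda>S. Max (fst ` S)"] by (auto simp: V_def)
  then obtain M where M: "\<And>f. f \<subseteq> V \<Longrightarrow> f \<noteq> {} \<Longrightarrow> n' < M f \<and> perm_of h (M f) (Max (fst ` trace_ends (perm_of h (M f)) (J (M f)) V f)) \<noteq> j"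
    by (metis DiffI PowI singletonD)
  \<comment> \<open>The edge has to be chosen finely enough for the escape level of its trace, but
    the trace is known only afterwards. Therefore \<open>m0\<close> dominates the escape levels of
    all possible traces.\<close>
  define m0 where "m0 = Max (insert n' (M ` (Pow V - {{}})))"
  have m0: "M f \<le> m0" if "f \<subseteq> V" "f \<noteq> {}" for f
    unfolding m0_def using that by (intro Max_ge) (auto simp: V_def)
  \<comment> \<open>An edge whose left end is within \<open>d'\<close> of \<open>x\<close> contains
    no vertex up to \<open>m0\<close> with \<open>U i < x\<close>; so \<open>j\<close>, if it
    belongs to the edge, is its first vertex at all these levels.\<close>
  obtain d' where d': "0 < d'" "d' \<le> d" "\<And>a. a \<in> (\<lambda>i. x - U i) ` {1..m0} \<Longrightarrow> 0 < a \<Longrightarrow> d' \<le> a"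
    by (rule finite_min_gap[of "(\<lambda>i. x - U i) ` {1..m0}" d]) (use d in auto)
  obtain e where e: "e \<in> E" "e \<noteq> {}" "\<bar>lo e - x\<bar> < d'" "\<bar>hi e - y\<bar> < d'" "P (e \<inter> {1..n})"
    using App d'(1) unfolding approx_def by blast
  show "\<exists>e\<in>E. e \<noteq> {} \<and> \<bar>lo e - x\<bar> < \<epsilon> \<and> \<bar>hi e - y\<bar> < \<epsilon> \<and> (\<exists>s'. P s' \<and> e \<inter> {1..n} = s' - {j})"
  proof (cases "j \<in> e")
    case False
    then show ?thesis using e d' d by (intro bexI[of _ e] conjI exI[of _ "e \<inter> {1..n}"]) auto
  next
    case True
    define f where "f = e \<inter> V"
    have x0: "0 \<le> x" using j U_range by auto
    have h1: "hi e \<le> 1" using lo_hi_range e by auto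
    have "y - hi e < d'" using e(4) by (simp add: abs_less_iff)
    moreover have "8 * d \<le> y - x" using d(3) by simp
    ultimately have "x + d \<le> 1" using h1 d(1) d'(2) by linarith
    then obtain i0 where i0: "i0 \<in> {1..n'}" "x < U i0" "U i0 < x + d"
      using meshD[OF n'(1), of x "x + d"] x0 by auto
    have lox: "lo e \<le> x" using lo_le[OF e(1) True] j by simp
    have "i0 \<in> e" using i0 lox e(4) d d' by (intro E_memI e) auto
    then have i0f: "i0 \<in> f" using i0 j by (auto simp: f_def V_def)
    have f: "f \<subseteq> V" "f \<noteq> {}" using i0f by (auto simp: f_def)
    define m where "m = M f"
    have m: "n' < m" "m \<le> m0" "perm_of h m (Max (fst ` trace_ends (perm_of h m) (J m) V f)) \<noteq> j"
      using M[OF f] m0[OF f] by (auto simp: m_def)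
    define T where "T = trace_ends (perm_of h m) (J m) V f"
    have m1: "1 \<le> m" using m by simp
    have finT: "finite (fst ` T)" unfolding T_def using finite_trace_ends[OF J_InSy[OF m1]] by blast
    have em: "e \<inter> {1..m} \<in> H m" using e(1) m1 by (simp add: E_def)
    have "V \<subseteq> {1..m}" using m by (auto simp: V_def)
    then have "e \<inter> {1..m} \<inter> V = f" by (auto simp: f_def)
    then obtain a b where ab: "(a, b) \<in> T" "e \<inter> {1..m} = {i \<in> {1..m}. pos m i \<in> {a..b}}"
      using trace_endsI[OF m1 em _ f(2)] unfolding T_def by metis
    note D0 = trace_endsD[OF m1 ab(1)[unfolded T_def]]
    define t where "t = perm_of h m a"
    have pt: "pos m t = a" by (simp add: t_def)
    then have tm: "t \<in> {1..m}" using label_pos_in_iff[of h m t] D0 by auto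
    then have "t \<in> {i \<in> {1..m}. pos m i \<in> {a..b}}" using pt D0 by simp
    then have te: "t \<in> e" unfolding ab(2)[symmetric] by blast
    have jm: "j \<in> {1..m}" using jn m by auto
    have "j \<in> {i \<in> {1..m}. pos m i \<in> {a..b}}" unfolding ab(2)[symmetric] using True jm by blast
    then have "a \<le> pos m j" by simp
    then have "U t \<le> x" using U_le_iff[OF tm jm] pt j by simp
    moreover have "\<not> U t < x"
    proof
      assume "U t < x"
      then have "d' \<le> x - U t" using d'(3)[of "x - U t"] tm m by auto
      then show False using lo_le[OF e(1) te] e(3) by linarith
    qed
    ultimately have "U t = U j" using j by simp
    then have "t = j" using U_inj tm jm by (auto dest: inj_onD)
    then have pa: "pos m j = a" using pt by simp
    have "a \<le> Max (fst ` T)" using ab finT by (force intro!: Max_ge simp: image_iff)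
    moreover have "Max (fst ` T) \<noteq> pos m j" using m(3) unfolding T_def by (metis perm_of_label_pos)
    ultimately have lt: "pos m j < Max (fst ` T)" using pa by simp
    have "Max (fst ` T) \<in> fst ` T" using finT ab by (intro Max_in) auto
    then obtain a' b' where ab': "(a', b') \<in> T" "a' = Max (fst ` T)" by auto
    define e2 where "e2 = {i \<in> {1..m}. pos m i \<in> {a'..b'}}"
    note D = trace_endsD[OF m1 ab'(1)[unfolded T_def], folded e2_def]
    have "j \<notin> e2" using lt ab' by (auto simp: e2_def)
    then have "e2 \<inter> {1..n'} = f" using D(2) by (auto simp: V_def)
    \<comment> \<open>The replacement agrees with \<open>e\<close> on the mesh except for
      \<open>j\<close>. Its left end is kept near \<open>x\<close> by \<open>i0\<close>, and its
      right end near \<open>hi e\<close> by the last mesh vertex, which both edges share.\<close>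
    obtain e3 where e3: "e3 \<in> E" "e3 \<inter> {1..m} = e2" using E_lift[OF m1 D(1)] .
    have e3f: "e3 \<inter> {1..n'} = f" using e3(2) \<open>e2 \<inter> {1..n'} = f\<close> m by auto
    have ff: "finite f" using f by (auto simp: V_def intro: finite_subset)
    obtain l where l: "l \<in> f" "\<And>i. i \<in> f \<Longrightarrow> U l \<le> U i" using finite_arg_min[OF ff f(2), of U] by metis
    obtain r where r: "r \<in> f" "\<And>i. i \<in> f \<Longrightarrow> U i \<le> U r" using finite_arg_max[OF ff f(2), of U] by metis
    have lo3: "lo e3 \<le> U l" "U l \<le> lo e3 + d"
      using lo_trace[OF e3(1) n'(1), of l] l e3f by auto
    have hi3: "U r \<le> hi e3" "hi e3 \<le> U r + d"
      using hi_trace[OF e3(1) n'(1), of r] r e3f by auto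
    have "U i \<le> U r" if "i \<in> e \<inter> {1..n'}" for i
      using that r(2)[of i] r(2)[OF i0f] i0 j by (cases "i = j") (auto simp: f_def V_def)
    then have hie: "U r \<le> hi e" "hi e \<le> U r + d"
      using hi_trace[OF e(1) n'(1), of r] r by (auto simp: f_def V_def)
    have "U l \<le> U i0" "lo e \<le> U l" using l i0f lo_le[OF e(1)] by (auto simp: f_def)
    then have "lo e3 - x < \<epsilon>" "x - lo e3 < \<epsilon>"
      using lo3 i0(3) abs_less_iff[THEN iffD1, OF e(3)] d(1,2) d'(2) by linarith+
    then have "\<bar>lo e3 - x\<bar> < \<epsilon>" by (simp add: abs_less_iff)
    moreover have "hi e3 - y < \<epsilon>" "y - hi e3 < \<epsilon>"
      using hi3 hie abs_less_iff[THEN iffD1, OF e(4)] d(1,2) d'(2) by linarith+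
    then have "\<bar>hi e3 - y\<bar> < \<epsilon>" by (simp add: abs_less_iff)
    moreover have "e3 \<noteq> {}" using e3f f by auto
    moreover have "e3 \<inter> {1..n} = e \<inter> {1..n} - {j}"
    proof -
      have sub: "{1..n} \<subseteq> {1..n'}" using n'(2) by auto
      then have "e3 \<inter> {1..n} = e3 \<inter> {1..n'} \<inter> {1..n}" by blast
      also have "\<dots> = e \<inter> {1..n} - {j}" unfolding e3f f_def V_def using sub by blast
      finally show ?thesis .
    qed
    ultimately show ?thesis using e3 e(5) by blast
  qed
qed

text \<open>Mirror image of \<open>avoid_left\<close>: \<open>j\<close> sits at \<open>y\<close>,
  and the edge is replaced by one with the smallest right end.\<close>

lemma avoid_right:
  assumes xy: "x < y" and j: "j \<in> {1..n}" "U j = y" and App: "approx x y n P"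
  shows "approx x y n (\<lambda>s. \<exists>s'. P s' \<and> s = s' - {j})"
  unfolding approx_def
proof (intro allI impI)
  fix \<epsilon> :: real assume eps: "0 < \<epsilon>"
  define d where "d = min (\<epsilon> / 4) ((y - x) / 8)"
  have d: "0 < d" "d \<le> \<epsilon> / 4" "d \<le> (y - x) / 8" using eps xy min.cobounded1[of "\<epsilon> / 4" "(y - x) / 8"] min.cobounded2[of "\<epsilon> / 4" "(y - x) / 8"] unfolding d_def by auto
  obtain n' where n': "mesh n' d" "n \<le> n'"
    using eventually_conj[OF eventually_mesh[OF d(1)] eventually_ge_at_top[of n]] by (metis (mono_tags, lifting) eventually_happens' sequentially_bot)
  define V where "V = {1..n'} - {j}"
  have jn: "j \<in> {1..n'}" using j n' by auto
  have "\<forall>f\<in>Pow V - {{}}. \<exists>m>n'. perm_of h m (Min (snd ` trace_ends (perm_of h m) (J m) V f)) \<noteq> j"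
    using escape[OF jn, of _ "\<lambda>S. Min (snd ` S)"] by (auto simp: V_def)
  then obtain M where M: "\<And>f. f \<subseteq> V \<Longrightarrow> f \<noteq> {} \<Longrightarrow> n' < M f \<and> perm_of h (M f) (Min (snd ` trace_ends (perm_of h (M f)) (J (M f)) V f)) \<noteq> j"
    by (metis DiffI PowI singletonD)
  define m0 where "m0 = Max (insert n' (M ` (Pow V - {{}})))"
  have m0: "M f \<le> m0" if "f \<subseteq> V" "f \<noteq> {}" for f
    unfolding m0_def using that by (intro Max_ge) (auto simp: V_def)
  obtain d' where d': "0 < d'" "d' \<le> d" "\<And>a. a \<in> (\<lambda>i. U i - y) ` {1..m0} \<Longrightarrow> 0 < a \<Longrightarrow> d' \<le> a"
    by (rule finite_min_gap[of "(\<lambda>i. U i - y) ` {1..m0}" d]) (use d in auto)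
  obtain e where e: "e \<in> E" "e \<noteq> {}" "\<bar>lo e - x\<bar> < d'" "\<bar>hi e - y\<bar> < d'" "P (e \<inter> {1..n})"
    using App d'(1) unfolding approx_def by blast
  show "\<exists>e\<in>E. e \<noteq> {} \<and> \<bar>lo e - x\<bar> < \<epsilon> \<and> \<bar>hi e - y\<bar> < \<epsilon> \<and> (\<exists>s'. P s' \<and> e \<inter> {1..n} = s' - {j})"
  proof (cases "j \<in> e")
    case False
    then show ?thesis using e d' d by (intro bexI[of _ e] conjI exI[of _ "e \<inter> {1..n}"]) auto
  next
    case True
    define f where "f = e \<inter> V"
    have x0: "y \<le> 1" using j U_range by auto
    have h1: "0 \<le> lo e" using lo_hi_range e by auto
    have "lo e - x < d'" using e(3) by (simp add: abs_less_iff)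
    moreover have "8 * d \<le> y - x" using d(3) by simp
    ultimately have "0 \<le> y - d" using h1 d(1) d'(2) by linarith
    then obtain i0 where i0: "i0 \<in> {1..n'}" "y - d < U i0" "U i0 < y"
      using meshD[OF n'(1), of "y - d" y] x0 by auto
    have lox: "y \<le> hi e" using hi_ge[OF e(1) True] j by simp
    have "i0 \<in> e" using i0 lox e(3) d d' by (intro E_memI e) auto
    then have i0f: "i0 \<in> f" using i0 j by (auto simp: f_def V_def)
    have f: "f \<subseteq> V" "f \<noteq> {}" using i0f by (auto simp: f_def)
    define m where "m = M f"
    have m: "n' < m" "m \<le> m0" "perm_of h m (Min (snd ` trace_ends (perm_of h m) (J m) V f)) \<noteq> j"
      using M[OF f] m0[OF f] by (auto simp: m_def)
    define T where "T = trace_ends (perm_of h m) (J m) V f"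
    have m1: "1 \<le> m" using m by simp
    have finT: "finite (snd ` T)" unfolding T_def using finite_trace_ends[OF J_InSy[OF m1]] by blast
    have em: "e \<inter> {1..m} \<in> H m" using e(1) m1 by (simp add: E_def)
    have "V \<subseteq> {1..m}" using m by (auto simp: V_def)
    then have "e \<inter> {1..m} \<inter> V = f" by (auto simp: f_def)
    then obtain a b where ab: "(a, b) \<in> T" "e \<inter> {1..m} = {i \<in> {1..m}. pos m i \<in> {a..b}}"
      using trace_endsI[OF m1 em _ f(2)] unfolding T_def by metis
    note D0 = trace_endsD[OF m1 ab(1)[unfolded T_def]]
    define t where "t = perm_of h m b"
    have pt: "pos m t = b" by (simp add: t_def)
    then have tm: "t \<in> {1..m}" using label_pos_in_iff[of h m t] D0 by auto
    then have "t \<in> {i \<in> {1..m}. pos m i \<in> {a..b}}" using pt D0 by simp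
    then have te: "t \<in> e" unfolding ab(2)[symmetric] by blast
    have jm: "j \<in> {1..m}" using jn m by auto
    have "j \<in> {i \<in> {1..m}. pos m i \<in> {a..b}}" unfolding ab(2)[symmetric] using True jm by blast
    then have "pos m j \<le> b" by simp
    then have "y \<le> U t" using U_le_iff[OF jm tm] pt j by simp
    moreover have "\<not> y < U t"
    proof
      assume "y < U t"
      then have "d' \<le> U t - y" using d'(3)[of "U t - y"] tm m by auto
      then show False using hi_ge[OF e(1) te] e(4) by linarith
    qed
    ultimately have "U t = U j" using j by simp
    then have "t = j" using U_inj tm jm by (auto dest: inj_onD)
    then have pa: "pos m j = b" using pt by simp
    have "Min (snd ` T) \<le> b" using ab finT by (force intro!: Min_le simp: image_iff)
    moreover have "Min (snd ` T) \<noteq> pos m j" using m(3) unfolding T_def by (metis perm_of_label_pos)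
    ultimately have lt: "Min (snd ` T) < pos m j" using pa by simp
    have "Min (snd ` T) \<in> snd ` T" using finT ab by (intro Min_in) auto
    then obtain a' b' where ab': "(a', b') \<in> T" "b' = Min (snd ` T)" by auto
    define e2 where "e2 = {i \<in> {1..m}. pos m i \<in> {a'..b'}}"
    note D = trace_endsD[OF m1 ab'(1)[unfolded T_def], folded e2_def]
    have "j \<notin> e2" using lt ab' by (auto simp: e2_def)
    then have "e2 \<inter> {1..n'} = f" using D(2) by (auto simp: V_def)
    obtain e3 where e3: "e3 \<in> E" "e3 \<inter> {1..m} = e2" using E_lift[OF m1 D(1)] .
    have e3f: "e3 \<inter> {1..n'} = f" using e3(2) \<open>e2 \<inter> {1..n'} = f\<close> m by auto
    have ff: "finite f" using f by (auto simp: V_def intro: finite_subset)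
    obtain l where l: "l \<in> f" "\<And>i. i \<in> f \<Longrightarrow> U l \<le> U i" using finite_arg_min[OF ff f(2), of U] by metis
    obtain r where r: "r \<in> f" "\<And>i. i \<in> f \<Longrightarrow> U i \<le> U r" using finite_arg_max[OF ff f(2), of U] by metis
    have lo3: "lo e3 \<le> U l" "U l \<le> lo e3 + d"
      using lo_trace[OF e3(1) n'(1), of l] l e3f by auto
    have hi3: "U r \<le> hi e3" "hi e3 \<le> U r + d"
      using hi_trace[OF e3(1) n'(1), of r] r e3f by auto
    have "U l \<le> U i" if "i \<in> e \<inter> {1..n'}" for i
      using that l(2)[of i] l(2)[OF i0f] i0 j by (cases "i = j") (auto simp: f_def V_def)
    then have loe: "lo e \<le> U l" "U l \<le> lo e + d"
      using lo_trace[OF e(1) n'(1), of l] l by (auto simp: f_def V_def)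
    have "U i0 \<le> U r" "U r \<le> hi e" using r i0f hi_ge[OF e(1)] by (auto simp: f_def)
    then have "hi e3 - y < \<epsilon>" "y - hi e3 < \<epsilon>"
      using hi3 i0(2) abs_less_iff[THEN iffD1, OF e(4)] d(1,2) d'(2) by linarith+
    then have "\<bar>hi e3 - y\<bar> < \<epsilon>" by (simp add: abs_less_iff)
    moreover have "lo e3 - x < \<epsilon>" "x - lo e3 < \<epsilon>"
      using lo3 loe abs_less_iff[THEN iffD1, OF e(3)] d(1,2) d'(2) by linarith+
    then have "\<bar>lo e3 - x\<bar> < \<epsilon>" by (simp add: abs_less_iff)
    moreover have "e3 \<noteq> {}" using e3f f by auto
    moreover have "e3 \<inter> {1..n} = e \<inter> {1..n} - {j}"
    proof -
      have sub: "{1..n} \<subseteq> {1..n'}" using n'(2) by auto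
      then have "e3 \<inter> {1..n} = e3 \<inter> {1..n'} \<inter> {1..n}" by blast
      also have "\<dots> = e \<inter> {1..n} - {j}" unfolding e3f f_def V_def using sub by blast
      finally show ?thesis .
    qed
    ultimately show ?thesis using e3 e(5) by blast
  qed
qed

text \<open>At most one vertex sits at \<open>x\<close> and at most one at \<open>y\<close>; they
  are removed from the traces of the approximating edges. All other vertices up to \<open>n\<close>
  keep a positive distance from \<open>x\<close> and \<open>y\<close>, so a sufficiently close edge
  has exactly the open trace.\<close>

lemma K_trace_in_H:
  assumes n: "1 \<le> n" and K: "(x, y) \<in> K"
  shows "{j \<in> {1..n}. x < U j \<and> U j < y} \<in> H n" (is "?f \<in> _")
proof (cases "?f = {}")
  case True
  have "{} \<in> J n" using J_InSy[OF n] by (simp add: InSy_iff)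
  then show ?thesis unfolding True H_def permute_hypergraph_def by blast
next
  case False
  then have xy: "x < y" by auto
  then have "(x, y) \<in> closure K0" using K by (auto simp: K_def diag_def)
  then have "\<exists>e\<in>E. e \<noteq> {} \<and> dist (lo e, hi e) (x, y) < \<epsilon>" if "0 < \<epsilon>" for \<epsilon>
    using that unfolding closure_approachable K0_def by blast
  moreover have "\<bar>u - x\<bar> \<le> dist (u, v) (x, y)" "\<bar>v - y\<bar> \<le> dist (u, v) (x, y)" for u v
    using dist_fst_le[of "(u, v)" "(x, y)"] dist_snd_le[of "(u, v)" "(x, y)"] by (auto simp: dist_real_def)
  ultimately have a0: "approx x y n (\<lambda>_. True)"
    unfolding approx_def by (meson order.strict_trans1)
  have a1: "approx x y n (\<lambda>s. \<forall>j\<in>s. U j \<noteq> x)"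
  proof (cases "\<exists>j\<in>{1..n}. U j = x")
    case True
    then obtain j where j: "j \<in> {1..n}" "U j = x" by blast
    have inj: "i = j" if "i \<in> {1..n}" "U i = x" for i using U_inj j that by (auto dest: inj_onD)
    have "approx x y n (\<lambda>s. \<exists>s'. s' \<subseteq> {1..n} \<and> s = s' - {j})"
      by (rule avoid_left[OF xy j, of "\<lambda>s. s \<subseteq> {1..n}"]) (use a0 in \<open>auto simp: approx_def\<close>)
    then show ?thesis by (rule approx_mono) (use inj in auto)
  next
    case False
    then show ?thesis using a0 unfolding approx_def by auto
  qed
  have a2: "approx x y n (\<lambda>s. \<forall>j\<in>s. U j \<noteq> x \<and> U j \<noteq> y)"
  proof (cases "\<exists>j\<in>{1..n}. U j = y")
    case True
    then obtain j where j: "j \<in> {1..n}" "U j = y" by blast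
    have inj: "i = j" if "i \<in> {1..n}" "U i = y" for i using U_inj j that by (auto dest: inj_onD)
    have "approx x y n (\<lambda>s. \<exists>s'. (s' \<subseteq> {1..n} \<and> (\<forall>j\<in>s'. U j \<noteq> x)) \<and> s = s' - {j})"
      by (rule avoid_right[OF xy j]) (use a1 in \<open>auto simp: approx_def\<close>)
    then show ?thesis by (rule approx_mono) (use inj in auto)
  next
    case False
    then show ?thesis using a1 unfolding approx_def by fastforce
  qed
  obtain d where d: "0 < d" "d \<le> 1"
    "\<And>a. a \<in> (\<lambda>i. \<bar>U i - x\<bar>) ` {1..n} \<union> (\<lambda>i. \<bar>U i - y\<bar>) ` {1..n} \<Longrightarrow> 0 < a \<Longrightarrow> d \<le> a"
    by (rule finite_min_gap[of "(\<lambda>i. \<bar>U i - x\<bar>) ` {1..n} \<union> (\<lambda>i. \<bar>U i - y\<bar>) ` {1..n}" 1]) auto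
  obtain e where e: "e \<in> E" "e \<noteq> {}" "\<bar>lo e - x\<bar> < d" "\<bar>hi e - y\<bar> < d" "\<forall>j\<in>e \<inter> {1..n}. U j \<noteq> x \<and> U j \<noteq> y"
    using a2 d(1) unfolding approx_def by blast
  have dx: "d \<le> \<bar>U i - x\<bar>" if "i \<in> {1..n}" "U i \<noteq> x" for i using d(3)[of "\<bar>U i - x\<bar>"] that by auto
  have dy: "d \<le> \<bar>U i - y\<bar>" if "i \<in> {1..n}" "U i \<noteq> y" for i using d(3)[of "\<bar>U i - y\<bar>"] that by auto
  have "e \<inter> {1..n} = ?f"
  proof (intro equalityI subsetI)
    fix i assume i: "i \<in> e \<inter> {1..n}"
    have "lo e \<le> U i" "U i \<le> hi e" using i lo_le[OF e(1)] hi_ge[OF e(1)] by auto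
    moreover have "d \<le> \<bar>U i - x\<bar>" "d \<le> \<bar>U i - y\<bar>" using i e(5) dx dy by auto
    ultimately have "x < U i" "U i < y" using e(3,4) d(1) by linarith+
    then show "i \<in> ?f" using i by auto
  next
    fix i assume i: "i \<in> ?f"
    then have "d \<le> \<bar>U i - x\<bar>" "d \<le> \<bar>U i - y\<bar>" using dx[of i] dy[of i] by auto
    then have "lo e < U i" "U i < hi e" using i e(3,4) by auto
    then have "i \<in> e" using i by (intro E_memI[OF e(1,2)]) auto
    then show "i \<in> e \<inter> {1..n}" using i by auto
  qed
  then show ?thesis using e(1) n unfolding E_def by auto
qed

text \<open>Extending to the left and then to the right yields an edge with vertices strictly
  outside \<open>e\<close> on both sides. A lift of it to \<open>E\<close> has its ends strictly
  beyond all vertices of \<open>e\<close>, so the open interval between them has trace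
  \<open>e\<close>.\<close>

lemma H_trace_of_K:
  assumes n: "1 \<le> n" and e: "e \<in> H n" "e \<noteq> {}" "\<nexists>j. e = {j}"
  shows "\<exists>x y. (x, y) \<in> K \<and> e = {j \<in> {1..n}. x < U j \<and> U j < y}"
proof -
  have sub: "e \<subseteq> {1..n}" using H_subset[OF n e(1)] .
  obtain l where l: "l \<in> e" "\<And>i. i \<in> e \<Longrightarrow> U l \<le> U i"
    using finite_arg_min[of e U] e sub by (metis finite_atLeastAtMost finite_subset)
  obtain m1 e1 t where e1: "n < m1" "e1 \<in> H m1" "e1 \<inter> {1..n} = e" "t \<in> e1" "U t < U l"
    using extend_left[OF n e(1) l] e(3) by metis
  have m1: "1 \<le> m1" using e1 n by simp
  have l1: "l \<in> e1" using l e1 by auto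
  have ne1: "e1 \<noteq> {}" using l1 by auto
  have fe1: "finite e1" using H_subset[OF m1 e1(2)] by (rule finite_subset) simp
  \<comment> \<open>The second extension starts from \<open>e1\<close>, so that its trace on
    \<open>{1..m1}\<close>, and with it the vertex \<open>t\<close> on the left, is kept.\<close>
  obtain r where r: "r \<in> e1" "\<And>i. i \<in> e1 \<Longrightarrow> U i \<le> U r"
    using finite_arg_max[OF fe1 ne1, of U] by metis
  have "e1 \<noteq> {r}" using e1(4,5) l1 by auto
  then obtain m2 e2 s where e2: "m1 < m2" "e2 \<in> H m2" "e2 \<inter> {1..m1} = e1" "s \<in> e2" "U r < U s"
    using extend_right[OF m1 e1(2) r] by metis
  obtain e3 where e3: "e3 \<in> E" "e3 \<inter> {1..m2} = e2" using E_lift[OF _ e2(2)] e2 m1 by auto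
  have mem: "t \<in> e3" "s \<in> e3" using e1 e2 e3 by auto
  have e3n: "e3 \<inter> {1..n} = e"
  proof -
    have "e3 \<inter> {1..n} = e3 \<inter> {1..m2} \<inter> {1..m1} \<inter> {1..n}" using e1 e2 by auto
    then show ?thesis using e1 e2 e3 by simp
  qed
  have "e = {j \<in> {1..n}. lo e3 < U j \<and> U j < hi e3}"
  proof (intro equalityI subsetI)
    fix i assume i: "i \<in> e"
    then have "U l \<le> U i" "U i \<le> U r" using l r e1 by auto
    then show "i \<in> {j \<in> {1..n}. lo e3 < U j \<and> U j < hi e3}"
      using lo_le[OF e3(1) mem(1)] hi_ge[OF e3(1) mem(2)] e1 e2 i sub by auto
  next
    fix i assume i: "i \<in> {j \<in> {1..n}. lo e3 < U j \<and> U j < hi e3}"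
    then have "i \<in> e3" using mem by (intro E_memI[OF e3(1)]) auto
    then show "i \<in> e" using i e3n by auto
  qed
  moreover have "(lo e3, hi e3) \<in> K" using e3 mem closure_subset[of K0] by (auto simp: K_def K0_def)
  ultimately show ?thesis by blast
qed

lemma H_eq_K:
  assumes n: "1 \<le> n"
  shows "H n = {{j \<in> {1..n}. x < U j \<and> U j < y} | x y. (x, y) \<in> K} \<union> {{j} | j. j \<in> {1..n}} \<union> {{}}"
    (is "_ = ?A \<union> ?B \<union> {{}}")
proof (intro equalityI Un_least)
  show "H n \<subseteq> ?A \<union> ?B \<union> {{}}"
  proof
    fix e assume e: "e \<in> H n"
    show "e \<in> ?A \<union> ?B \<union> {{}}"
    proof (cases "e = {} \<or> (\<exists>j. e = {j})")
      case True
      then show ?thesis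
      proof (elim disjE exE)
        fix j assume j: "e = {j}"
        then have "j \<in> {1..n}" using H_subset[OF n e] by simp
        then have "e \<in> ?B" unfolding j mem_Collect_eq by (intro exI[of _ j]) simp
        then show ?thesis by (intro UnI1 UnI2)
      qed simp
    next
      case False then have "e \<in> ?A" using H_trace_of_K[OF n e] by blast
      then show ?thesis by (intro UnI1)
    qed
  qed
  show "?A \<subseteq> H n" using K_trace_in_H[OF n] by blast
  have "{} \<in> H n" "\<forall>j\<in>{1..n}. {j} \<in> H n"
    using H_InHy[OF n] unfolding InHy_def interval_hypergraph_wrt_def mem_Collect_eq by metis+
  then show "?B \<subseteq> H n" "{{}} \<subseteq> H n" by blast+
qed

end

section \<open>Almost sure properties of erased-interval processes\<close>

lemma (in prob_space) AE_not_if_arbitrarily_small: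
  assumes small: "\<And>\<epsilon>. 0 < \<epsilon> \<Longrightarrow> \<exists>A\<in>events. prob A \<le> \<epsilon> \<and> (AE x in M. P x \<longrightarrow> x \<in> A)"
  shows "AE x in M. \<not> P x"
proof -
  have "\<forall>k. \<exists>A. A \<in> events \<and> prob A \<le> 1 / real (Suc k) \<and> (AE x in M. P x \<longrightarrow> x \<in> A)"
    using small by (metis of_nat_0_less_iff zero_less_Suc zero_less_divide_1_iff)
  then obtain A where A: "\<And>k. A k \<in> events" "\<And>k. prob (A k) \<le> 1 / real (Suc k)" "\<And>k. AE x in M. P x \<longrightarrow> x \<in> A k"
    by metis
  have N: "(\<Inter>k. A k) \<in> events" using A(1) by blast
  have "prob (\<Inter>k. A k) \<le> 1 / real (Suc k)" for k
    using A(2)[of k] finite_measure_mono[OF _ A(1)[of k], of "\<Inter>k. A k"] by (meson INT_lower UNIV_I order_trans)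
  then have "prob (\<Inter>k. A k) \<le> 0"
    by (intro LIMSEQ_le_const[OF LIMSEQ_inverse_real_of_nat]) (auto simp: inverse_eq_divide)
  then have "prob (\<Inter>k. A k) = 0" using measure_nonneg[of M "\<Inter>k. A k"] by linarith
  then have "AE x in M. x \<notin> (\<Inter>k. A k)" using N by (simp add: prob_eq_0)
  moreover have "AE x in M. \<forall>k. P x \<longrightarrow> x \<in> A k" using A(3) unfolding AE_all_countable by blast
  ultimately show ?thesis by eventually_elim blast
qed

text \<open>Double counting of the pairs \<open>(p, l)\<close> with \<open>R p l\<close>: composing
  with the transposition of \<open>i\<close> and \<open>l\<close> shows that every \<open>l\<close>
  in \<open>L\<close> occurs for equally many \<open>p\<close>. Under a uniform permutation
  \<open>R p i\<close> thus has probability at most \<open>c / card L\<close>.\<close>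

lemma card_permutations_equivariant:
  assumes L: "L \<subseteq> {1..n}" "i \<in> L"
    and few: "\<And>p. p permutes {1..n} \<Longrightarrow> card {l \<in> L. R p l} \<le> c"
    and eqv: "\<And>p l. p permutes {1..n} \<Longrightarrow> l \<in> L \<Longrightarrow> R (Transposition.transpose i l \<circ> p) i \<longleftrightarrow> R p l"
  shows "card L * card {p. p permutes {1..n} \<and> R p i} \<le> c * fact n"
proof -
  let ?S = "{p. p permutes {1..n}}"
  have fin: "finite ?S" "finite L" using L by (auto simp: finite_permutations intro: finite_subset)
  have tr: "Transposition.transpose i l permutes {1..n}" if "l \<in> L" for l
    using that L by (intro permutes_swap_id) auto
  have card_eq: "card {p \<in> ?S. R p l} = card {p \<in> ?S. R p i}" if l: "l \<in> L" for l
  proof (rule bij_betw_same_card[of "\<lambda>p. Transposition.transpose i l \<circ> p"], rule bij_betwI[where g = "\<lambda>p. Transposition.transpose i l \<circ> p"])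
    show "(\<lambda>p. Transposition.transpose i l \<circ> p) \<in> {p \<in> ?S. R p l} \<rightarrow> {p \<in> ?S. R p i}"
      using tr[OF l] eqv l by (auto intro: permutes_compose)
    show "(\<lambda>p. Transposition.transpose i l \<circ> p) \<in> {p \<in> ?S. R p i} \<rightarrow> {p \<in> ?S. R p l}"
    proof safe
      fix p assume p: "p permutes {1..n}" "R p i"
      show q: "Transposition.transpose i l \<circ> p permutes {1..n}" by (rule permutes_compose[OF p(1) tr[OF l]])
      have "Transposition.transpose i l \<circ> (Transposition.transpose i l \<circ> p) = p" by (simp add: fun_eq_iff)
      then show "R (Transposition.transpose i l \<circ> p) l" using eqv[OF q l] p by simp
    qed
  qed (auto simp: fun_eq_iff)
  have "card L * card {p \<in> ?S. R p i} = (\<Sum>l\<in>L. card {p \<in> ?S. R p l})"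
    using card_eq by simp
  also have "\<dots> = (\<Sum>p\<in>?S. card {l \<in> L. R p l})"
    by (rule sum_multicount_gen) (use fin in auto)
  also have "\<dots> \<le> (\<Sum>p\<in>?S. c)" by (rule sum_mono) (use few in auto)
  also have "\<dots> = c * fact n" by (simp add: card_permutations[of "{1..n}" n, simplified])
  finally show ?thesis by simp
qed

lemma card_erasers_perm_of:
  "card {e \<in> erasers n. R (perm_of e n)} = card {p. p permutes {1..n} \<and> R p}"
proof (rule bij_betw_same_card)
  show "bij_betw (\<lambda>e. perm_of e n) {e \<in> erasers n. R (perm_of e n)} {p. p permutes {1..n} \<and> R p}"
    using bij_erasers[of n] by (rule bij_betw_subset) (use bij_erasers[of n] in \<open>auto simp: bij_betw_def\<close>)
qed

section \<open>Second moments of relative positions and convergence criteria\<close>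

definition square_dev :: "nat \<Rightarrow> nat \<Rightarrow> nat \<Rightarrow> (nat \<Rightarrow> nat) \<Rightarrow> real" where
  "square_dev n m i h = (real (label_pos h m i) / (real m + 1) - real (label_pos h n i) / (real n + 1))\<^sup>2"

lemma square_dev_cong: "n \<le> m \<Longrightarrow> (\<And>k. 1 \<le> k \<Longrightarrow> k < m \<Longrightarrow> h k = h' k) \<Longrightarrow> square_dev n m i h = square_dev n m i h'"
  using perm_of_cong[of n h h'] perm_of_cong[of m h h'] by (simp add: square_dev_def)

text \<open>Given its position \<open>p\<close> among \<open>m\<close>, the relative position \<open>p / (m + 1)\<close> of a label is the
  mean of its relative position among \<open>m + 1\<close>; so it is a martingale and squared increments add up.\<close>

lemma sum_square_dev_Suc:
  fixes p m :: nat and c :: real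
  assumes "p \<le> m"
  shows "(\<Sum>k\<in>{1..Suc m}. (real (if k \<le> p then Suc p else p) / (real m + 2) - c)\<^sup>2)
    \<le> (real m + 1) * (real p / (real m + 1) - c)\<^sup>2 + (real m + 1) / (4 * (real m + 2)\<^sup>2)"
proof -
  define P N where "P = real p" and "N = real m + 1"
  have N: "N > 0" by (simp add: N_def)
  have "(\<Sum>k\<in>{1..Suc m}. (real (if k \<le> p then Suc p else p) / (real m + 2) - c)\<^sup>2)
    = (\<Sum>k\<in>{1..p}. ((P + 1) / (N + 1) - c)\<^sup>2) + (\<Sum>k\<in>{Suc p..Suc m}. (P / (N + 1) - c)\<^sup>2)"
  proof -
    have "{1..Suc m} = {1..p} \<union> {Suc p..Suc m}" using assms by auto
    then show ?thesis
      by (simp only:) (subst sum.union_disjoint, auto intro!: arg_cong2[where f="(+)"] sum.cong simp: P_def N_def add_ac)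
  qed
  also have "\<dots> = P * ((P + 1) / (N + 1) - c)\<^sup>2 + (N - P) * (P / (N + 1) - c)\<^sup>2"
    using assms by (simp add: P_def N_def of_nat_diff)
  \<comment> \<open>Bias and variance: \<open>P\<close> of the \<open>N\<close> choices raise the
    position, so the mean of the new relative position is \<open>P / N\<close>. The last summand is
    \<open>N\<close> times its variance, bounded below through
    \<open>P * (N - P) \<le> N\<^sup>2 / 4\<close>.\<close>
  also have "\<dots> = N * (P / N - c)\<^sup>2 + P * (N - P) / (N * (N + 1)\<^sup>2)"
  proof -
    define x t q where "x = P / (N + 1) - c" and "t = 1 / (N + 1)" and "q = P * t / N"
    have 1: "(P + 1) / (N + 1) - c = x + t" by (simp add: x_def t_def add_divide_distrib)
    have "P / N = P / (N + 1) + q" using N by (simp add: t_def q_def divide_simps) (simp add: algebra_simps)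
    then have 2: "P / N - c = x + q" by (simp add: x_def)
    have 3: "P * (N - P) / (N * (N + 1)\<^sup>2) = P * t\<^sup>2 - P * t * q"
    proof -
      have "P * t\<^sup>2 - P * t * q = t\<^sup>2 * (P * (N - P) / N)"
        using N by (simp add: q_def field_simps power2_eq_square)
      then show ?thesis by (simp add: t_def power_divide)
    qed
    have 4: "N * q = P * t" using N by (simp add: q_def)
    have "N * (x + q)\<^sup>2 = N * x\<^sup>2 + 2 * (N * q) * x + (N * q) * q" by (simp add: power2_eq_square algebra_simps)
    then show ?thesis unfolding 1 2 3 4 x_def[symmetric] by (simp add: power2_eq_square algebra_simps)
  qed
  also have "P * (N - P) / (N * (N + 1)\<^sup>2) \<le> N / (4 * (N + 1)\<^sup>2)"
  proof -
    have "0 \<le> (N - 2 * P)\<^sup>2" by simp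
    then have "P * (N - P) \<le> N\<^sup>2 / 4" by (simp add: power2_eq_square algebra_simps)
    then have "P * (N - P) / (N * (N + 1)\<^sup>2) \<le> (N\<^sup>2 / 4) / (N * (N + 1)\<^sup>2)" using N by (intro divide_right_mono) auto
    also have "\<dots> = N / (4 * (N + 1)\<^sup>2)" using N by (simp add: power2_eq_square)
    finally show ?thesis .
  qed
  finally show ?thesis by (simp add: P_def N_def add_ac)
qed

text \<open>On average over the erasers, the step from level \<open>m\<close> adds at most
  \<open>1 / (4 * (m + 2)\<^sup>2)\<close>, which is dominated by a quarter of the telescoping
  difference \<open>1 / (m + 1) - 1 / (m + 2)\<close>.\<close>

lemma sum_square_dev:
  assumes "1 \<le> i" "i \<le> n" "n \<le> m"
  shows "(\<Sum>e\<in>erasers m. square_dev n m i e) \<le> fact m * (1 / (real n + 1) - 1 / (real m + 1)) / 4"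
  using assms(3)
proof (induction m rule: dec_induct)
  case base
  then show ?case by (simp add: square_dev_def)
next
  case (step m)
  have m1: "1 \<le> m" using assms step by simp
  have inner: "(\<Sum>k\<in>{1..Suc m}. square_dev n (Suc m) i (e(m := k)))
      \<le> (real m + 1) * square_dev n m i e + (real m + 1) / (4 * (real m + 2)\<^sup>2)" if e: "e \<in> erasers m" for e
  proof -
    have "square_dev n (Suc m) i (e(m := k)) =
      (real (if k \<le> label_pos e m i then Suc (label_pos e m i) else label_pos e m i) / (real m + 2) - real (label_pos e n i) / (real n + 1))\<^sup>2"
      if k: "k \<in> {1..Suc m}" for k
    proof -
      have "perm_of (e(m := k)) n = perm_of e n" "perm_of (e(m := k)) m = perm_of e m"
        using step by (auto intro!: perm_of_cong)
      moreover from this have "label_pos (e(m := k)) (Suc m) i = (if k \<le> label_pos e m i then Suc (label_pos e m i) else label_pos e m i)"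
        using label_pos_Suc_old[of i m "e(m := k)"] k assms step by simp
      ultimately show ?thesis by (simp add: square_dev_def add.commute[of 2 "real m"])
    qed
    then have "(\<Sum>k\<in>{1..Suc m}. square_dev n (Suc m) i (e(m := k))) =
      (\<Sum>k\<in>{1..Suc m}. (real (if k \<le> label_pos e m i then Suc (label_pos e m i) else label_pos e m i) / (real m + 2) - real (label_pos e n i) / (real n + 1))\<^sup>2)"
      by (intro sum.cong) auto
    also have "\<dots> \<le> (real m + 1) * square_dev n m i e + (real m + 1) / (4 * (real m + 2)\<^sup>2)"
      unfolding square_dev_def by (rule sum_square_dev_Suc) (use label_pos_bounds[of i m e] assms step in auto)
    finally show ?thesis .
  qed
  have "(\<Sum>e\<in>erasers (Suc m). square_dev n (Suc m) i e) = (\<Sum>e\<in>erasers m. \<Sum>k\<in>{1..Suc m}. square_dev n (Suc m) i (e(m := k)))"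
    by (rule sum_erasers_Suc[OF m1])
  also have "\<dots> \<le> (\<Sum>e\<in>erasers m. (real m + 1) * square_dev n m i e + (real m + 1) / (4 * (real m + 2)\<^sup>2))"
    by (rule sum_mono) (rule inner)
  also have "\<dots> = (real m + 1) * (\<Sum>e\<in>erasers m. square_dev n m i e) + fact m * ((real m + 1) / (4 * (real m + 2)\<^sup>2))"
    by (simp add: sum.distrib sum_distrib_left card_erasers[of m, simplified])
  also have "\<dots> \<le> (real m + 1) * (fact m * (1 / (real n + 1) - 1 / (real m + 1)) / 4) + fact m * ((real m + 1) / (4 * (real m + 2)\<^sup>2))"
    using step.IH by (intro add_right_mono mult_left_mono) auto
  also have "\<dots> = fact (Suc m) * (1 / (real n + 1) - 1 / (real m + 1) + 1 / (real m + 2)\<^sup>2) / 4"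
  proof -
    have gen: "w * (a * b / 4) + a * (w / (4 * z)) = w * a * (b + 1 / z) / 4" for w a b z :: real
      by (simp add: algebra_simps add_divide_distrib)
    have "fact (Suc m) = (real m + 1) * fact m" by (simp add: add.commute)
    then show ?thesis using gen[of "real m + 1" "fact m" "1 / (real n + 1) - 1 / (real m + 1)" "(real m + 2)\<^sup>2"] by (simp only:)
  qed
  also have "\<dots> \<le> fact (Suc m) * (1 / (real n + 1) - 1 / (real (Suc m) + 1)) / 4"
  proof -
    have "1 / (real m + 2)\<^sup>2 \<le> 1 / ((real m + 1) * (real m + 2))"
      by (intro divide_left_mono) (auto simp: power2_eq_square)
    also have "\<dots> = 1 / (real m + 1) - 1 / (real (Suc m) + 1)" by (simp add: field_simps)
    finally show ?thesis by (intro divide_right_mono mult_left_mono) auto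
  qed
  finally show ?case .
qed

text \<open>With \<open>w = k + 1\<close> and an increment of size \<open>d\<close>, the inequality
  \<open>2 * d \<le> w\<^sup>2 * d\<^sup>2 + 1 / w\<^sup>2\<close> makes the increments absolutely
  summable.\<close>

lemma convergent_if_weighted_squares:
  fixes y :: "nat \<Rightarrow> real"
  assumes "summable (\<lambda>k. (real k + 1)\<^sup>2 * (y (Suc k) - y k)\<^sup>2)"
  shows "convergent y"
proof -
  have "summable (\<lambda>k. 1 / (real k + 1)\<^sup>2)"
    using inverse_power_summable[of 2, where 'a = real] by (simp add: summable_Suc_iff[of "\<lambda>k. 1 / (real k)\<^sup>2", symmetric] add.commute inverse_eq_divide)
  then have s: "summable (\<lambda>k. (real k + 1)\<^sup>2 * (y (Suc k) - y k)\<^sup>2 + 1 / (real k + 1)\<^sup>2)"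
    using assms by (intro summable_add)
  have "norm (y (Suc k) - y k) \<le> (real k + 1)\<^sup>2 * (y (Suc k) - y k)\<^sup>2 + 1 / (real k + 1)\<^sup>2" for k
  proof -
    define w d where "w = real k + 1" and "d = \<bar>y (Suc k) - y k\<bar>"
    have "0 \<le> (w * d - 1 / w)\<^sup>2" by simp
    moreover have "w > 0" by (simp add: w_def)
    ultimately have "2 * d \<le> w\<^sup>2 * d\<^sup>2 + 1 / w\<^sup>2" by (simp add: power2_eq_square algebra_simps)
    moreover have "0 \<le> d" by (simp add: d_def)
    ultimately have "d \<le> w\<^sup>2 * d\<^sup>2 + 1 / w\<^sup>2" by linarith
    then show ?thesis by (simp add: w_def d_def)
  qed
  then have "summable (\<lambda>k. y (Suc k) - y k)"
    by (intro summable_comparison_test[OF _ s]) auto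
  then have "(\<lambda>n. \<Sum>k<n. y (Suc k) - y k) \<longlonglongrightarrow> (\<Sum>k. y (Suc k) - y k)" by (rule summable_LIMSEQ)
  then have "(\<lambda>n. y n - y 0) \<longlonglongrightarrow> (\<Sum>k. y (Suc k) - y k)" by (simp add: sum_lessThan_telescope)
  from tendsto_add[OF this tendsto_const[of "y 0"]] show ?thesis by (auto simp: convergent_def)
qed

text \<open>Positions increase with the level and consecutive fourth powers have quotient tending to
  1, so the values along fourth powers squeeze those in between.\<close>

lemma interpolate_fourth_powers:
  fixes p :: "nat \<Rightarrow> nat"
  assumes mono: "\<And>n m. N \<le> n \<Longrightarrow> n \<le> m \<Longrightarrow> p n \<le> p m"
    and lim: "(\<lambda>k. real (p ((k+1)^4)) / (real ((k+1)^4) + 1)) \<longlonglongrightarrow> L"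
  shows "(\<lambda>n. real (p n) / real n) \<longlonglongrightarrow> L"
proof -
  define a where "a k = (k + 1)^4" for k :: nat
  have a0: "0 < a k" for k by (simp add: a_def)
  have lim': "(\<lambda>k. real (p (a k)) / (real (a k) + 1)) \<longlonglongrightarrow> L" using lim by (simp add: a_def)
  \<comment> \<open>In terms of \<open>u k = 1 / (k + 1)\<close> both quotients of neighbouring
    levels are continuous expressions with value 1 at 0.\<close>
  define u where "u k = inverse (real (Suc k))" for k
  have u: "u \<longlonglongrightarrow> 0" unfolding u_def by (rule LIMSEQ_inverse_real_of_nat)
  have step: "real (a k) = 1 / u k ^ 4" "real (a (Suc k)) = ((1 + u k) / u k) ^ 4" "u k > 0" for k
  proof -
    show "u k > 0" by (simp add: u_def)
    show "real (a k) = 1 / u k ^ 4" by (simp add: a_def u_def power_inverse inverse_eq_divide power_divide)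
    have "(1 + inverse w) / inverse w = w + 1" if "w > 0" for w :: real using that by (simp add: field_simps)
    from this[of "real (Suc k)"] have "(1 + u k) / u k = real (Suc k) + 1" by (simp add: u_def)
    then show "real (a (Suc k)) = ((1 + u k) / u k) ^ 4" by (simp add: a_def)
  qed
  have "(\<lambda>k. (1 + u k ^ 4) / (1 + u k) ^ 4) \<longlonglongrightarrow> (1 + 0 ^ 4) / (1 + 0) ^ 4"
    by (intro tendsto_intros u) simp
  moreover have "(1 + u k ^ 4) / (1 + u k) ^ 4 = (real (a k) + 1) / real (a (Suc k))" for k
    using step(3)[of k] unfolding step(1)[of k] step(2)[of k] by (simp add: power_divide field_simps)
  ultimately have r1: "(\<lambda>k. (real (a k) + 1) / real (a (Suc k))) \<longlonglongrightarrow> 1" by simp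
  have "(\<lambda>k. (1 + u k) ^ 4 + u k ^ 4) \<longlonglongrightarrow> (1 + 0) ^ 4 + 0 ^ 4"
    by (intro tendsto_intros u)
  moreover have "(1 + u k) ^ 4 + u k ^ 4 = (real (a (Suc k)) + 1) / real (a k)" for k
    using step(3)[of k] unfolding step(1)[of k] step(2)[of k] by (simp add: power_divide field_simps)
  ultimately have r2: "(\<lambda>k. (real (a (Suc k)) + 1) / real (a k)) \<longlonglongrightarrow> 1" by simp
  have "(\<lambda>k. real (p (a k)) / (real (a k) + 1) * ((real (a k) + 1) / real (a (Suc k)))) \<longlonglongrightarrow> L * 1"
    by (intro tendsto_mult lim' r1)
  moreover have "real (p (a k)) / (real (a k) + 1) * ((real (a k) + 1) / real (a (Suc k))) = real (p (a k)) / real (a (Suc k))" for k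
    using a0[of "Suc k"] by (simp add: add_pos_pos)
  ultimately have lower: "(\<lambda>k. real (p (a k)) / real (a (Suc k))) \<longlonglongrightarrow> L" by simp
  have "(\<lambda>k. real (p (a (Suc k))) / (real (a (Suc k)) + 1) * ((real (a (Suc k)) + 1) / real (a k))) \<longlonglongrightarrow> L * 1"
    by (intro tendsto_mult LIMSEQ_Suc[OF lim'] r2)
  moreover have "real (p (a (Suc k))) / (real (a (Suc k)) + 1) * ((real (a (Suc k)) + 1) / real (a k)) = real (p (a (Suc k))) / real (a k)" for k
    using a0[of "k"] by (simp add: add_pos_pos)
  ultimately have upper: "(\<lambda>k. real (p (a (Suc k))) / real (a k)) \<longlonglongrightarrow> L" by simp
  show ?thesis
  proof (rule LIMSEQ_I)
    fix r :: real assume r: "0 < r"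
    have "\<forall>\<^sub>F k in sequentially. L - r < real (p (a k)) / real (a (Suc k)) \<and> real (p (a (Suc k))) / real (a k) < L + r \<and> N \<le> k"
      using order_tendstoD(1)[OF lower, of "L - r"] order_tendstoD(2)[OF upper, of "L + r"] eventually_ge_at_top[of N] r
      by (intro eventually_conj) auto
    then obtain k0 where k0: "\<And>k. k0 \<le> k \<Longrightarrow> L - r < real (p (a k)) / real (a (Suc k)) \<and> real (p (a (Suc k))) / real (a k) < L + r \<and> N \<le> k"
      by (auto simp: eventually_sequentially)
    have "norm (real (p n) / real n - L) < r" if n: "a k0 \<le> n" for n
    proof -
      have ge: "k \<le> a k" for k
      proof -
        have "k + 1 \<le> (k + 1)^4" by (rule self_le_power) auto
        then show ?thesis by (simp add: a_def)
      qed
      have amono: "a j \<le> a k" if "j \<le> k" for j k unfolding a_def using that by (intro power_mono) auto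
      \<comment> \<open>The first fourth power beyond \<open>n\<close>; its predecessor
        \<open>a k\<close> satisfies \<open>a k \<le> n < a (Suc k)\<close>.\<close>
      define j where "j = (LEAST j. n < a j)"
      have "n < a (Suc n)" using ge[of "Suc n"] by simp
      then have j: "n < a j" unfolding j_def by (rule LeastI)
      have "k0 < j" using j n amono[of j k0] by (metis leD le_less_trans linorder_not_le order.strict_trans2)
      then obtain k where k: "j = Suc k" "k0 \<le> k" by (metis less_eq_Suc_le Suc_le_D Suc_le_mono)
      have "\<not> n < a k" using not_less_Least[of k "\<lambda>j. n < a j"] k unfolding j_def by auto
      then have kn: "a k \<le> n" "n < a (Suc k)" using j k by auto
      have Nk: "N \<le> a k" using k0[OF k(2)] ge[of k] by simp
      have n0: "0 < n" using kn a0[of k] by simp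
      have "real (p (a k)) / real (a (Suc k)) \<le> real (p n) / real n"
        using mono[OF Nk kn(1)] kn n0 by (intro frac_le) auto
      moreover have "real (p n) / real n \<le> real (p (a (Suc k))) / real (a k)"
        using mono[of n "a (Suc k)"] Nk kn a0[of k] by (intro frac_le) auto
      ultimately have "L - r < real (p n) / real n" "real (p n) / real n < L + r" using k0[OF k(2)] by linarith+
      then show ?thesis by (simp add: abs_less_iff)
    qed
    then show "\<exists>no. \<forall>n\<ge>no. norm (real (p n) / real n - L) < r" by blast
  qed
qed


text \<open>Recovers the system at level \<open>m\<close> from the one at level \<open>m + d\<close>
  and the erasers in between. In this way an event on several levels becomes an event on one system
  and a prefix of erasers.\<close>

primrec erase_down :: "(nat \<Rightarrow> nat) \<Rightarrow> nat \<Rightarrow> nat \<Rightarrow> nat set set \<Rightarrow> nat set set" where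
  "erase_down h m 0 J = J"
| "erase_down h m (Suc d) J = erase_down h m d (erase_system J (h (m + d)))"

lemma erase_down_cong: "(\<And>k. m \<le> k \<Longrightarrow> k < m + d \<Longrightarrow> h k = h' k) \<Longrightarrow> erase_down h m d J = erase_down h' m d J"
  by (induction d arbitrary: J) auto

lemma (in erased_path) J_erase_down: "1 \<le> m \<Longrightarrow> J m = erase_down h m d (J (m + d))"
proof (induction d)
  case (Suc d)
  have "erase_system (J (m + Suc d)) (h (m + d)) = J (m + d)" using J_erase[of "m + d"] Suc.prems by simp
  then show ?case using Suc by simp
qed simp

text \<open>A finite-dimensional form of the independence assumption: given \<open>I n\<close>, the
  prefix of erasers is uniform. It follows from the definition of an erased-interval process and
  implies it, and it is the form that can be checked for the coordinate process and for the
  constructed chain.\<close>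

locale eraser_law = prob_space M for M :: "'a measure" +
  fixes I :: "nat \<Rightarrow> 'a \<Rightarrow> nat set set" and \<eta> :: "nat \<Rightarrow> 'a \<Rightarrow> nat"
  assumes measurable_pair: "1 \<le> n \<Longrightarrow> pair_process I \<eta> n \<in> measurable M (count_space UNIV)"
    and AE_path: "AE \<omega> in M. erased_path (\<lambda>n. I n \<omega>) (\<lambda>m. \<eta> m \<omega>)"
    and prob_prefix_eq: "1 \<le> n \<Longrightarrow> e \<in> erasers n \<Longrightarrow>
      measure M ({\<omega> \<in> space M. \<forall>k\<in>{1..<n}. \<eta> k \<omega> = e k} \<inter> {\<omega> \<in> space M. I n \<omega> = J}) =
      measure M {\<omega> \<in> space M. I n \<omega> = J} / fact n"
begin

abbreviation ers :: "'a \<Rightarrow> nat \<Rightarrow> nat" where "ers \<omega> \<equiv> \<lambda>m. \<eta> m \<omega>"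

lemma measurable_I: "1 \<le> n \<Longrightarrow> I n \<in> measurable M (count_space UNIV)"
  using measurable_compose[OF measurable_pair, of n fst "count_space UNIV"] by simp

lemma measurable_eta: "1 \<le> n \<Longrightarrow> \<eta> n \<in> measurable M (count_space UNIV)"
  using measurable_compose[OF measurable_pair, of n snd "count_space UNIV"] by simp

lemma event_I: "1 \<le> n \<Longrightarrow> {\<omega> \<in> space M. P (I n \<omega>)} \<in> events"
  using measurable_sets[OF measurable_I, of n "Collect P"] by (simp add: vimage_def Int_def conj_commute)

lemma event_eta: "1 \<le> n \<Longrightarrow> {\<omega> \<in> space M. P (\<eta> n \<omega>)} \<in> events"
  using measurable_sets[OF measurable_eta, of n "Collect P"] by (simp add: vimage_def Int_def conj_commute)

lemma event_prefix: "1 \<le> n \<Longrightarrow> {\<omega> \<in> space M. \<forall>k\<in>{1..<n}. \<eta> k \<omega> = e k} \<in> events"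
  by (rule sets.sets_Collect_finite_All) (auto intro!: event_eta simp del: One_nat_def)

lemma event_prefix_I:
  assumes n: "1 \<le> n" and Q: "\<And>h h' J. (\<And>k. 1 \<le> k \<Longrightarrow> k < n \<Longrightarrow> h k = h' k) \<Longrightarrow> Q h J = Q h' J"
  shows "{\<omega> \<in> space M. Q (ers \<omega>) (I n \<omega>)} \<in> events"
proof -
  let ?F = "PiE {1..<n} (\<lambda>_. UNIV :: nat set)"
  have "{\<omega> \<in> space M. Q (ers \<omega>) (I n \<omega>)} =
    (\<Union>e\<in>?F. {\<omega> \<in> space M. \<forall>k\<in>{1..<n}. \<eta> k \<omega> = e k} \<inter> {\<omega> \<in> space M. Q e (I n \<omega>)})"
  proof (intro equalityI subsetI)
    fix \<omega> assume \<omega>: "\<omega> \<in> {\<omega> \<in> space M. Q (ers \<omega>) (I n \<omega>)}"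
    have "Q (restrict (ers \<omega>) {1..<n}) (I n \<omega>) = Q (ers \<omega>) (I n \<omega>)" by (rule Q) simp
    then show "\<omega> \<in> (\<Union>e\<in>?F. {\<omega> \<in> space M. \<forall>k\<in>{1..<n}. \<eta> k \<omega> = e k} \<inter> {\<omega> \<in> space M. Q e (I n \<omega>)})"
      using \<omega> by (intro UN_I[of "restrict (ers \<omega>) {1..<n}"]) auto
  next
    fix \<omega> assume "\<omega> \<in> (\<Union>e\<in>?F. {\<omega> \<in> space M. \<forall>k\<in>{1..<n}. \<eta> k \<omega> = e k} \<inter> {\<omega> \<in> space M. Q e (I n \<omega>)})"
    then obtain e where e: "\<omega> \<in> space M" "\<forall>k\<in>{1..<n}. \<eta> k \<omega> = e k" "Q e (I n \<omega>)" by blast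
    then have "Q (ers \<omega>) (I n \<omega>) = Q e (I n \<omega>)" by (intro Q) simp
    with e show "\<omega> \<in> {\<omega> \<in> space M. Q (ers \<omega>) (I n \<omega>)}" by simp
  qed
  also have "\<dots> \<in> events"
    by (intro sets.countable_UN' countable_PiE) (auto simp: sets.Int event_prefix[OF n] event_I[OF n] simp del: One_nat_def)
  finally show ?thesis .
qed

text \<open>The event splits according to \<open>I n\<close> and the prefix of erasers into pieces
  of known probability. What remains is the number of prefixes satisfying \<open>Q\<close>, so
  probabilities turn into counts.\<close>

lemma prob_prefix_I:
  assumes n: "1 \<le> n" and Q: "\<And>h h' J. (\<And>k. 1 \<le> k \<Longrightarrow> k < n \<Longrightarrow> h k = h' k) \<Longrightarrow> Q h J = Q h' J"
  shows "prob {\<omega> \<in> space M. Q (ers \<omega>) (I n \<omega>)} =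
    (\<Sum>J\<in>InSy n. prob {\<omega> \<in> space M. I n \<omega> = J} * real (card {e \<in> erasers n. Q e J}) / fact n)"
proof -
  define S where "S = (SIGMA J:InSy n. {e \<in> erasers n. Q e J})"
  define B where "B = (\<lambda>(J, e). {\<omega> \<in> space M. \<forall>k\<in>{1..<n}. \<eta> k \<omega> = e k} \<inter> {\<omega> \<in> space M. I n \<omega> = J})"
  have finS: "finite S" unfolding S_def using finite_InSy by (intro finite_SigmaI finite_subset[OF _ finite_erasers[of n]]) auto
  have B: "B x \<in> events" for x   proof (cases x)
    case (Pair J e)
    then show ?thesis unfolding B_def Pair prod.case
      by (intro sets.Int event_prefix[OF n] event_I[OF n, of "\<lambda>J'. J' = J"])
  qed
  have "prob {\<omega> \<in> space M. Q (ers \<omega>) (I n \<omega>)} = prob (\<Union>x\<in>S. B x)"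
  proof (rule finite_measure_eq_AE)
    show "AE \<omega> in M. (\<omega> \<in> {\<omega> \<in> space M. Q (ers \<omega>) (I n \<omega>)}) = (\<omega> \<in> (\<Union>x\<in>S. B x))"
      using AE_path AE_space
    proof eventually_elim
      case (elim \<omega>)
      interpret p: erased_path "\<lambda>n. I n \<omega>" "ers \<omega>" by (rule elim)
      have eq: "Q (ers \<omega>) (I n \<omega>) = Q e (I n \<omega>)" if "\<forall>k\<in>{1..<n}. \<eta> k \<omega> = e k" for e
        using that by (intro Q) simp
      have "restrict (ers \<omega>) {1..<n} \<in> erasers n" using p.h_range by (auto simp: PiE_iff)
      then have "\<omega> \<in> (\<Union>x\<in>S. B x)" if "Q (ers \<omega>) (I n \<omega>)"
        using that eq[of "restrict (ers \<omega>) {1..<n}"] p.J_InSy[OF n] elim(2)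
        by (intro UN_I[of "(I n \<omega>, restrict (ers \<omega>) {1..<n})"]) (auto simp: S_def B_def)
      moreover have "Q (ers \<omega>) (I n \<omega>)" if "\<omega> \<in> (\<Union>x\<in>S. B x)"
        using that eq by (auto simp: S_def B_def)
      ultimately show ?case using elim(2) by blast
    qed
    show "{\<omega> \<in> space M. Q (ers \<omega>) (I n \<omega>)} \<in> events" by (rule event_prefix_I[OF n Q])
    show "(\<Union>x\<in>S. B x) \<in> events" using finS B by (intro sets.finite_UN) auto
  qed
  also have "\<dots> = (\<Sum>x\<in>S. prob (B x))"
  proof (rule finite_measure_finite_Union[OF finS])
    show "B ` S \<subseteq> events" using B by auto
    show "disjoint_family_on B S"
      unfolding disjoint_family_on_def
    proof (intro ballI impI)
      fix x y assume xy: "x \<in> S" "y \<in> S" "x \<noteq> y"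
      obtain J e J' e' where p: "x = (J, e)" "y = (J', e')" by fastforce
      have e: "e \<in> erasers n" "e' \<in> erasers n" using xy p by (auto simp: S_def)
      show "B x \<inter> B y = {}"
      proof (rule ccontr)
        assume "B x \<inter> B y \<noteq> {}"
        then obtain \<omega> where "\<omega> \<in> B x" "\<omega> \<in> B y" by blast
        then have "J = J'" "\<forall>k\<in>{1..<n}. e k = e' k" using p by (auto simp: B_def)
        then show False using xy(3) p PiE_ext[OF e] by blast
      qed
    qed
  qed
  also have "\<dots> = (\<Sum>(J, e)\<in>S. prob {\<omega> \<in> space M. I n \<omega> = J} / fact n)"
  proof (rule sum.cong[OF refl], clarify)
    fix J e assume "(J, e) \<in> S"
    then have "e \<in> erasers n" by (simp add: S_def)
    then show "prob (B (J, e)) = prob {\<omega> \<in> space M. I n \<omega> = J} / fact n"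
      unfolding B_def prod.case by (rule prob_prefix_eq[OF n])
  qed
  also have "\<dots> = (\<Sum>J\<in>InSy n. \<Sum>e\<in>{e \<in> erasers n. Q e J}. prob {\<omega> \<in> space M. I n \<omega> = J} / fact n)"
    unfolding S_def by (rule sum.Sigma[symmetric]) (use finite_InSy finite_erasers[of n] in \<open>auto intro: finite_subset\<close>)
  also have "\<dots> = (\<Sum>J\<in>InSy n. prob {\<omega> \<in> space M. I n \<omega> = J} * real (card {e \<in> erasers n. Q e J}) / fact n)"
    by (intro sum.cong) simp_all
  finally show ?thesis .
qed


text \<open>As \<open>Q\<close> ignores the eraser at \<open>n\<close>, changing that coordinate is
  a bijection between the counted prefixes with different values there; all values are equally
  frequent.\<close>

lemma prob_levels:
  assumes n: "1 \<le> n" and R: "n < R"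
    and ins: "\<And>h k J. Q (h(n := k)) J = Q h J"
    and dep: "\<And>h h' J. (\<And>k. 1 \<le> k \<Longrightarrow> k < R \<Longrightarrow> h k = h' k) \<Longrightarrow> Q h J = Q h' J"
  shows "prob {\<omega> \<in> space M. \<eta> n \<omega> \<in> A \<and> Q (ers \<omega>) (I R \<omega>)} =
    real (card (A \<inter> {1..Suc n})) / real (Suc n) * prob {\<omega> \<in> space M. Q (ers \<omega>) (I R \<omega>)}"
proof -
  have R1: "1 \<le> R" using R by simp
  have count: "real (card {e \<in> erasers R. e n \<in> A \<and> Q e J}) = real (card (A \<inter> {1..Suc n})) / real (Suc n) * real (card {e \<in> erasers R. Q e J})" for J
  proof -
    define S where "S k = {e \<in> erasers R. e n = k \<and> Q e J}" for k
    have fS: "finite (S k)" for k unfolding S_def by (rule finite_subset[OF _ finite_erasers[of R]]) blast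
    have en: "e n \<in> {1..Suc n}" if "e \<in> erasers R" for e using eraser_le[OF that n R] .
    have upd: "e(n := k) \<in> erasers R" if "e \<in> erasers R" "k \<in> {1..Suc n}" for e k
      using that n R by (auto simp: PiE_iff extensional_def)
    have cS: "card (S k) = card (S 1)" if k: "k \<in> {1..Suc n}" for k
    proof (rule bij_betw_same_card[of "\<lambda>e. e(n := 1)"], rule bij_betwI[where g = "\<lambda>e. e(n := k)"])
      show "(\<lambda>e. e(n := 1)) \<in> S k \<rightarrow> S 1" using upd ins by (auto simp: S_def)
      show "(\<lambda>e. e(n := k)) \<in> S 1 \<rightarrow> S k" using upd ins k by (auto simp: S_def)
    qed (auto simp: S_def)
    have sum: "card {e \<in> erasers R. e n \<in> B \<and> Q e J} = card (B \<inter> {1..Suc n}) * card (S 1)" for B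
    proof -
      have "{e \<in> erasers R. e n \<in> B \<and> Q e J} = (\<Union>k\<in>B \<inter> {1..Suc n}. S k)" using en by (auto simp: S_def)
      then have "card {e \<in> erasers R. e n \<in> B \<and> Q e J} = card (\<Union>k\<in>B \<inter> {1..Suc n}. S k)" by (simp only:)
      also have "\<dots> = (\<Sum>k\<in>B \<inter> {1..Suc n}. card (S k))"
        by (rule card_UN_disjoint) (simp, simp add: fS, auto simp: S_def)
      also have "\<dots> = (\<Sum>k\<in>B \<inter> {1..Suc n}. card (S 1))" by (rule sum.cong[OF refl], rule cS) blast
      finally show ?thesis by simp
    qed
    have "card {e \<in> erasers R. Q e J} = Suc n * card (S 1)" using sum[of UNIV] by (simp del: One_nat_def)
    then show ?thesis unfolding sum[of A] by (simp only: of_nat_mult) simp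
  qed
  have "prob {\<omega> \<in> space M. \<eta> n \<omega> \<in> A \<and> Q (ers \<omega>) (I R \<omega>)} =
      (\<Sum>J\<in>InSy R. prob {\<omega> \<in> space M. I R \<omega> = J} * real (card {e \<in> erasers R. e n \<in> A \<and> Q e J}) / fact R)"
  proof (rule prob_prefix_I[OF R1])
    fix h h' :: "nat \<Rightarrow> nat" and J assume a: "\<And>k. 1 \<le> k \<Longrightarrow> k < R \<Longrightarrow> h k = h' k"
    show "(h n \<in> A \<and> Q h J) = (h' n \<in> A \<and> Q h' J)" using a[OF n R] dep[OF a] by simp
  qed
  also have "\<dots> = real (card (A \<inter> {1..Suc n})) / real (Suc n) * (\<Sum>J\<in>InSy R. prob {\<omega> \<in> space M. I R \<omega> = J} * real (card {e \<in> erasers R. Q e J}) / fact R)"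
    unfolding count sum_distrib_left by (rule sum.cong) simp_all
  also have "(\<Sum>J\<in>InSy R. prob {\<omega> \<in> space M. I R \<omega> = J} * real (card {e \<in> erasers R. Q e J}) / fact R) = prob {\<omega> \<in> space M. Q (ers \<omega>) (I R \<omega>)}"
    by (rule prob_prefix_I[OF R1, symmetric]) (rule dep)
  finally show ?thesis .
qed

lemma prob_eta_levels:
  assumes n: "1 \<le> n" and N: "n < N"
  shows "prob {\<omega> \<in> space M. \<eta> n \<omega> \<in> A \<and> (\<forall>m\<in>{Suc n..N}. (I m \<omega>, \<eta> m \<omega>) \<in> B m)} =
    real (card (A \<inter> {1..Suc n})) / real (Suc n) * prob {\<omega> \<in> space M. \<forall>m\<in>{Suc n..N}. (I m \<omega>, \<eta> m \<omega>) \<in> B m}"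
proof -
  \<comment> \<open>The states at levels \<open>Suc n\<close> to \<open>N\<close> are functions of
    the system at level \<open>Suc N\<close> and the erasers from \<open>Suc n\<close> on. The top
    level is \<open>Suc N\<close> because the eraser at \<open>N\<close> must belong to the
    prefix.\<close>
  define Q where "Q h J \<longleftrightarrow> (\<forall>m\<in>{Suc n..N}. (erase_down h m (Suc N - m) J, h m) \<in> B m)" for h J
  have evB: "{\<omega> \<in> space M. \<forall>m\<in>{Suc n..N}. (I m \<omega>, \<eta> m \<omega>) \<in> B m} \<in> events"
  proof (rule sets.sets_Collect_finite_All)
    fix m assume "m \<in> {Suc n..N}"
    then have "1 \<le> m" by simp
    from measurable_sets[OF measurable_pair[OF this], of "B m"]
    show "{\<omega> \<in> space M. (I m \<omega>, \<eta> m \<omega>) \<in> B m} \<in> events" by (simp add: vimage_def Int_def conj_commute)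
  qed simp
  have dep: "Q h J = Q h' J" if "\<And>k. 1 \<le> k \<Longrightarrow> k < Suc N \<Longrightarrow> h k = h' k" for h h' J
  proof -
    have "erase_down h m (Suc N - m) J = erase_down h' m (Suc N - m) J \<and> h m = h' m" if "m \<in> {Suc n..N}" for m
      using that \<open>\<And>k. 1 \<le> k \<Longrightarrow> k < Suc N \<Longrightarrow> h k = h' k\<close> n by (auto intro!: erase_down_cong)
    then show ?thesis by (simp add: Q_def)
  qed
  have ins: "Q (h(n := k)) J = Q h J" for h k J
  proof -
    have "erase_down (h(n := k)) m (Suc N - m) J = erase_down h m (Suc N - m) J \<and> (h(n := k)) m = h m" if "m \<in> {Suc n..N}" for m
      using that by (auto intro!: erase_down_cong)
    then show ?thesis by (simp add: Q_def)
  qed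
  have eq: "AE \<omega> in M. (\<forall>m\<in>{Suc n..N}. (I m \<omega>, \<eta> m \<omega>) \<in> B m) = Q (ers \<omega>) (I (Suc N) \<omega>)"
    using AE_path
  proof eventually_elim
    case (elim \<omega>)
    have "I m \<omega> = erase_down (ers \<omega>) m (Suc N - m) (I (Suc N) \<omega>)" if "m \<in> {Suc n..N}" for m
      using erased_path.J_erase_down[OF elim, of m "Suc N - m"] that by simp
    then show ?case by (simp add: Q_def)
  qed
  have 1: "prob {\<omega> \<in> space M. \<eta> n \<omega> \<in> A \<and> (\<forall>m\<in>{Suc n..N}. (I m \<omega>, \<eta> m \<omega>) \<in> B m)} =
     prob {\<omega> \<in> space M. \<eta> n \<omega> \<in> A \<and> Q (ers \<omega>) (I (Suc N) \<omega>)}"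
  proof (rule finite_measure_eq_AE)
    show "{\<omega> \<in> space M. \<eta> n \<omega> \<in> A \<and> (\<forall>m\<in>{Suc n..N}. (I m \<omega>, \<eta> m \<omega>) \<in> B m)} \<in> events"
      by (rule sets.sets_Collect_conj[OF evB event_eta[OF n, of "\<lambda>k. k \<in> A"]])
    show "{\<omega> \<in> space M. \<eta> n \<omega> \<in> A \<and> Q (ers \<omega>) (I (Suc N) \<omega>)} \<in> events"
      by (rule sets.sets_Collect_conj[OF event_prefix_I event_eta[OF n, of "\<lambda>k. k \<in> A"]]) (simp, rule dep)
  qed (use eq in eventually_elim, simp)
  have 2: "prob {\<omega> \<in> space M. \<forall>m\<in>{Suc n..N}. (I m \<omega>, \<eta> m \<omega>) \<in> B m} = prob {\<omega> \<in> space M. Q (ers \<omega>) (I (Suc N) \<omega>)}"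
  proof (rule finite_measure_eq_AE[OF _ evB])
    show "{\<omega> \<in> space M. Q (ers \<omega>) (I (Suc N) \<omega>)} \<in> events"
      by (rule event_prefix_I) (simp, rule dep)
  qed (use eq in eventually_elim, simp)
  show ?thesis unfolding 1 2 by (rule prob_levels[OF n _ ins]) (use N in simp, rule dep)
qed

lemma prob_eta: "1 \<le> n \<Longrightarrow> prob {\<omega> \<in> space M. \<eta> n \<omega> \<in> A} = real (card (A \<inter> {1..Suc n})) / real (Suc n)"
  using prob_eta_levels[of n "Suc n" A "\<lambda>_. UNIV"] prob_space by simp

lemma erased_interval_process: "erased_interval_process M I \<eta>"
  unfolding erased_interval_process_def
proof (intro conjI allI impI)
  show "prob_space M" by (rule prob_space_axioms)
next
  fix n :: nat assume n: "1 \<le> n"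
  show "pair_process I \<eta> n \<in> measurable M (count_space UNIV)" by (rule measurable_pair[OF n])
  show "AE \<omega> in M. pair_process I \<eta> n \<omega> \<in> EIP_states n"
    using AE_path by eventually_elim (use n erased_path.J_InSy erased_path.h_range in \<open>fastforce simp: EIP_states_def\<close>)
  show "AE \<omega> in M. I n \<omega> = erase_system (I (n + 1) \<omega>) (\<eta> n \<omega>)"
    using AE_path
  proof eventually_elim
    case (elim \<omega>)
    show ?case using erased_path.J_erase[OF elim n] by (simp only: Suc_eq_plus1)
  qed
  show "distr M (count_space UNIV) (\<eta> n) = measure_pmf (pmf_of_set {1..n + 1})"
  proof (rule measure_eqI)
    fix A assume "A \<in> sets (distr M (count_space UNIV) (\<eta> n))"
    have "emeasure (distr M (count_space UNIV) (\<eta> n)) A = prob {\<omega> \<in> space M. \<eta> n \<omega> \<in> A}"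
      by (subst emeasure_distr[OF measurable_eta[OF n]]) (auto simp: emeasure_eq_measure vimage_def Int_def conj_commute)
    also have "\<dots> = emeasure (measure_pmf (pmf_of_set {1..n + 1})) A"
      unfolding prob_eta[OF n] by (subst emeasure_pmf_of_set) (auto simp: Int_commute)
    finally show "emeasure (distr M (count_space UNIV) (\<eta> n)) A = emeasure (measure_pmf (pmf_of_set {1..n + 1})) A" .
  qed simp
  let ?A = "{\<eta> n -` B \<inter> space M | B. True}"
  let ?X = "pair_process I \<eta>"
  let ?G = "{?X m -` B \<inter> space M | m B. m \<ge> n + 1}"
  \<comment> \<open>Conditions on finitely many later levels: they are stable under intersection and
    generate the tail. For them \<open>prob_eta_levels\<close> gives independence, which extends to
    the generated sigma-algebra.\<close>
  define C where "C = (\<lambda>(N, B). {\<omega> \<in> space M. \<forall>m\<in>{Suc n..N}. ?X m \<omega> \<in> B m})"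
  let ?C = "C ` ({Suc n..} \<times> UNIV)"
  have Cev: "c \<in> events" if c: "c \<in> ?C" for c
  proof -
    obtain N B where "c = {\<omega> \<in> space M. \<forall>m\<in>{Suc n..N}. ?X m \<omega> \<in> B m}" using c by (auto simp: C_def)
    also have "\<dots> \<in> events"
    proof (rule sets.sets_Collect_finite_All)
      fix m assume "m \<in> {Suc n..N}"
      then have "1 \<le> m" by simp
      from measurable_sets[OF measurable_pair[OF this], of "B m"]
      show "{\<omega> \<in> space M. ?X m \<omega> \<in> B m} \<in> events" by (simp add: vimage_def Int_def conj_commute)
    qed simp
    finally show ?thesis .
  qed
  have Aev: "?A \<subseteq> events" using measurable_sets[OF measurable_eta[OF n]] by auto
  have "indep_set ?A ?C"
  proof (rule indep_setI[OF Aev])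
    show "?C \<subseteq> events" using Cev by blast
    fix a c assume "a \<in> ?A" "c \<in> ?C"
    then obtain A N B where a: "a = {\<omega> \<in> space M. \<eta> n \<omega> \<in> A}" and N: "Suc n \<le> N"
      and c: "c = {\<omega> \<in> space M. \<forall>m\<in>{Suc n..N}. ?X m \<omega> \<in> B m}" by (auto simp: C_def)
    have "a \<inter> c = {\<omega> \<in> space M. \<eta> n \<omega> \<in> A \<and> (\<forall>m\<in>{Suc n..N}. ?X m \<omega> \<in> B m)}" unfolding a c by blast
    then have "prob (a \<inter> c) = prob {\<omega> \<in> space M. \<eta> n \<omega> \<in> A} * prob c"
      unfolding prob_eta[OF n] c using prob_eta_levels[OF n, of N A B] N by (simp only: Suc_le_eq)
    then show "prob (a \<inter> c) = prob a * prob c" by (simp only: a)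
  qed
  moreover have "Int_stable ?A"
  proof (rule Int_stableI)
    fix a b assume "a \<in> ?A" "b \<in> ?A"
    then obtain A B where "a = \<eta> n -` A \<inter> space M" "b = \<eta> n -` B \<inter> space M" by auto
    then have "a \<inter> b = \<eta> n -` (A \<inter> B) \<inter> space M" by auto
    then show "a \<inter> b \<in> ?A" by blast
  qed
  moreover have "Int_stable ?C"
  proof (rule Int_stableI)
    fix a b assume "a \<in> ?C" "b \<in> ?C"
    then obtain N B N' B' where N: "Suc n \<le> N" "Suc n \<le> N'" and ab: "a = C (N, B)" "b = C (N', B')" by auto
    have "a \<inter> b = C (max N N', \<lambda>m. (if m \<le> N then B m else UNIV) \<inter> (if m \<le> N' then B' m else UNIV))"
      unfolding ab C_def prod.case by (auto simp: Ball_def le_max_iff_disj)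
    then show "a \<inter> b \<in> ?C" using N by auto
  qed
  ultimately have ind: "indep_set (sigma_sets (space M) ?A) (sigma_sets (space M) ?C)"
    by (rule indep_set_sigma_sets)
  have sub: "sigma_sets (space M) ?G \<subseteq> sigma_sets (space M) ?C"
  proof (rule sigma_sets_mono, clarify)
    fix m B assume m: "n + 1 \<le> m"
    have "?X m -` B \<inter> space M = C (m, \<lambda>k. if k = m then B else UNIV)"
      using m unfolding C_def prod.case by auto
    then show "?X m -` B \<inter> space M \<in> sigma_sets (space M) ?C"
      using m by (auto intro!: sigma_sets.Basic)
  qed
  show "indep_set ?A (sigma_sets (space M) ?G)"
  proof (rule indep_setI[OF Aev])
    show "sigma_sets (space M) ?G \<subseteq> events"
      using sub ind unfolding indep_sets2_eq by blast
    fix a b assume "a \<in> ?A" "b \<in> sigma_sets (space M) ?G"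
    then show "prob (a \<inter> b) = prob a * prob b"
      using sub by (intro indep_setD[OF ind]) (auto intro: sigma_sets.Basic)
  qed
qed

end

section \<open>From independent erasers to uniform relabellings and escape\<close>

locale eip = prob_space M for M :: "'a measure" +
  fixes I :: "nat \<Rightarrow> 'a \<Rightarrow> nat set set" and \<eta> :: "nat \<Rightarrow> 'a \<Rightarrow> nat"
  assumes eip: "erased_interval_process M I \<eta>"
begin

lemma eip_measurable_pair: "1 \<le> n \<Longrightarrow> pair_process I \<eta> n \<in> measurable M (count_space UNIV)"
  using eip by (simp add: erased_interval_process_def)

lemma eip_measurable_eta: "1 \<le> n \<Longrightarrow> \<eta> n \<in> measurable M (count_space UNIV)"
  using measurable_compose[OF eip_measurable_pair, of n snd "count_space UNIV"] by simp

lemma eip_AE_path: "AE \<omega> in M. erased_path (\<lambda>n. I n \<omega>) (\<lambda>m. \<eta> m \<omega>)"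
proof -
  have "AE \<omega> in M. \<forall>n. 1 \<le> n \<longrightarrow> pair_process I \<eta> n \<omega> \<in> EIP_states n"
    "AE \<omega> in M. \<forall>n. 1 \<le> n \<longrightarrow> I n \<omega> = erase_system (I (n + 1) \<omega>) (\<eta> n \<omega>)"
    using eip unfolding erased_interval_process_def AE_all_countable by auto
  then show ?thesis
  proof eventually_elim
    case (elim \<omega>)
    have "pair_process I \<eta> n \<omega> \<in> EIP_states n" if "1 \<le> n" for n using elim(1) that by blast
    then show ?case
    proof (unfold_locales, goal_cases)
      case (1 n) then show ?case by (simp add: EIP_states_def)
    next
      case (2 n) then show ?case by (simp add: EIP_states_def)
    next
      case (3 n) then show ?case using elim(2) by (metis Suc_eq_plus1)
    qed
  qed
qed

definition tail :: "nat \<Rightarrow> 'a set set" where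
  "tail n = sigma_sets (space M) {pair_process I \<eta> m -` B \<inter> space M | m B. m \<ge> n}"

lemma tail_events: "1 \<le> n \<Longrightarrow> tail n \<subseteq> events"
  unfolding tail_def by (intro sets.sigma_sets_subset) (auto intro!: measurable_sets[OF eip_measurable_pair])

lemma tail_Suc: "tail (Suc n) \<subseteq> tail n"
  unfolding tail_def
proof (rule sigma_sets_mono', clarify)
  fix m B assume "Suc n \<le> m"
  then show "\<exists>m' B'. pair_process I \<eta> m -` B \<inter> space M = pair_process I \<eta> m' -` B' \<inter> space M \<and> n \<le> m'"
    by (intro exI[of _ m] exI[of _ B]) simp
qed

lemma sigma_algebra_tail: "sigma_algebra (space M) (tail n)"
  unfolding tail_def by (rule sigma_algebra_sigma_sets) auto

lemma eta_in_tail: "{\<omega> \<in> space M. P (\<eta> n \<omega>)} \<in> tail n"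
proof -
  have "{\<omega> \<in> space M. P (\<eta> n \<omega>)} = pair_process I \<eta> n -` {x. P (snd x)} \<inter> space M" by auto
  then show ?thesis unfolding tail_def by blast
qed

lemma I_in_tail: "{\<omega> \<in> space M. P (I n \<omega>)} \<in> tail n"
proof -
  have "{\<omega> \<in> space M. P (I n \<omega>)} = pair_process I \<eta> n -` {x. P (fst x)} \<inter> space M" by auto
  then show ?thesis unfolding tail_def by blast
qed

lemma prob_eta_tail:
  assumes n: "1 \<le> n" and k: "k \<in> {1..Suc n}" and C: "C \<in> tail (Suc n)"
  shows "prob ({\<omega> \<in> space M. \<eta> n \<omega> = k} \<inter> C) = prob C / real (Suc n)"
proof -
  have "indep_set {\<eta> n -` B \<inter> space M | B. True} (tail (Suc n))"
    using eip n unfolding erased_interval_process_def tail_def by simp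
  moreover have eq: "{\<omega> \<in> space M. \<eta> n \<omega> = k} = \<eta> n -` {k} \<inter> space M" by auto
  moreover have "\<eta> n -` {k} \<inter> space M \<in> {\<eta> n -` B \<inter> space M | B. True}" by blast
  ultimately have "prob ({\<omega> \<in> space M. \<eta> n \<omega> = k} \<inter> C) = prob {\<omega> \<in> space M. \<eta> n \<omega> = k} * prob C"
    using indep_setD[of _ _ "\<eta> n -` {k} \<inter> space M" C] C by simp
  moreover have "prob {\<omega> \<in> space M. \<eta> n \<omega> = k} = measure (distr M (count_space UNIV) (\<eta> n)) {k}"
    by (subst measure_distr[OF eip_measurable_eta[OF n]]) (auto simp: eq)
  moreover have "distr M (count_space UNIV) (\<eta> n) = measure_pmf (pmf_of_set {1..n + 1})"
    using eip n unfolding erased_interval_process_def by blast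
  moreover have "measure (measure_pmf (pmf_of_set {1..n + 1})) {k} = 1 / real (Suc n)"
    using k by (subst measure_pmf_of_set) auto
  ultimately show ?thesis by simp
qed

text \<open>Erasers are peeled off from the top: prescribing the eraser at \<open>n\<close> together
  with an event of the tail from \<open>Suc n\<close> on gives an event of the tail from
  \<open>n\<close> on and costs the factor \<open>1 / Suc n\<close>.\<close>

lemma prob_prefix:
  assumes "1 \<le> n" "e \<in> erasers n" "C \<in> tail n"
  shows "prob ({\<omega> \<in> space M. \<forall>k\<in>{1..<n}. \<eta> k \<omega> = e k} \<inter> C) = prob C / fact n"
  using assms
proof (induction n arbitrary: C e rule: nat_induct_at_least)
  case base
  have "C \<subseteq> space M" using tail_events[of 1] base sets.sets_into_space by blast
  then have "{\<omega> \<in> space M. \<forall>k\<in>{1..<1}. \<eta> k \<omega> = e k} \<inter> C = C" by auto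
  then show ?case by simp
next
  case (Suc n)
  define C' where "C' = {\<omega> \<in> space M. \<eta> n \<omega> = e n} \<inter> C"
  interpret T: sigma_algebra "space M" "tail n" by (rule sigma_algebra_tail)
  have C': "C' \<in> tail n" unfolding C'_def
    using T.Int[OF eta_in_tail[of "\<lambda>k. k = e n" n] subsetD[OF tail_Suc Suc.prems(2)]] .
  have "restrict e {1..<n} \<in> erasers n" using Suc.prems(1) by (auto simp: PiE_iff)
  from Suc.IH[OF this C'] have "prob ({\<omega> \<in> space M. \<forall>k\<in>{1..<n}. \<eta> k \<omega> = e k} \<inter> C') = prob C' / fact n" by simp
  moreover have "prob C' = prob C / real (Suc n)"
    unfolding C'_def using prob_eta_tail[OF Suc.hyps _ Suc.prems(2)] eraser_le[OF Suc.prems(1) Suc.hyps] by simp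
  moreover have "{\<omega> \<in> space M. \<forall>k\<in>{1..<Suc n}. \<eta> k \<omega> = e k} \<inter> C = {\<omega> \<in> space M. \<forall>k\<in>{1..<n}. \<eta> k \<omega> = e k} \<inter> C'"
    unfolding C'_def using Suc.hyps by (auto simp: less_Suc_eq)
  ultimately show ?case by simp
qed

end

sublocale eip \<subseteq> eraser_law
proof
  show "AE \<omega> in M. erased_path (\<lambda>n. I n \<omega>) (\<lambda>m. \<eta> m \<omega>)" by (rule eip_AE_path)
qed (auto simp del: One_nat_def intro: eip_measurable_pair prob_prefix[OF _ _ I_in_tail])

context eip begin

lemma sum_prob_I:
  assumes "1 \<le> n" shows "(\<Sum>J\<in>InSy n. prob {\<omega> \<in> space M. I n \<omega> = J}) = 1"
  using prob_prefix_I[OF assms, of "\<lambda>_ _. True"] card_erasers[of n] prob_space by simp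

lemma prob_perm_I:
  assumes n: "1 \<le> n"
  shows "prob {\<omega> \<in> space M. R (perm_of (ers \<omega>) n) (I n \<omega>)} =
    (\<Sum>J\<in>InSy n. prob {\<omega> \<in> space M. I n \<omega> = J} * real (card {p. p permutes {1..n} \<and> R p J}) / fact n)"
proof -
  have "R (perm_of h n) J = R (perm_of h' n) J" if "\<And>k. 1 \<le> k \<Longrightarrow> k < n \<Longrightarrow> h k = h' k" for h h' J
    using perm_of_cong[of n h h'] that by simp
  then have "prob {\<omega> \<in> space M. R (perm_of (ers \<omega>) n) (I n \<omega>)} =
    (\<Sum>J\<in>InSy n. prob {\<omega> \<in> space M. I n \<omega> = J} * real (card {e \<in> erasers n. R (perm_of e n) J}) / fact n)"
    by (intro prob_prefix_I[OF n, of "\<lambda>h. R (perm_of h n)"]) blast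
  also have "\<dots> = (\<Sum>J\<in>InSy n. prob {\<omega> \<in> space M. I n \<omega> = J} * real (card {p. p permutes {1..n} \<and> R p J}) / fact n)"
  proof (rule sum.cong[OF refl])
    fix J
    show "prob {\<omega> \<in> space M. I n \<omega> = J} * real (card {e \<in> erasers n. R (perm_of e n) J}) / fact n =
      prob {\<omega> \<in> space M. I n \<omega> = J} * real (card {p. p permutes {1..n} \<and> R p J}) / fact n"
      using card_erasers_perm_of[of n "\<lambda>p. R p J"] by (simp only:)
  qed
  finally show ?thesis .
qed

lemma event_perm_I: "1 \<le> n \<Longrightarrow> {\<omega> \<in> space M. R (perm_of (ers \<omega>) n) (I n \<omega>)} \<in> events"
  by (rule event_prefix_I[where Q = "\<lambda>h. R (perm_of h n)"]) (use perm_of_cong in metis)+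

lemma prob_perm_I_le:
  assumes n: "1 \<le> n" and le: "\<And>J. J \<in> InSy n \<Longrightarrow> real (card {p. p permutes {1..n} \<and> R p J}) \<le> c * fact n"
  shows "prob {\<omega> \<in> space M. R (perm_of (ers \<omega>) n) (I n \<omega>)} \<le> c"
proof -
  have "prob {\<omega> \<in> space M. R (perm_of (ers \<omega>) n) (I n \<omega>)} \<le> (\<Sum>J\<in>InSy n. prob {\<omega> \<in> space M. I n \<omega> = J} * c)"
    unfolding prob_perm_I[OF n]
  proof (rule sum_mono)
    fix J assume "J \<in> InSy n"
    then have "real (card {p. p permutes {1..n} \<and> R p J}) / fact n \<le> c" using le by (simp add: divide_le_eq)
    from mult_left_mono[OF this, of "prob {\<omega> \<in> space M. I n \<omega> = J}"]
    show "prob {\<omega> \<in> space M. I n \<omega> = J} * real (card {p. p permutes {1..n} \<and> R p J}) / fact n \<le> prob {\<omega> \<in> space M. I n \<omega> = J} * c"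
      by simp
  qed
  also have "\<dots> = c" using sum_prob_I[OF n] by (simp flip: sum_distrib_right)
  finally show ?thesis .
qed

text \<open>A vertex that is determined by \<open>I\<^sub>m\<close> and the positions of the vertices in \<open>{1..n} - {j}\<close> is
  exchangeable among the remaining vertices, hence equal to \<open>j\<close> with small probability.\<close>

lemma AE_escape:
  assumes j: "j \<in> {1..n}" and f: "f \<subseteq> {1..n} - {j}"
  shows "AE \<omega> in M. \<exists>m>n. perm_of (ers \<omega>) m (c (trace_ends (perm_of (ers \<omega>) m) (I m \<omega>) ({1..n} - {j}) f)) \<noteq> j"
proof -
  define V where "V = {1..n} - {j}"
  define R where "R p J l \<longleftrightarrow> p (c (trace_ends p J V f)) = l" for p :: "nat \<Rightarrow> nat" and J l
  have bound: "prob {\<omega> \<in> space M. R (perm_of (ers \<omega>) m) (I m \<omega>) j} \<le> 1 / real (m - n)" if m: "n < m" for m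
  proof (rule prob_perm_I_le)
    show "1 \<le> m" using m by simp
    fix J assume "J \<in> InSy m"
    \<comment> \<open>The vertices outside \<open>V\<close>: these are the ones that may be
      exchanged with \<open>j\<close>.\<close>
    define L where "L = insert j {Suc n..m}"
    have L: "L \<subseteq> {1..m}" "j \<in> L" using j m by (auto simp: L_def)
    have cL: "card L \<ge> m - n" unfolding L_def by (rule order_trans[OF _ card_mono[of "insert j {Suc n..m}" "{Suc n..m}"]]) auto
    have LV: "L \<inter> V = {}" by (auto simp: L_def V_def)
    have "card L * card {p. p permutes {1..m} \<and> R p J j} \<le> 1 * fact m"
    proof (rule card_permutations_equivariant[OF L, where R = "\<lambda>p. R p J"])
      fix p assume "p permutes {1..m}"
      have "{l \<in> L. R p J l} \<subseteq> {p (c (trace_ends p J V f))}" by (auto simp: R_def)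
      from card_mono[OF _ this] show "card {l \<in> L. R p J l} \<le> 1" by simp
    next
      fix p l assume p: "p permutes {1..m}" and l: "l \<in> L"
      have tr: "Transposition.transpose j l x \<in> V \<longleftrightarrow> x \<in> V" "x \<in> V \<Longrightarrow> Transposition.transpose j l x = x" for x
      proof -
        have "j \<notin> V" "l \<notin> V" using l L(2) LV by auto
        then show "Transposition.transpose j l x \<in> V \<longleftrightarrow> x \<in> V" "x \<in> V \<Longrightarrow> Transposition.transpose j l x = x"
          by (auto simp: Transposition.transpose_def)
      qed
      \<comment> \<open>The transposition fixes \<open>V\<close> pointwise, so the selected place
        stays the same and only its occupant changes from \<open>l\<close> to
        \<open>j\<close>.\<close>
      have "(Transposition.transpose j l \<circ> p) ` X \<inter> V = p ` X \<inter> V" for X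
      proof (intro equalityI subsetI)
        fix y assume "y \<in> (Transposition.transpose j l \<circ> p) ` X \<inter> V"
        then obtain x where "x \<in> X" "y = Transposition.transpose j l (p x)" "y \<in> V" by auto
        then show "y \<in> p ` X \<inter> V" using tr[of "p x"] by auto
      next
        fix y assume "y \<in> p ` X \<inter> V"
        then obtain x where "x \<in> X" "y = p x" "y \<in> V" by auto
        then show "y \<in> (Transposition.transpose j l \<circ> p) ` X \<inter> V" using tr(2)[of "p x"] by force
      qed
      then have "trace_ends (Transposition.transpose j l \<circ> p) J V f = trace_ends p J V f"
        unfolding trace_ends_def by simp
      then show "R (Transposition.transpose j l \<circ> p) J j \<longleftrightarrow> R p J l"
        unfolding R_def by (auto simp: Transposition.transpose_def)
    qed
    then have "real (card L) * real (card {p. p permutes {1..m} \<and> R p J j}) \<le> fact m"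
      by (metis mult_1 of_nat_fact of_nat_le_iff of_nat_mult)
    moreover have "real (m - n) * real (card {p. p permutes {1..m} \<and> R p J j}) \<le> real (card L) * real (card {p. p permutes {1..m} \<and> R p J j})"
      using cL by (intro mult_right_mono) auto
    ultimately have "real (m - n) * real (card {p. p permutes {1..m} \<and> R p J j}) \<le> fact m" by linarith
    then show "real (card {p. p permutes {1..m} \<and> R p J j}) \<le> 1 / real (m - n) * fact m"
      using m by (simp add: field_simps)
  qed
  have "AE \<omega> in M. \<not> (\<forall>m>n. R (perm_of (ers \<omega>) m) (I m \<omega>) j)"
  proof (rule AE_not_if_arbitrarily_small)
    fix \<epsilon> :: real assume "0 < \<epsilon>"
    then obtain k where k: "inverse (real (Suc k)) < \<epsilon>" using reals_Archimedean by blast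
    let ?A = "{\<omega> \<in> space M. R (perm_of (ers \<omega>) (n + Suc k)) (I (n + Suc k) \<omega>) j}"
    show "\<exists>A\<in>events. prob A \<le> \<epsilon> \<and> (AE \<omega> in M. (\<forall>m>n. R (perm_of (ers \<omega>) m) (I m \<omega>) j) \<longrightarrow> \<omega> \<in> A)"
    proof (intro bexI[of _ ?A] conjI)
      show "prob ?A \<le> \<epsilon>" using bound[of "n + Suc k"] k by (simp add: inverse_eq_divide)
      show "?A \<in> events" by (rule event_perm_I[where R = "\<lambda>p J. R p J j"]) simp
      show "AE \<omega> in M. (\<forall>m>n. R (perm_of (ers \<omega>) m) (I m \<omega>) j) \<longrightarrow> \<omega> \<in> ?A"
        using AE_space by eventually_elim auto
    qed
  qed
  then show ?thesis by (simp add: R_def V_def)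
qed

text \<open>There are only countably many parameters: the selector ranges over four functions, so it
  can stay inside the quantifier together with the finite sets \<open>f\<close>.\<close>

lemma AE_all_escape:
  "AE \<omega> in M. \<forall>n j f c. j \<in> {1..n} \<longrightarrow> f \<subseteq> {1..n} - {j} \<longrightarrow>
    c \<in> {\<lambda>S. Min (fst ` S), \<lambda>S. Max (fst ` S), \<lambda>S. Min (snd ` S), \<lambda>S. Max (snd ` S)} \<longrightarrow>
    (\<exists>m>n. perm_of (ers \<omega>) m (c (trace_ends (perm_of (ers \<omega>) m) (I m \<omega>) ({1..n} - {j}) f)) \<noteq> j)"
proof -
  let ?S = "SIGMA n:UNIV. SIGMA j:{1..n}. Pow ({1..n::nat} - {j}) \<times>
    {\<lambda>S :: (nat \<times> nat) set. Min (fst ` S), \<lambda>S. Max (fst ` S), \<lambda>S. Min (snd ` S), \<lambda>S. Max (snd ` S)}"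
  have fin: "finite (SIGMA j:{1..n}. Pow ({1..n::nat} - {j}) \<times>
    {\<lambda>S :: (nat \<times> nat) set. Min (fst ` S), \<lambda>S. Max (fst ` S), \<lambda>S. Min (snd ` S), \<lambda>S. Max (snd ` S)})" for n
    by (intro finite_SigmaI) auto
  have cnt: "countable ?S" by (rule countable_SIGMA[OF countableI_type], rule countable_finite, rule fin)
  have ae: "AE \<omega> in M. (case x of (n, j, f, c) \<Rightarrow> \<exists>m>n. perm_of (ers \<omega>) m (c (trace_ends (perm_of (ers \<omega>) m) (I m \<omega>) ({1..n} - {j}) f)) \<noteq> j)"
    if x: "x \<in> ?S" for x
  proof -
    obtain n j f c where eq: "x = (n, j, f, c)" by (cases x)
    then have "j \<in> {1..n}" "f \<subseteq> {1..n} - {j}" using x by auto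
    then show ?thesis unfolding eq prod.case by (rule AE_escape)
  qed
  have "AE \<omega> in M. \<forall>x\<in>?S. (case x of (n, j, f, c) \<Rightarrow> \<exists>m>n. perm_of (ers \<omega>) m (c (trace_ends (perm_of (ers \<omega>) m) (I m \<omega>) ({1..n} - {j}) f)) \<noteq> j)"
    by (rule AE_ball_countable[OF cnt, THEN iffD2]) (use ae in blast)
  then show ?thesis
  proof eventually_elim
    case (elim \<omega>)
    show ?case
    proof (intro allI impI)
      fix n j :: nat and f :: "nat set" and c :: "(nat \<times> nat) set \<Rightarrow> nat"
      assume a: "j \<in> {1..n}" "f \<subseteq> {1..n} - {j}"
        "c \<in> {\<lambda>S. Min (fst ` S), \<lambda>S. Max (fst ` S), \<lambda>S. Min (snd ` S), \<lambda>S. Max (snd ` S)}"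
      then have "(n, j, f, c) \<in> ?S" by blast
      from bspec[OF elim this] show "\<exists>m>n. perm_of (ers \<omega>) m (c (trace_ends (perm_of (ers \<omega>) m) (I m \<omega>) ({1..n} - {j}) f)) \<noteq> j"
        by simp
    qed
  qed
qed

end


text \<open>Markov's inequality, transferred from the extended nonnegative integral.\<close>

lemma (in prob_space) prob_ge_le:
  fixes F :: "'a \<Rightarrow> real"
  assumes F: "F \<in> borel_measurable M" and a: "0 < a" and le: "(\<integral>\<^sup>+\<omega>. ennreal (F \<omega>) \<partial>M) \<le> ennreal c" and c: "0 \<le> c"
  shows "prob {\<omega> \<in> space M. a \<le> F \<omega>} \<le> c / a"
proof -
  have "{\<omega> \<in> space M. a \<le> F \<omega>} = {\<omega> \<in> space M. 1 \<le> ennreal (1 / a) * ennreal (F \<omega>)}"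
  proof (rule Collect_cong, rule conj_cong[OF refl])
    fix \<omega>
    have "1 \<le> ennreal (1 / a) * ennreal (F \<omega>) \<longleftrightarrow> ennreal 1 \<le> ennreal (F \<omega> / a)"
      using a by (subst ennreal_mult'[symmetric]) auto
    also have "\<dots> \<longleftrightarrow> 1 \<le> F \<omega> / a" by (subst ennreal_le_iff2) auto
    also have "\<dots> \<longleftrightarrow> a \<le> F \<omega>" using a by (simp add: field_simps)
    finally show "a \<le> F \<omega> \<longleftrightarrow> 1 \<le> ennreal (1 / a) * ennreal (F \<omega>)" by simp
  qed
  then have "emeasure M {\<omega> \<in> space M. a \<le> F \<omega>} \<le> ennreal (1 / a) * (\<integral>\<^sup>+\<omega>. ennreal (F \<omega>) * indicator (space M) \<omega> \<partial>M)"
    using nn_integral_Markov_inequality[of "\<lambda>\<omega>. ennreal (F \<omega>)" "space M" M "ennreal (1 / a)"] F by simp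
  also have "(\<integral>\<^sup>+\<omega>. ennreal (F \<omega>) * indicator (space M) \<omega> \<partial>M) = (\<integral>\<^sup>+\<omega>. ennreal (F \<omega>) \<partial>M)"
    by (rule nn_integral_cong) simp
  also have "ennreal (1 / a) * \<dots> \<le> ennreal (1 / a) * ennreal c" using le by (rule mult_left_mono) simp
  also have "\<dots> = ennreal (c / a)" using a c by (simp add: ennreal_mult'[symmetric])
  finally show ?thesis using a c by (simp add: emeasure_eq_measure)
qed

section \<open>Limits of relative positions: existence, distinctness, density\<close>

context eip begin

lemma borel_measurable_prefix:
  fixes g :: "(nat \<Rightarrow> nat) \<Rightarrow> real"
  assumes n: "1 \<le> n" and g: "\<And>h h'. (\<And>k. 1 \<le> k \<Longrightarrow> k < n \<Longrightarrow> h k = h' k) \<Longrightarrow> g h = g h'"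
  shows "(\<lambda>\<omega>. g (ers \<omega>)) \<in> borel_measurable M"
  unfolding borel_measurable_iff_le
proof
  fix a
  show "{\<omega> \<in> space M. g (ers \<omega>) \<le> a} \<in> events"
    by (rule event_prefix_I[OF n, of "\<lambda>h _. g h \<le> a"]) (metis g)
qed

lemma nn_integral_prefix:
  fixes g :: "(nat \<Rightarrow> nat) \<Rightarrow> real"
  assumes n: "1 \<le> n" and g: "\<And>h h'. (\<And>k. 1 \<le> k \<Longrightarrow> k < n \<Longrightarrow> h k = h' k) \<Longrightarrow> g h = g h'"
    and pos: "\<And>h. 0 \<le> g h"
  shows "(\<integral>\<^sup>+\<omega>. ennreal (g (ers \<omega>)) \<partial>M) = ennreal ((\<Sum>e\<in>erasers n. g e) / fact n)"
proof -
  define B where "B e = {\<omega> \<in> space M. \<forall>k\<in>{1..<n}. \<eta> k \<omega> = e k}" for e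
  have B: "B e \<in> events" for e unfolding B_def by (rule event_prefix[OF n])
  have pB: "emeasure M (B e) = ennreal (1 / fact n)" if "e \<in> erasers n" for e
  proof -
    interpret T: sigma_algebra "space M" "tail n" by (rule sigma_algebra_tail)
    have "prob (B e \<inter> space M) = prob (space M) / fact n"
      unfolding B_def by (rule prob_prefix[OF n that T.top])
    moreover have "B e \<inter> space M = B e" by (auto simp: B_def)
    ultimately show ?thesis using prob_space by (simp add: emeasure_eq_measure)
  qed
  have "(\<integral>\<^sup>+\<omega>. ennreal (g (ers \<omega>)) \<partial>M) = (\<integral>\<^sup>+\<omega>. (\<Sum>e\<in>erasers n. ennreal (g e) * indicator (B e) \<omega>) \<partial>M)"
  proof (rule nn_integral_cong_AE)
    show "AE \<omega> in M. ennreal (g (ers \<omega>)) = (\<Sum>e\<in>erasers n. ennreal (g e) * indicator (B e) \<omega>)"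
      using AE_path AE_space
    proof eventually_elim
      case (elim \<omega>)
      interpret p: erased_path "\<lambda>n. I n \<omega>" "ers \<omega>" by (rule elim)
      define e0 where "e0 = restrict (ers \<omega>) {1..<n}"
      have e0: "e0 \<in> erasers n" using p.h_range by (auto simp: PiE_iff e0_def)
      have "indicator (B e) \<omega> = (if e = e0 then 1 else 0 :: ennreal)" if e: "e \<in> erasers n" for e
      proof -
        have "(\<forall>k\<in>{1..<n}. \<eta> k \<omega> = e k) \<longleftrightarrow> e = e0"
        proof
          assume "\<forall>k\<in>{1..<n}. \<eta> k \<omega> = e k"
          then show "e = e0" by (intro PiE_ext[OF e e0]) (simp add: e0_def)
        qed (simp add: e0_def)
        then show ?thesis using elim(2) by (simp add: B_def indicator_def)
      qed
      then have "(\<Sum>e\<in>erasers n. ennreal (g e) * indicator (B e) \<omega>) = (\<Sum>e\<in>erasers n. if e = e0 then ennreal (g e) else 0)"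
        by (intro sum.cong) auto
      also have "\<dots> = ennreal (g e0)" using e0 finite_erasers[of n] by (simp only: sum.delta' sum.delta if_True)
      also have "g e0 = g (ers \<omega>)" by (rule g) (simp add: e0_def)
      finally show ?case by simp
    qed
  qed
  also have "\<dots> = (\<Sum>e\<in>erasers n. ennreal (g e) * emeasure M (B e))"
    using B by (subst nn_integral_sum) (auto simp: nn_integral_cmult_indicator)
  also have "\<dots> = (\<Sum>e\<in>erasers n. ennreal (g e / fact n))"
    by (rule sum.cong[OF refl]) (simp only: pB ennreal_mult[symmetric] pos, simp add: pos ennreal_mult[symmetric])
  also have "\<dots> = ennreal (\<Sum>e\<in>erasers n. g e / fact n)" using pos by (intro sum_ennreal) simp
  finally show ?thesis by (simp only: sum_divide_distrib)
qed

lemma borel_measurable_square_dev: "1 \<le> n \<Longrightarrow> n \<le> m \<Longrightarrow> (\<lambda>\<omega>. square_dev n m i (ers \<omega>)) \<in> borel_measurable M"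
  by (rule borel_measurable_prefix[of m]) (auto intro: square_dev_cong)

lemma nn_integral_square_dev:
  assumes "1 \<le> i" "i \<le> n" "n \<le> m"
  shows "(\<integral>\<^sup>+\<omega>. ennreal (square_dev n m i (ers \<omega>)) \<partial>M) \<le> ennreal (1 / (4 * (real n + 1)))"
proof -
  have "(\<integral>\<^sup>+\<omega>. ennreal (square_dev n m i (ers \<omega>)) \<partial>M) = ennreal ((\<Sum>e\<in>erasers m. square_dev n m i e) / fact m)"
  proof (rule nn_integral_prefix)
    show "1 \<le> m" using assms by simp
    show "square_dev n m i h' = square_dev n m i h''" if "\<And>k. 1 \<le> k \<Longrightarrow> k < m \<Longrightarrow> h' k = h'' k" for h' h''
      by (rule square_dev_cong[OF assms(3) that])
  qed (simp add: square_dev_def)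
  also have "\<dots> \<le> ennreal (1 / (4 * (real n + 1)))"
  proof (rule ennreal_leI)
    have "(\<Sum>e\<in>erasers m. square_dev n m i e) / fact m \<le> (1 / (real n + 1) - 1 / (real m + 1)) / 4"
      using sum_square_dev[OF assms] by (simp add: divide_le_eq mult.commute)
    also have "\<dots> \<le> (1 / (real n + 1)) / 4" by (intro divide_right_mono) auto
    also have "(1 / (real n + 1)) / 4 = 1 / (4 * (real n + 1))" by (simp add: field_simps)
    finally show "(\<Sum>e\<in>erasers m. square_dev n m i e) / fact m \<le> 1 / (4 * (real n + 1))" .
  qed
  finally show ?thesis .
qed

text \<open>Along the levels \<open>(k + 1)^4\<close> the expected squared increment is of order
  \<open>1 / (k + 1)^4\<close>. Weighted by \<open>(k + 1)\<^sup>2\<close> it is still summable, so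
  the weighted squares are almost surely summable and the subsequence converges; monotone
  interpolation fills in the other levels.\<close>

lemma AE_convergent_label_pos:
  assumes i: "1 \<le> i"
  shows "AE \<omega> in M. (\<lambda>n. real (label_pos (ers \<omega>) n i) / real n) \<longlonglongrightarrow> U_of (ers \<omega>) i"
proof -
  \<comment> \<open>The terms are set to 0 until vertex \<open>i\<close> is certainly present, which
    is the case from \<open>i \<le> k + 1\<close> on; this changes only finitely many of
    them.\<close>
  define F where "F k \<omega> = (if i \<le> k + 1 then (real k + 1)\<^sup>2 * square_dev ((k+1)^4) ((k+2)^4) i (ers \<omega>) else 0)" for k \<omega>
  have k4: "k + 1 \<le> (k + 1)^4" "(k+1)^4 \<le> (k+2)^4" for k :: nat by (simp_all add: self_le_power power_mono)
  have mF: "F k \<in> borel_measurable M" for k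
  proof -
    have "1 \<le> (k+1)^4" using k4(1)[of k] by linarith
    from borel_measurable_square_dev[OF this k4(2), of i] show ?thesis
      unfolding F_def by (cases "i \<le> k + 1") auto
  qed
  have F0: "0 \<le> F k \<omega>" for k \<omega> by (simp add: F_def square_dev_def)
  have intF: "(\<integral>\<^sup>+\<omega>. ennreal (F k \<omega>) \<partial>M) \<le> ennreal (1 / (real k + 1)\<^sup>2)" for k
  proof (cases "i \<le> k + 1")
    case True
    have "(\<integral>\<^sup>+\<omega>. ennreal (F k \<omega>) \<partial>M) = (\<integral>\<^sup>+\<omega>. ennreal ((real k + 1)\<^sup>2) * ennreal (square_dev ((k+1)^4) ((k+2)^4) i (ers \<omega>)) \<partial>M)"
      using True by (intro nn_integral_cong) (simp add: F_def ennreal_mult square_dev_def)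
    also have "\<dots> = ennreal ((real k + 1)\<^sup>2) * (\<integral>\<^sup>+\<omega>. ennreal (square_dev ((k+1)^4) ((k+2)^4) i (ers \<omega>)) \<partial>M)"
      using borel_measurable_square_dev[of "(k+1)^4" "(k+2)^4" i] k4[of k] by (intro nn_integral_cmult) simp
    also have "\<dots> \<le> ennreal ((real k + 1)\<^sup>2) * ennreal (1 / (4 * (real ((k+1)^4) + 1)))"
      using i True k4(1)[of k] k4(2)[of k] by (intro mult_left_mono nn_integral_square_dev) auto
    also have "\<dots> = ennreal ((real k + 1)\<^sup>2 * (1 / (4 * (real ((k+1)^4) + 1))))" by (rule ennreal_mult[symmetric]) auto
    also have "\<dots> \<le> ennreal (1 / (real k + 1)\<^sup>2)"
    proof (rule ennreal_leI)
      define w where "w = real k + 1"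
      have w: "w > 0" by (simp add: w_def)
      have "real ((k+1)^4) = w ^ (2 + 2)" by (simp add: w_def add.commute)
      then have w4: "real ((k+1)^4) = w\<^sup>2 * w\<^sup>2" by (simp only: power_add)
      have "w\<^sup>2 * (1 / (4 * (w\<^sup>2 * w\<^sup>2 + 1))) \<le> w\<^sup>2 * (1 / (w\<^sup>2 * w\<^sup>2))"
      proof (rule mult_left_mono)
        have "1 / (4 * (z + 1)) \<le> 1 / z" if "0 < z" for z :: real using that by (intro frac_le) auto
        then show "1 / (4 * (w\<^sup>2 * w\<^sup>2 + 1)) \<le> 1 / (w\<^sup>2 * w\<^sup>2)" using w by simp
      qed simp
      also have "\<dots> = 1 / w\<^sup>2"
      proof -
        have "z * (1 / (z * z)) = 1 / z" for z :: real by simp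
        then show ?thesis .
      qed
      finally show "(real k + 1)\<^sup>2 * (1 / (4 * (real ((k+1)^4) + 1))) \<le> 1 / (real k + 1)\<^sup>2"
        unfolding w4 by (simp only: w_def)
    qed
    finally show ?thesis .
  next
    case False then show ?thesis by (simp add: F_def)
  qed
  have s2: "summable (\<lambda>k. 1 / (real k + 1)\<^sup>2)"
    using inverse_power_summable[of 2, where 'a = real] by (simp add: summable_Suc_iff[of "\<lambda>k. 1 / (real k)\<^sup>2", symmetric] add.commute inverse_eq_divide)
  have "(\<integral>\<^sup>+\<omega>. (\<Sum>k. ennreal (F k \<omega>)) \<partial>M) = (\<Sum>k. \<integral>\<^sup>+\<omega>. ennreal (F k \<omega>) \<partial>M)"
    using mF by (intro nn_integral_suminf) auto
  also have "\<dots> \<le> (\<Sum>k. ennreal (1 / (real k + 1)\<^sup>2))" by (rule suminf_le) (auto intro: intF)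
  also have "\<dots> = ennreal (\<Sum>k. 1 / (real k + 1)\<^sup>2)" using s2 by (intro suminf_ennreal2) auto
  finally have "(\<integral>\<^sup>+\<omega>. (\<Sum>k. ennreal (F k \<omega>)) \<partial>M) \<noteq> \<infinity>"
    by (metis ennreal_less_top infinity_ennreal_def leD)
  then have "AE \<omega> in M. (\<Sum>k. ennreal (F k \<omega>)) \<noteq> \<infinity>"
    using mF by (intro nn_integral_PInf_AE) auto
  then show ?thesis using AE_path
  proof eventually_elim
    case (elim \<omega>)
    interpret p: erased_path "\<lambda>n. I n \<omega>" "ers \<omega>" by (rule elim)
    define y where "y k = real (label_pos (ers \<omega>) ((k+1)^4) i) / (real ((k+1)^4) + 1)" for k
    have sF: "summable (\<lambda>k. F k \<omega>)" using elim(1) F0 by (intro summable_suminf_not_top) auto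
    have "\<forall>\<^sub>F k in sequentially. F k \<omega> = (real k + 1)\<^sup>2 * (y (Suc k) - y k)\<^sup>2"
      using eventually_ge_at_top[of i]
      by eventually_elim (simp add: F_def square_dev_def y_def)
    then have "summable (\<lambda>k. (real k + 1)\<^sup>2 * (y (Suc k) - y k)\<^sup>2)" by (rule summable_cong[THEN iffD1, OF _ sF])
    then have "convergent y" by (rule convergent_if_weighted_squares)
    then obtain L where L: "y \<longlonglongrightarrow> L" by (auto simp: convergent_def)
    have "(\<lambda>n. real (label_pos (ers \<omega>) n i) / real n) \<longlonglongrightarrow> L"
    proof (rule interpolate_fourth_powers[of i])
      show "label_pos (ers \<omega>) n i \<le> label_pos (ers \<omega>) m i" if "i \<le> n" "n \<le> m" for n m
        using p.pos_mono[OF i] that by blast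
    qed (use L in \<open>simp add: y_def[abs_def]\<close>)
    moreover from this have "U_of (ers \<omega>) i = L" unfolding U_of_def by (rule limI)
    ultimately show ?case by simp
  qed
qed

lemma borel_measurable_label_pos: "1 \<le> n \<Longrightarrow> (\<lambda>\<omega>. real (label_pos (ers \<omega>) n i)) \<in> borel_measurable M"
  by (rule borel_measurable_prefix[of n], assumption) (metis perm_of_cong)

lemma borel_measurable_U: "(\<lambda>\<omega>. U_of (ers \<omega>) i) \<in> borel_measurable M"
  unfolding U_of_def
proof (rule borel_measurable_lim_metric)
  fix n show "(\<lambda>\<omega>. real (label_pos (ers \<omega>) n i) / real n) \<in> borel_measurable M"
    using borel_measurable_label_pos[of n i] by (cases "n = 0") auto
qed

definition pos_dev :: "nat \<Rightarrow> nat \<Rightarrow> 'a \<Rightarrow> real" where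
  "pos_dev n i \<omega> = (real (label_pos (ers \<omega>) n i) / (real n + 1) - U_of (ers \<omega>) i)\<^sup>2"

lemma borel_measurable_pos_dev: "1 \<le> n \<Longrightarrow> pos_dev n i \<in> borel_measurable M"
  unfolding pos_dev_def using borel_measurable_label_pos[of n i] borel_measurable_U[of i] by measurable

text \<open>Fatou's lemma carries the bound for \<open>square_dev n m\<close>, which is uniform in
  \<open>m\<close>, over to the limit.\<close>

lemma nn_integral_pos_dev:
  assumes "1 \<le> i" "i \<le> n"
  shows "(\<integral>\<^sup>+\<omega>. ennreal (pos_dev n i \<omega>) \<partial>M) \<le> ennreal (1 / (4 * (real n + 1)))"
proof -
  have "AE \<omega> in M. ennreal (pos_dev n i \<omega>) = liminf (\<lambda>m. ennreal (square_dev n (m + n) i (ers \<omega>)))"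
    using AE_convergent_label_pos[OF assms(1)]
  proof eventually_elim
    case (elim \<omega>)
    have "(\<lambda>m. real m / (real m + 1)) \<longlonglongrightarrow> 1" using LIMSEQ_n_over_Suc_n by (simp add: add.commute)
    from tendsto_mult[OF elim this] have "(\<lambda>m. real (label_pos (ers \<omega>) m i) / real m * (real m / (real m + 1))) \<longlonglongrightarrow> U_of (ers \<omega>) i"
      by simp
    moreover have "\<forall>\<^sub>F m in sequentially. real (label_pos (ers \<omega>) m i) / real m * (real m / (real m + 1)) = real (label_pos (ers \<omega>) m i) / (real m + 1)"
      using eventually_gt_at_top[of 0] by eventually_elim simp
    ultimately have "(\<lambda>m. real (label_pos (ers \<omega>) m i) / (real m + 1)) \<longlonglongrightarrow> U_of (ers \<omega>) i"
      by (rule Lim_transform_eventually)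
    from LIMSEQ_ignore_initial_segment[OF this, of n]
    have "(\<lambda>m. real (label_pos (ers \<omega>) (m + n) i) / (real (m + n) + 1)) \<longlonglongrightarrow> U_of (ers \<omega>) i" .
    then have "(\<lambda>m. (real (label_pos (ers \<omega>) (m + n) i) / (real (m + n) + 1) - real (label_pos (ers \<omega>) n i) / (real n + 1))\<^sup>2) \<longlonglongrightarrow>
       (U_of (ers \<omega>) i - real (label_pos (ers \<omega>) n i) / (real n + 1))\<^sup>2"
      by (intro tendsto_intros)
    then have "(\<lambda>m. square_dev n (m + n) i (ers \<omega>)) \<longlonglongrightarrow> pos_dev n i \<omega>"
      unfolding square_dev_def pos_dev_def
        power2_commute[of "real (label_pos (ers \<omega>) n i) / (real n + 1)" "U_of (ers \<omega>) i"] .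
    then have "(\<lambda>m. ennreal (square_dev n (m + n) i (ers \<omega>))) \<longlonglongrightarrow> ennreal (pos_dev n i \<omega>)"
      by (rule tendsto_ennrealI)
    from lim_imp_Liminf[OF _ this] show ?case by simp
  qed
  then have "(\<integral>\<^sup>+\<omega>. ennreal (pos_dev n i \<omega>) \<partial>M) = (\<integral>\<^sup>+\<omega>. liminf (\<lambda>m. ennreal (square_dev n (m + n) i (ers \<omega>))) \<partial>M)"
    by (rule nn_integral_cong_AE)
  also have "\<dots> \<le> liminf (\<lambda>m. \<integral>\<^sup>+\<omega>. ennreal (square_dev n (m + n) i (ers \<omega>)) \<partial>M)"
    using assms borel_measurable_square_dev[of n _ i] by (intro nn_integral_liminf) auto
  also have "\<dots> \<le> ennreal (1 / (4 * (real n + 1)))"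
    by (rule Liminf_le) (use nn_integral_square_dev[OF assms] in \<open>auto intro!: always_eventually\<close>)
  finally show ?thesis .
qed

text \<open>Among the \<open>n - 1\<close> vertices other than \<open>j\<close>, vertex
  \<open>i\<close> plays no special role, and at most \<open>2 * \<lfloor>r\<rfloor>\<close> places
  other than that of \<open>j\<close> lie within distance \<open>r\<close> of it.\<close>

lemma prob_pos_close:
  assumes ij: "i \<in> {1..n}" "j \<in> {1..n}" "i \<noteq> j" and r: "0 \<le> r"
  shows "prob {\<omega> \<in> space M. \<bar>real (label_pos (ers \<omega>) n i) - real (label_pos (ers \<omega>) n j)\<bar> \<le> r} \<le> 2 * r / (real n - 1)"
proof -
  have n2: "n \<ge> 2" using ij by (cases "n \<le> 1") auto
  define k where "k = nat \<lfloor>r\<rfloor>"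
  define R where "R p l \<longleftrightarrow> \<bar>real (inv p l) - real (inv p j)\<bar> \<le> r" for p :: "nat \<Rightarrow> nat" and l
  define L where "L = {1..n} - {j}"
  have cL: "card L = n - 1" using ij by (simp add: L_def)
  have "card L * card {p. p permutes {1..n} \<and> R p i} \<le> (2 * k) * fact n"
  proof (rule card_permutations_equivariant[where R = R])
    show "L \<subseteq> {1..n}" "i \<in> L" using ij by (auto simp: L_def)
    fix p assume p: "p permutes {1..n}"
    have inj: "inv p x = inv p y \<longleftrightarrow> x = y" for x y by (metis permutes_inverses(1)[OF p])
    have "inv p ` {l \<in> L. R p l} \<subseteq> {inv p j - k..inv p j + k} - {inv p j}"
    proof (rule image_subsetI)
      fix l assume l: "l \<in> {l \<in> L. R p l}"
      have "\<bar>int (inv p l) - int (inv p j)\<bar> \<le> int k"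
      proof -
        have "real_of_int \<bar>int (inv p l) - int (inv p j)\<bar> \<le> r" using l by (simp add: R_def)
        then have "\<bar>int (inv p l) - int (inv p j)\<bar> \<le> \<lfloor>r\<rfloor>" by (simp add: le_floor_iff)
        then show ?thesis using r by (simp add: k_def)
      qed
      then have "inv p l \<in> {inv p j - k..inv p j + k}" by auto
      moreover have "inv p l \<noteq> inv p j" using l inj by (auto simp: L_def)
      ultimately show "inv p l \<in> {inv p j - k..inv p j + k} - {inv p j}" by blast
    qed
    then have "card (inv p ` {l \<in> L. R p l}) \<le> card ({inv p j - k..inv p j + k} - {inv p j})"
      by (intro card_mono) auto
    also have "\<dots> = card {inv p j - k..inv p j + k} - 1" by (subst card_Diff_singleton) auto
    also have "\<dots> \<le> 2 * k" by auto
    also have "card (inv p ` {l \<in> L. R p l}) = card {l \<in> L. R p l}"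
      by (rule card_image) (auto simp: inj_on_def inj)
    finally show "card {l \<in> L. R p l} \<le> 2 * k" .
  next
    fix p l assume p: "p permutes {1..n}" and l: "l \<in> L"
    have t: "Transposition.transpose i l permutes {1..n}" using ij l by (intro permutes_swap_id) (auto simp: L_def)
    have "inv (Transposition.transpose i l \<circ> p) x = inv p (Transposition.transpose i l x)" for x
      by (rule permutes_inv_eq[OF permutes_compose[OF p t], THEN iffD2])
         (simp add: permutes_inverses[OF p])
    then show "R (Transposition.transpose i l \<circ> p) i \<longleftrightarrow> R p l"
      using ij l by (simp add: R_def L_def)
  qed
  then have "real (n - 1) * real (card {p. p permutes {1..n} \<and> R p i}) \<le> real (2 * k) * fact n"
    unfolding cL by (metis of_nat_fact of_nat_le_iff of_nat_mult)
  also have "\<dots> \<le> 2 * r * fact n" using r by (intro mult_right_mono) (auto simp: k_def)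
  finally have "real (card {p. p permutes {1..n} \<and> R p i}) \<le> 2 * r / (real n - 1) * fact n"
    using n2 by (simp add: field_simps of_nat_diff)
  then have "prob {\<omega> \<in> space M. R (perm_of (ers \<omega>) n) i} \<le> 2 * r / (real n - 1)"
    using n2 by (intro prob_perm_I_le[of n "\<lambda>p _. R p i"]) auto
  then show ?thesis by (simp add: R_def)
qed

text \<open>If the limits agree, then at level \<open>n\<close> either the two places are within
  \<open>\<epsilon> * n\<close> of each other, or one relative position is far from its limit. The
  first is controlled by counting, the second by the second moment.\<close>

lemma AE_U_distinct:
  assumes ij: "1 \<le> i" "1 \<le> j" "i \<noteq> j"
  shows "AE \<omega> in M. U_of (ers \<omega>) i \<noteq> U_of (ers \<omega>) j"
proof (rule AE_not_if_arbitrarily_small)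
  fix \<epsilon>' :: real assume e': "0 < \<epsilon>'"
  \<comment> \<open>The parts sum to \<open>5 * \<epsilon>\<close>: \<open>4 * \<epsilon>\<close>
    for close places and \<open>\<epsilon> / 2\<close> for each of the two deviations.\<close>
  define \<epsilon> where "\<epsilon> = \<epsilon>' / 5"
  have e: "0 < \<epsilon>" using e' by (simp add: \<epsilon>_def)
  \<comment> \<open>For such levels the Markov bound
    \<open>4 / ((n + 1) * \<epsilon>\<^sup>2)\<close> drops to
    \<open>\<epsilon> / 2\<close>.\<close>
  obtain n0 :: nat where n0: "8 / \<epsilon>^3 < real n0" using reals_Archimedean2 by blast
  define n where "n = max (max i j) (max 2 n0)"
  have n: "i \<in> {1..n}" "j \<in> {1..n}" "2 \<le> n" "n0 \<le> n" using ij by (auto simp: n_def)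
  define A1 where "A1 = {\<omega> \<in> space M. \<bar>real (label_pos (ers \<omega>) n i) - real (label_pos (ers \<omega>) n j)\<bar> \<le> \<epsilon> * real n}"
  define A2 where "A2 l = {\<omega> \<in> space M. (\<epsilon> / 4)\<^sup>2 \<le> pos_dev n l \<omega>}" for l
  have m: "A1 \<in> events" "A2 l \<in> events" for l
  proof -
    have "1 \<le> n" using n by simp
    note [measurable] = borel_measurable_label_pos[OF this] borel_measurable_pos_dev[OF this]
    show "A1 \<in> events" "A2 l \<in> events" unfolding A1_def A2_def by measurable
  qed
  have p1: "prob A1 \<le> 4 * \<epsilon>"
  proof -
    have "prob A1 \<le> 2 * (\<epsilon> * real n) / (real n - 1)" unfolding A1_def using n ij e by (intro prob_pos_close) auto
    also have "\<dots> \<le> 4 * \<epsilon>"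
    proof -
      have "real n \<le> 2 * (real n - 1)" using n(3) by simp
      from mult_left_mono[OF this, of "2 * \<epsilon>"] show ?thesis using n(3) e by (simp add: divide_le_eq algebra_simps)
    qed
    finally show ?thesis .
  qed
  have p2: "prob (A2 l) \<le> \<epsilon> / 2" if l: "l \<in> {1..n}" for l
  proof -
    have "prob (A2 l) \<le> (1 / (4 * (real n + 1))) / (\<epsilon> / 4)\<^sup>2"
      unfolding A2_def using l e by (intro prob_ge_le borel_measurable_pos_dev nn_integral_pos_dev) auto
    also have "\<dots> = 4 / ((real n + 1) * \<epsilon>\<^sup>2)"
    proof -
      have "(1 / (4 * w)) / (\<epsilon> / 4)\<^sup>2 = 4 / (w * \<epsilon>\<^sup>2)" for w
        using e by (cases "w = 0") (simp_all add: power_divide field_simps)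
      then show ?thesis .
    qed
    also have "\<dots> \<le> \<epsilon> / 2"
    proof -
      have "8 < real n0 * \<epsilon>^3" using n0 e by (simp add: field_simps)
      also have "\<dots> \<le> (real n + 1) * \<epsilon>^3" using n(4) e by (intro mult_right_mono) auto
      also have "\<dots> = \<epsilon> * ((real n + 1) * \<epsilon>\<^sup>2)" by (simp add: power3_eq_cube power2_eq_square)
      finally have "4 \<le> \<epsilon> / 2 * ((real n + 1) * \<epsilon>\<^sup>2)" by simp
      moreover have "0 < (real n + 1) * \<epsilon>\<^sup>2" using e by (intro mult_pos_pos) auto
      ultimately show ?thesis by (simp only: pos_divide_le_eq)
    qed
    finally show ?thesis .
  qed
  show "\<exists>A\<in>events. prob A \<le> \<epsilon>' \<and> (AE \<omega> in M. U_of (ers \<omega>) i = U_of (ers \<omega>) j \<longrightarrow> \<omega> \<in> A)"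
  proof (intro bexI[of _ "A1 \<union> (A2 i \<union> A2 j)"] conjI)
    have "prob (A1 \<union> (A2 i \<union> A2 j)) \<le> prob A1 + (prob (A2 i) + prob (A2 j))"
      using m measure_Un_le[of A1 M "A2 i \<union> A2 j"] measure_Un_le[of "A2 i" M "A2 j"] by simp
    then show "prob (A1 \<union> (A2 i \<union> A2 j)) \<le> \<epsilon>'" using p1 p2[OF n(1)] p2[OF n(2)] by (simp add: \<epsilon>_def)
    show "AE \<omega> in M. U_of (ers \<omega>) i = U_of (ers \<omega>) j \<longrightarrow> \<omega> \<in> A1 \<union> (A2 i \<union> A2 j)"
      using AE_space
    proof eventually_elim
      case (elim \<omega>)
      show ?case
      proof (intro impI, rule ccontr)
        assume eq: "U_of (ers \<omega>) i = U_of (ers \<omega>) j" and no: "\<omega> \<notin> A1 \<union> (A2 i \<union> A2 j)"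
        have dev: "\<bar>real (label_pos (ers \<omega>) n l) / (real n + 1) - U_of (ers \<omega>) l\<bar> < \<epsilon> / 4" if "l = i \<or> l = j" for l
        proof -
          have "pos_dev n l \<omega> < (\<epsilon> / 4)\<^sup>2" using no elim that by (auto simp: A2_def)
          then have "\<bar>real (label_pos (ers \<omega>) n l) / (real n + 1) - U_of (ers \<omega>) l\<bar>\<^sup>2 < (\<epsilon> / 4)\<^sup>2" by (simp add: pos_dev_def)
          then show ?thesis by (rule power2_less_imp_less) (use e in simp)
        qed
        have "\<bar>real (label_pos (ers \<omega>) n i) / (real n + 1) - real (label_pos (ers \<omega>) n j) / (real n + 1)\<bar> < \<epsilon> / 2"
        proof -
          have "\<bar>x - y\<bar> < \<epsilon> / 2" if "\<bar>x - u\<bar> < \<epsilon> / 4" "\<bar>y - u\<bar> < \<epsilon> / 4" for x y u :: real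
            using that by linarith
          then show ?thesis using dev[of i] dev[of j] eq by (metis (full_types))
        qed
        then have "\<bar>(real (label_pos (ers \<omega>) n i) - real (label_pos (ers \<omega>) n j)) / (real n + 1)\<bar> < \<epsilon> / 2"
          by (simp add: diff_divide_distrib)
        then have "\<bar>real (label_pos (ers \<omega>) n i) - real (label_pos (ers \<omega>) n j)\<bar> < \<epsilon> / 2 * (real n + 1)"
          by (simp add: abs_divide pos_divide_less_eq)
        also have "\<dots> \<le> \<epsilon> * real n"
        proof -
          have "real n + 1 \<le> 2 * real n" using n(3) by simp
          from mult_left_mono[OF this, of "\<epsilon> / 2"] show ?thesis using e by simp
        qed
        finally show False using no elim by (simp add: A1_def)
      qed
    qed
  qed (use m in auto)
qed

text \<open>If no limit falls between \<open>a\<close> and \<open>b\<close>, every vertex whose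
  relative position lies in the middle third deviates from its limit by at least \<open>d\<close>.
  The number of these vertices is of order \<open>d * n\<close>, so the sum of squared deviations
  would be large, while its expectation is at most 1.\<close>

lemma AE_U_dense:
  assumes ab: "0 \<le> a" "a < b" "b \<le> 1"
  shows "AE \<omega> in M. \<exists>i\<ge>1. a < U_of (ers \<omega>) i \<and> U_of (ers \<omega>) i < b"
proof -
  define d where "d = (b - a) / 3"
  have d: "0 < d" using ab by (simp add: d_def)
  have "AE \<omega> in M. \<not> (\<forall>i\<ge>1. \<not> (a < U_of (ers \<omega>) i \<and> U_of (ers \<omega>) i < b))"
  proof (rule AE_not_if_arbitrarily_small)
    fix \<epsilon> :: real assume e: "0 < \<epsilon>"
    obtain n :: nat where n0: "(1 / (d\<^sup>2 * \<epsilon>) + 1) / d < real n" using reals_Archimedean2 by blast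
    have "0 < (1 / (d\<^sup>2 * \<epsilon>) + 1) / d" using d e by (simp add: add_pos_pos)
    then have n1: "1 \<le> n" using n0 by (cases n) auto
    have nd: "1 / (d\<^sup>2 * \<epsilon>) < d * (real n + 1) - 1"
    proof -
      have "1 / (d\<^sup>2 * \<epsilon>) + 1 < real n * d" using n0 d by (simp add: divide_less_eq)
      also have "\<dots> \<le> d * (real n + 1)" using d by (simp add: algebra_simps)
      finally show ?thesis by simp
    qed
    \<comment> \<open>The value that the sum must reach if the interval is missed:
      \<open>d\<^sup>2\<close> for each of at least \<open>d * (real n + 1) - 1\<close> places. The
      choice of \<open>n\<close> makes it exceed \<open>1 / \<epsilon>\<close>.\<close>
    define c where "c = d\<^sup>2 * (d * (real n + 1) - 1)"
    have c: "1 / \<epsilon> < c"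
    proof -
      have "d\<^sup>2 * (1 / (d\<^sup>2 * \<epsilon>)) < c" unfolding c_def using nd d by (intro mult_strict_left_mono) auto
      then show ?thesis using d by simp
    qed
    then have c0: "0 < c" using e by (meson less_trans zero_less_divide_1_iff)
    define S where "S \<omega> = (\<Sum>i\<in>{1..n}. pos_dev n i \<omega>)" for \<omega>
    have mS: "S \<in> borel_measurable M" unfolding S_def[abs_def] using borel_measurable_pos_dev[OF n1] by measurable
    have pd: "0 \<le> pos_dev n i \<omega>" for i \<omega> by (simp add: pos_dev_def)
    have "(\<integral>\<^sup>+\<omega>. ennreal (S \<omega>) \<partial>M) = (\<integral>\<^sup>+\<omega>. (\<Sum>i\<in>{1..n}. ennreal (pos_dev n i \<omega>)) \<partial>M)"
      unfolding S_def by (intro nn_integral_cong sum_ennreal[symmetric] pd)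
    also have "\<dots> = (\<Sum>i\<in>{1..n}. \<integral>\<^sup>+\<omega>. ennreal (pos_dev n i \<omega>) \<partial>M)"
      using borel_measurable_pos_dev[OF n1] by (intro nn_integral_sum) simp
    also have "\<dots> \<le> (\<Sum>i\<in>{1..n}. ennreal (1 / (4 * (real n + 1))))"
      by (intro sum_mono nn_integral_pos_dev) auto
    also have "\<dots> = ennreal (real n * (1 / (4 * (real n + 1))))"
      by (subst sum_ennreal) auto
    also have "\<dots> \<le> ennreal 1" by (intro ennreal_leI) (simp add: field_simps)
    finally have "prob {\<omega> \<in> space M. c \<le> S \<omega>} \<le> 1 / c" by (intro prob_ge_le mS c0) auto
    also have "\<dots> \<le> \<epsilon>" using c c0 e by (simp add: field_simps)
    finally have small: "prob {\<omega> \<in> space M. c \<le> S \<omega>} \<le> \<epsilon>" .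
    show "\<exists>A\<in>events. prob A \<le> \<epsilon> \<and> (AE \<omega> in M. (\<forall>i\<ge>1. \<not> (a < U_of (ers \<omega>) i \<and> U_of (ers \<omega>) i < b)) \<longrightarrow> \<omega> \<in> A)"
    proof (intro bexI[of _ "{\<omega> \<in> space M. c \<le> S \<omega>}"] conjI small)
      show "{\<omega> \<in> space M. c \<le> S \<omega>} \<in> events" using mS by measurable
      show "AE \<omega> in M. (\<forall>i\<ge>1. \<not> (a < U_of (ers \<omega>) i \<and> U_of (ers \<omega>) i < b)) \<longrightarrow> \<omega> \<in> {\<omega> \<in> space M. c \<le> S \<omega>}"
        using AE_space
      proof eventually_elim
        case (elim \<omega>)
        show ?case
        proof
          assume no: "\<forall>i\<ge>1. \<not> (a < U_of (ers \<omega>) i \<and> U_of (ers \<omega>) i < b)"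
          define w where "w = real n + 1"
          have w: "0 < w" by (simp add: w_def)
          define P where "P = {nat \<lceil>(a + d) * w\<rceil>..nat \<lfloor>(b - d) * w\<rfloor>}"
          have bnd: "0 < (a + d) * w" "(b - d) * w < w"
          proof -
            show "0 < (a + d) * w" using ab d w by (intro mult_pos_pos) auto
            have "b - d < 1" using ab d by simp
            then show "(b - d) * w < w" using mult_strict_right_mono[of "b - d" 1 w] w by simp
          qed
          have mem: "p \<in> {1..n} \<and> (a + d) * w \<le> real p \<and> real p \<le> (b - d) * w" if p: "p \<in> P" for p
          proof -
            have p': "nat \<lceil>(a + d) * w\<rceil> \<le> p" "p \<le> nat \<lfloor>(b - d) * w\<rfloor>" using p unfolding P_def atLeastAtMost_iff by blast+
            have 1: "(a + d) * w \<le> real p" using p'(1) by simp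
            then have "0 < p" using bnd(1) by (cases p) auto
            with p'(2) have "int p \<le> \<lfloor>(b - d) * w\<rfloor>" by linarith
            then have 2: "real p \<le> (b - d) * w" by linarith
            with bnd(2) have "real p < real n + 1" unfolding w_def by linarith
            then show ?thesis using 1 2 \<open>0 < p\<close> by auto
          qed
          have cP: "d * w - 1 \<le> real (card P)"
          proof -
            have "(b - d) * w - (a + d) * w = d * w" by (simp add: d_def field_simps)
            moreover have "real (nat \<lceil>(a + d) * w\<rceil>) < (a + d) * w + 1" using bnd by linarith
            moreover have "(b - d) * w - 1 < real (nat \<lfloor>(b - d) * w\<rfloor>)" by linarith
            ultimately have "d * w - 2 < real (nat \<lfloor>(b - d) * w\<rfloor>) - real (nat \<lceil>(a + d) * w\<rceil>)" by linarith
            then show ?thesis unfolding P_def card_atLeastAtMost by linarith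
          qed
          have big: "d\<^sup>2 \<le> pos_dev n (perm_of (ers \<omega>) n p) \<omega>" if p: "p \<in> P" for p
          proof -
            have l: "perm_of (ers \<omega>) n p \<in> {1..n}"
              using mem[OF p] label_pos_in_iff[of "ers \<omega>" n "perm_of (ers \<omega>) n p"] by simp
            then have "U_of (ers \<omega>) (perm_of (ers \<omega>) n p) \<le> a \<or> b \<le> U_of (ers \<omega>) (perm_of (ers \<omega>) n p)"
              using no by (meson atLeastAtMost_iff linorder_not_le)
            moreover have "a + d \<le> real p / w" "real p / w \<le> b - d" using mem[OF p] w by (auto simp: field_simps)
            ultimately have "d \<le> \<bar>real p / w - U_of (ers \<omega>) (perm_of (ers \<omega>) n p)\<bar>" by linarith
            then have "d\<^sup>2 \<le> \<bar>real p / w - U_of (ers \<omega>) (perm_of (ers \<omega>) n p)\<bar>\<^sup>2" using d by (intro power_mono) auto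
            then show ?thesis by (simp add: pos_dev_def w_def)
          qed
          have "c \<le> d\<^sup>2 * real (card P)" unfolding c_def using cP by (intro mult_left_mono) (auto simp: w_def)
          also have "\<dots> = (\<Sum>p\<in>P. d\<^sup>2)" by simp
          also have "\<dots> \<le> (\<Sum>p\<in>P. pos_dev n (perm_of (ers \<omega>) n p) \<omega>)" by (rule sum_mono) (rule big)
          also have "\<dots> \<le> (\<Sum>p\<in>{1..n}. pos_dev n (perm_of (ers \<omega>) n p) \<omega>)"
            using mem pd by (intro sum_mono2) auto
          also have "\<dots> = S \<omega>"
            unfolding S_def by (rule sum.permute[OF perm_of_permutes, unfolded comp_def, symmetric])
          finally show "\<omega> \<in> {\<omega> \<in> space M. c \<le> S \<omega>}" using elim by simp
        qed
      qed
    qed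
  qed
  then show ?thesis by (rule AE_mp) (auto intro!: AE_I2)
qed

lemma AE_typical_path: "AE \<omega> in M. typical_path (\<lambda>n. I n \<omega>) (ers \<omega>) (U_of (ers \<omega>))"
proof -
  have c: "AE \<omega> in M. \<forall>i. 1 \<le> i \<longrightarrow> (\<lambda>n. real (label_pos (ers \<omega>) n i) / real n) \<longlonglongrightarrow> U_of (ers \<omega>) i"
    unfolding AE_all_countable using AE_convergent_label_pos by (auto intro: AE_impI)
  have d: "AE \<omega> in M. \<forall>i j. 1 \<le> i \<longrightarrow> 1 \<le> j \<longrightarrow> i \<noteq> j \<longrightarrow> U_of (ers \<omega>) i \<noteq> U_of (ers \<omega>) j"
    unfolding AE_all_countable using AE_U_distinct by (auto intro!: AE_impI)
  \<comment> \<open>Rational end points suffice, since two rationals fit between any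
    \<open>a < b\<close>; this leaves countably many events.\<close>
  have "countable {(a, b). a \<in> \<rat> \<and> b \<in> \<rat> \<and> 0 \<le> a \<and> a < b \<and> b \<le> (1::real)}"
    by (rule countable_subset[of _ "\<rat> \<times> \<rat>"]) (auto simp: countable_rat)
  from AE_ball_countable[OF this, THEN iffD2, of "\<lambda>\<omega> (a, b). \<exists>i\<ge>1. a < U_of (ers \<omega>) i \<and> U_of (ers \<omega>) i < b" M]
  have e: "AE \<omega> in M. \<forall>(a, b)\<in>{(a, b). a \<in> \<rat> \<and> b \<in> \<rat> \<and> 0 \<le> a \<and> a < b \<and> b \<le> (1::real)}. \<exists>i\<ge>1. a < U_of (ers \<omega>) i \<and> U_of (ers \<omega>) i < b"
    using AE_U_dense by auto
  show ?thesis using AE_path c d e AE_all_escape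
  proof eventually_elim
    case (elim \<omega>)
    interpret erased_path "\<lambda>n. I n \<omega>" "ers \<omega>" by (rule elim)
    show ?case
    proof (unfold_locales, goal_cases)
      case (1 i) then show ?case using elim(2) by blast
    next
      case 2 then show ?case using elim(3) by (auto simp: inj_on_def)
    next
      case (3 a b)
      obtain a' where a': "a' \<in> \<rat>" "a < a'" "a' < b" using Rats_dense_in_real[OF 3(2)] by blast
      obtain b' where b': "b' \<in> \<rat>" "a' < b'" "b' < b" using Rats_dense_in_real[OF a'(3)] by blast
      have "(a', b') \<in> {(a, b). a \<in> \<rat> \<and> b \<in> \<rat> \<and> 0 \<le> a \<and> a < b \<and> b \<le> (1::real)}" using a' b' 3 by auto
      from bspec[OF elim(4) this] show ?case using a' b' by force
    next
      case (4 j n f c) then show ?case using elim(5) by blast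
    qed
  qed
qed

end

section \<open>Laws on path space\<close>

lemma space_path_space: "space (path_space A) = PiE {1..} A"
  by (simp add: path_space_def space_PiM)

lemma topspace_path_topology: "topspace (path_topology A) = PiE {1..} A"
  by (simp add: path_topology_def topspace_product_topology)

lemma measurable_path_coordinate:
  assumes "1 \<le> n" shows "(\<lambda>x. x n) \<in> measurable (path_space A) (count_space (A n))"
  unfolding path_space_def using assms by (intro measurable_component_singleton) simp

text \<open>There are only finitely many beginnings of length \<open>N\<close>, and the set is the
  union of the cylinders over the admissible ones.\<close>

lemma sets_path_cylinder:
  assumes fin: "\<And>n. finite (A n)"
    and dep: "\<And>x y. x \<in> PiE {1..} A \<Longrightarrow> y \<in> PiE {1..} A \<Longrightarrow> (\<And>k. 1 \<le> k \<Longrightarrow> k \<le> N \<Longrightarrow> x k = y k) \<Longrightarrow> P x = P y"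
  shows "{x \<in> PiE {1..} A. P x} \<in> sets (path_space A)"
proof -
  define C where "C g = {x \<in> space (path_space A). \<forall>k\<in>{1..N}. x k \<in> {g k}}" for g :: "nat \<Rightarrow> 'a"
  have C: "C g \<in> sets (path_space A)" for g
    unfolding C_def
  proof (rule sets.sets_Collect_finite_All)
    fix k assume k: "k \<in> {1..N}"
    have "{x \<in> space (path_space A). x k \<in> {g k}} = (\<lambda>x. x k) -` ({g k} \<inter> A k) \<inter> space (path_space A)"
      using k PiE_mem[of _ "{1..}" A k] by (auto simp: space_path_space)
    also have "\<dots> \<in> sets (path_space A)" using k by (intro measurable_sets[OF measurable_path_coordinate]) auto
    finally show "{x \<in> space (path_space A). x k \<in> {g k}} \<in> sets (path_space A)" .
  qed simp
  define S where "S = {g \<in> PiE {1..N} A. \<exists>x\<in>PiE {1..} A. P x \<and> (\<forall>k\<in>{1..N}. x k = g k)}"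
  have "finite (PiE {1..N} A)" using fin by (intro finite_PiE) auto
  then have "finite S" unfolding S_def by (rule rev_finite_subset) blast
  moreover have "{x \<in> PiE {1..} A. P x} = (\<Union>g\<in>S. C g)"
  proof (intro equalityI subsetI)
    fix x assume x: "x \<in> {x \<in> PiE {1..} A. P x}"
    then have "restrict x {1..N} \<in> PiE {1..N} A" by (auto simp: PiE_iff)
    then have "restrict x {1..N} \<in> S" unfolding S_def using x by (intro CollectI conjI bexI[of _ x]) auto
    moreover have "x \<in> C (restrict x {1..N})" using x by (simp add: C_def space_path_space)
    ultimately show "x \<in> (\<Union>g\<in>S. C g)" by blast
  next
    fix x assume "x \<in> (\<Union>g\<in>S. C g)"
    then obtain g y where x: "x \<in> PiE {1..} A" "\<And>k. k \<in> {1..N} \<Longrightarrow> x k = g k"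
      and y: "y \<in> PiE {1..} A" "P y" "\<And>k. k \<in> {1..N} \<Longrightarrow> y k = g k"
      unfolding S_def C_def space_path_space by blast
    then have "P x = P y" by (intro dep) simp_all
    then show "x \<in> {x \<in> PiE {1..} A. P x}" using x y by simp
  qed
  ultimately show ?thesis using C by auto
qed

lemma measurable_into_path_space:
  assumes "\<And>n. 1 \<le> n \<Longrightarrow> X n \<in> measurable M (count_space (A n))"
  shows "(\<lambda>\<omega>. \<lambda>n\<in>{1..}. X n \<omega>) \<in> measurable M (path_space A)"
  unfolding path_space_def using assms by (intro measurable_restrict) auto

text \<open>Replacing the exceptional values of a process by fixed states makes its path map measurable.\<close>

definition patch :: "(nat \<Rightarrow> 'b set) \<Rightarrow> nat \<Rightarrow> 'b \<Rightarrow> 'b" where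
  "patch A n b = (if b \<in> A n then b else (SOME a. a \<in> A n))"

text \<open>The path map may leave the state spaces on a null set. Preimages of measurable sets
  under it are events all the same: they are the preimages under the patched path, cut down to the
  event that all states are admissible.\<close>

lemma process_law_eq_distr:
  assumes meas: "\<And>n. 1 \<le> n \<Longrightarrow> X n \<in> measurable M (count_space UNIV)"
    and ne: "\<And>n. 1 \<le> n \<Longrightarrow> A n \<noteq> {}"
    and Y: "Y \<in> measurable M (path_space A)"
    and eq: "AE \<omega> in M. \<forall>n\<ge>1. X n \<omega> = Y \<omega> n"
  shows "process_law M A X = distr M (path_space A) Y"
proof -
  let ?Z = "\<lambda>\<omega>. \<lambda>n\<in>{1..}. X n \<omega>" and ?W = "\<lambda>\<omega>. \<lambda>n\<in>{1..}. patch A n (X n \<omega>)"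
  have p: "patch A n \<in> measurable (count_space UNIV) (count_space (A n))" if "1 \<le> n" for n
    using some_in_eq[of "A n"] ne[OF that] by (auto simp: patch_def)
  have W: "?W \<in> measurable M (path_space A)"
    using measurable_compose[OF meas p] by (intro measurable_into_path_space) simp
  have "{\<omega> \<in> space M. \<forall>n. 1 \<le> n \<longrightarrow> X n \<omega> \<in> A n} \<in> sets M"
  proof (rule sets.sets_Collect_countable_All)
    fix n :: nat
    show "{\<omega> \<in> space M. 1 \<le> n \<longrightarrow> X n \<omega> \<in> A n} \<in> sets M"
    proof (cases "1 \<le> n")
      case True
      from measurable_sets[OF meas[OF this], of "A n"] True
      show ?thesis by (simp add: vimage_def Int_def conj_commute)
    qed simp
  qed
  then have good: "{\<omega> \<in> space M. \<forall>n\<in>{1..}. X n \<omega> \<in> A n} \<in> sets M" unfolding Ball_def atLeast_iff .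
  have "emeasure M (?Z -` B \<inter> space M) = emeasure M (Y -` B \<inter> space M)" if B: "B \<in> sets (path_space A)" for B
  proof (rule emeasure_eq_AE)
    have "?Z -` B \<inter> space M = {\<omega> \<in> space M. \<forall>n\<in>{1..}. X n \<omega> \<in> A n} \<inter> (?W -` B \<inter> space M)"
    proof -
      have "?Z \<omega> \<in> B \<longleftrightarrow> (\<forall>n\<in>{1..}. X n \<omega> \<in> A n) \<and> ?W \<omega> \<in> B" for \<omega>
      proof (cases "\<forall>n\<in>{1..}. X n \<omega> \<in> A n")
        case True
        then have "?W \<omega> = ?Z \<omega>" by (auto simp: patch_def restrict_def)
        then show ?thesis using True by simp
      next
        case False
        then obtain n where n: "n \<in> {1..}" "X n \<omega> \<notin> A n" by blast
        have "?Z \<omega> \<notin> PiE {1..} A"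
        proof
          assume "?Z \<omega> \<in> PiE {1..} A"
          from PiE_mem[OF this n(1)] show False using n by simp
        qed
        then show ?thesis using sets.sets_into_space[OF B] False unfolding space_path_space by blast
      qed
      then show ?thesis by blast
    qed
    also have "\<dots> \<in> sets M" using good measurable_sets[OF W B] by blast
    finally show "?Z -` B \<inter> space M \<in> sets M" .
    show "Y -` B \<inter> space M \<in> sets M" using measurable_sets[OF Y B] .
    show "AE \<omega> in M. \<omega> \<in> ?Z -` B \<inter> space M \<longleftrightarrow> \<omega> \<in> Y -` B \<inter> space M"
      using eq AE_space
    proof eventually_elim
      case (elim \<omega>)
      have "Y \<omega> \<in> PiE {1..} A" using measurable_space[OF Y elim(2)] by (simp add: space_path_space)
      then have "?Z \<omega> = Y \<omega>" using elim(1) by (auto simp: PiE_iff extensional_def restrict_def)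
      then show ?case by simp
    qed
  qed
  then have "measure_of (space (path_space A)) (sets (path_space A)) (\<lambda>B. emeasure M (?Z -` B \<inter> space M)) =
    measure_of (space (path_space A)) (sets (path_space A)) (\<lambda>B. emeasure M (Y -` B \<inter> space M))"
    by (intro measure_of_eq sets.space_closed) (simp add: sets.sigma_sets_eq)
  then show ?thesis unfolding process_law_def distr_def .
qed

lemma process_law_patch:
  assumes meas: "\<And>n. 1 \<le> n \<Longrightarrow> X n \<in> measurable M (count_space UNIV)"
    and ne: "\<And>n. 1 \<le> n \<Longrightarrow> A n \<noteq> {}"
    and AE: "\<And>n. 1 \<le> n \<Longrightarrow> AE \<omega> in M. X n \<omega> \<in> A n"
  obtains Y where "Y \<in> measurable M (path_space A)" "AE \<omega> in M. \<forall>n\<ge>1. X n \<omega> = Y \<omega> n"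
    "process_law M A X = distr M (path_space A) Y"
proof -
  let ?W = "\<lambda>\<omega>. \<lambda>n\<in>{1..}. patch A n (X n \<omega>)"
  have p: "patch A n \<in> measurable (count_space UNIV) (count_space (A n))" if "1 \<le> n" for n
    using some_in_eq[of "A n"] ne[OF that] by (auto simp: patch_def)
  have W: "?W \<in> measurable M (path_space A)"
    using measurable_compose[OF meas p] by (intro measurable_into_path_space) simp
  have "AE \<omega> in M. \<forall>n. 1 \<le> n \<longrightarrow> X n \<omega> \<in> A n" using AE unfolding AE_all_countable by (auto intro: AE_impI)
  then have eq: "AE \<omega> in M. \<forall>n\<ge>1. X n \<omega> = ?W \<omega> n" by eventually_elim (simp add: patch_def)
  show ?thesis using that[OF W eq process_law_eq_distr[OF meas ne W eq]] .
qed

lemma process_law_coordinates: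
  assumes "sets \<mu> = sets (path_space A)"
  shows "process_law \<mu> A (\<lambda>n x. x n) = \<mu>"
proof -
  have sp: "space \<mu> = PiE {1..} A" using sets_eq_imp_space_eq[OF assms] by (simp add: space_path_space)
  have "process_law \<mu> A (\<lambda>n x. x n) = distr \<mu> (path_space A) (\<lambda>x. x)"
    unfolding process_law_def by (rule distr_cong) (auto simp: sp)
  also have "\<dots> = \<mu>" using assms[symmetric] by (rule distr_id2)
  finally show ?thesis .
qed

lemma measurable_coordinate_UNIV:
  assumes "sets \<mu> = sets (path_space A)" "1 \<le> n"
  shows "(\<lambda>x. x n) \<in> measurable \<mu> (count_space UNIV)"
proof -
  have "(\<lambda>x. x n) \<in> measurable \<mu> (count_space (A n))"
    using measurable_path_coordinate[OF assms(2)] measurable_cong_sets[OF assms(1) refl] by blast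
  from measurable_compose[OF this, of "\<lambda>a. a" "count_space UNIV"] show ?thesis by simp
qed

lemma path_measure_eqI:
  assumes fin: "finite_measure \<mu>" and sets: "sets \<mu> = sets (path_space A)" "sets \<nu> = sets (path_space A)"
    and eq: "\<And>N B. emeasure \<mu> {x \<in> PiE {1..} A. \<forall>k\<in>{1..N}. x k \<in> B k} = emeasure \<nu> {x \<in> PiE {1..} A. \<forall>k\<in>{1..N}. x k \<in> B k}"
  shows "\<mu> = \<nu>"
proof (rule measure_eqI_PiM_infinite)
  show "sets \<mu> = sets (PiM {1..} (\<lambda>n. count_space (A n)))" "sets \<nu> = sets (PiM {1..} (\<lambda>n. count_space (A n)))"
    using sets by (simp_all add: path_space_def)
  show "finite_measure \<mu>" by (rule fin)
  fix F J assume J: "finite J" "J \<subseteq> {1..}" and F: "\<And>i. i \<in> J \<Longrightarrow> F i \<in> sets (count_space (A i))"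
  obtain N where N: "\<And>j. j \<in> J \<Longrightarrow> j \<le> N" using J(1) by (meson finite_nat_set_iff_bounded_le)
  define B where "B k = (if k \<in> J then F k else A k)" for k
  have "prod_emb {1..} (\<lambda>n. count_space (A n)) J (PiE J F) = {x \<in> PiE {1..} A. \<forall>k\<in>{1..N}. x k \<in> B k}"
  proof (intro equalityI subsetI)
    fix x assume x: "x \<in> prod_emb {1..} (\<lambda>n. count_space (A n)) J (PiE J F)"
    then have "x \<in> PiE {1..} A" "\<And>j. j \<in> J \<Longrightarrow> x j \<in> F j" by (auto simp: prod_emb_def PiE_iff)
    then show "x \<in> {x \<in> PiE {1..} A. \<forall>k\<in>{1..N}. x k \<in> B k}" by (auto simp: B_def PiE_iff)
  next
    fix x assume x: "x \<in> {x \<in> PiE {1..} A. \<forall>k\<in>{1..N}. x k \<in> B k}"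
    have "x j \<in> F j" if "j \<in> J" for j using x that J N[OF that] by (auto simp: B_def dest!: bspec[of _ _ j])
    then show "x \<in> prod_emb {1..} (\<lambda>n. count_space (A n)) J (PiE J F)" using x J by (auto simp: prod_emb_def PiE_iff)
  qed
  then show "emeasure \<mu> (prod_emb {1..} (\<lambda>n. count_space (A n)) J (PiE J F)) = emeasure \<nu> (prod_emb {1..} (\<lambda>n. count_space (A n)) J (PiE J F))"
    using eq by simp
qed

section \<open>The map from paths of systems and erasers to paths of hypergraphs\<close>

lemma finite_EIP_states: "finite (EIP_states n)"
  by (simp add: EIP_states_def finite_InSy)

lemma EIP_states_nonempty: "EIP_states n \<noteq> {}"
  using InSy_nonempty[of n] by (force simp: EIP_states_def)

lemma InHy_nonempty: "InHy n \<noteq> {}"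
  using permute_InHy[OF permutes_id InSy_nonempty[of n]] by blast

text \<open>The law map is the image measure under this map of paths. Each coordinate of the image
  depends on finitely many coordinates of the argument, whence measurability and continuity.\<close>

definition hypergraph_path :: "(nat \<Rightarrow> nat set set \<times> nat) \<Rightarrow> nat \<Rightarrow> nat set set" where
  "hypergraph_path x = (\<lambda>n\<in>{1..}. permute_hypergraph (perm_of (\<lambda>m. snd (x m)) n) (fst (x n)))"

lemma hypergraph_path_in: "x \<in> PiE {1..} EIP_states \<Longrightarrow> hypergraph_path x \<in> PiE {1..} InHy"
  unfolding hypergraph_path_def
  by (rule restrict_PiE_iff[THEN iffD2]) (use PiE_mem[of x "{1..}" EIP_states] in \<open>force intro: permute_InHy perm_of_permutes simp: EIP_states_def\<close>)

lemma hypergraph_path_cong: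
  assumes "\<And>k. 1 \<le> k \<Longrightarrow> k \<le> n \<Longrightarrow> x k = y k"
  shows "hypergraph_path x n = hypergraph_path y n"
proof (cases "1 \<le> n")
  case True
  have "perm_of (\<lambda>m. snd (x m)) n = perm_of (\<lambda>m. snd (y m)) n" using assms by (intro perm_of_cong) simp
  then show ?thesis using True assms[of n] by (simp add: hypergraph_path_def)
qed (simp add: hypergraph_path_def)

lemma measurable_hypergraph_path: "hypergraph_path \<in> measurable (path_space EIP_states) (path_space InHy)"
proof -
  have "(\<lambda>x. hypergraph_path x n) \<in> measurable (path_space EIP_states) (count_space (InHy n))" if n: "1 \<le> n" for n
  proof (rule measurable_count_space_eq2[OF finite_InHy, THEN iffD2], intro conjI ballI)
    show "(\<lambda>x. hypergraph_path x n) \<in> space (path_space EIP_states) \<rightarrow> InHy n"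
      using n hypergraph_path_in by (auto simp: space_path_space)
    fix G
    have "(\<lambda>x. hypergraph_path x n) -` {G} \<inter> space (path_space EIP_states) = {x \<in> PiE {1..} EIP_states. hypergraph_path x n = G}"
      by (auto simp: space_path_space)
    also have "\<dots> \<in> sets (path_space EIP_states)"
      by (rule sets_path_cylinder[OF finite_EIP_states, where N = n]) (metis hypergraph_path_cong)
    finally show "(\<lambda>x. hypergraph_path x n) -` {G} \<inter> space (path_space EIP_states) \<in> sets (path_space EIP_states)" .
  qed
  then have "(\<lambda>x. \<lambda>n\<in>{1..}. hypergraph_path x n) \<in> measurable (path_space EIP_states) (path_space InHy)"
    by (rule measurable_into_path_space)
  moreover have "(\<lambda>x. \<lambda>n\<in>{1..}. hypergraph_path x n) = hypergraph_path"
    by (auto simp: hypergraph_path_def fun_eq_iff)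
  ultimately show ?thesis by simp
qed

lemma hypergraph_law_eq: "hypergraph_law \<mu> = distr \<mu> (path_space InHy) hypergraph_path"
  unfolding hypergraph_law_def process_law_def hypergraph_process_def hypergraph_path_def ..

lemma continuous_map_hypergraph_path:
  "continuous_map (path_topology EIP_states) (path_topology InHy) hypergraph_path"
  unfolding path_topology_def[of InHy] continuous_map_componentwise topspace_path_topology
proof (intro conjI ballI)
  show "hypergraph_path ` PiE {1..} EIP_states \<subseteq> extensional {1..}"
    by (auto simp: hypergraph_path_def)
  fix n :: nat assume n: "n \<in> {1..}"
  show "continuous_map (path_topology EIP_states) (discrete_topology (InHy n)) (\<lambda>x. hypergraph_path x n)"
    unfolding continuous_map_def topspace_path_topology topspace_discrete_topology
  proof (intro conjI allI impI)
    show "(\<lambda>x. hypergraph_path x n) \<in> PiE {1..} EIP_states \<rightarrow> InHy n"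
      using n hypergraph_path_in by auto
    fix B assume "openin (discrete_topology (InHy n)) B"
    show "openin (path_topology EIP_states) {x \<in> PiE {1..} EIP_states. hypergraph_path x n \<in> B}"
      unfolding path_topology_def openin_product_topology_alt
    proof (intro conjI ballI)
      fix x assume x: "x \<in> {x \<in> PiE {1..} EIP_states. hypergraph_path x n \<in> B}"
      \<comment> \<open>Fixing the first \<open>n\<close> coordinates gives a basic open set on
        which the hypergraph at level \<open>n\<close> is constant.\<close>
      define V where "V k = (if k \<le> n then {x k} else EIP_states k)" for k
      have "finite {i \<in> {1..}. V i \<noteq> EIP_states i}"
        by (rule finite_subset[of _ "{..n}"]) (auto simp: V_def)
      moreover have "\<forall>i\<in>{1..}. V i \<subseteq> EIP_states i" using x by (auto simp: V_def PiE_iff)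
      moreover have "x \<in> PiE {1..} V" using x by (auto simp: V_def PiE_iff)
      moreover have "PiE {1..} V \<subseteq> {x \<in> PiE {1..} EIP_states. hypergraph_path x n \<in> B}"
      proof
        fix y assume y: "y \<in> PiE {1..} V"
        have "y k = x k" if "1 \<le> k" "k \<le> n" for k using PiE_mem[OF y, of k] that by (simp add: V_def)
        then have "hypergraph_path y n = hypergraph_path x n" by (rule hypergraph_path_cong)
        moreover have "y \<in> PiE {1..} EIP_states"
          using y \<open>\<forall>i\<in>{1..}. V i \<subseteq> EIP_states i\<close> by (auto simp: PiE_iff)
        ultimately show "y \<in> {x \<in> PiE {1..} EIP_states. hypergraph_path x n \<in> B}" using x by simp
      qed
      ultimately show "\<exists>U. finite {i \<in> {1..}. U i \<noteq> topspace (discrete_topology (EIP_states i))} \<and>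
        (\<forall>i\<in>{1..}. openin (discrete_topology (EIP_states i)) (U i)) \<and>
        x \<in> PiE {1..} U \<and> PiE {1..} U \<subseteq> {x \<in> PiE {1..} EIP_states. hypergraph_path x n \<in> B}"
        by (intro exI[of _ V]) simp
    qed
  qed
qed

lemma borel_measurable_path_continuous:
  assumes fin: "\<And>n. finite (A n)" and f: "continuous_map (path_topology A) euclideanreal f"
  shows "f \<in> borel_measurable (path_space A)"
proof (rule borel_measurableI)
  fix S :: "real set" assume "open S"
  then have "openin (path_topology A) {x \<in> topspace (path_topology A). f x \<in> S}"
    using f by (intro openin_continuous_map_preimage[OF f]) auto
  then have "{x \<in> topspace (path_topology A). f x \<in> S} \<in> sets (path_space A)"
    unfolding sets_path_space_borel[OF fin] by (intro sigma_sets.Basic) simp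
  moreover have "{x \<in> topspace (path_topology A). f x \<in> S} = f -` S \<inter> space (path_space A)"
    by (auto simp: topspace_path_topology space_path_space)
  ultimately show "f -` S \<inter> space (path_space A) \<in> sets (path_space A)" by simp
qed

text \<open>\<open>measure_of\<close> returns the intended set function only if this function is
  countably additive on the sigma-algebra, which has to be checked.\<close>

lemma mixture_props:
  assumes sets: "sets \<nu> = sets \<mu>"
  shows "sets (mixture t \<mu> \<nu>) = sets \<mu>" "space (mixture t \<mu> \<nu>) = space \<mu>"
    "B \<in> sets \<mu> \<Longrightarrow> emeasure (mixture t \<mu> \<nu>) B = ennreal t * emeasure \<mu> B + ennreal (1 - t) * emeasure \<nu> B"
proof -
  show "sets (mixture t \<mu> \<nu>) = sets \<mu>" "space (mixture t \<mu> \<nu>) = space \<mu>"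
    unfolding mixture_def using sets.space_closed[of \<mu>] by (simp_all add: sets.sigma_sets_eq)
  show "emeasure (mixture t \<mu> \<nu>) B = ennreal t * emeasure \<mu> B + ennreal (1 - t) * emeasure \<nu> B" if B: "B \<in> sets \<mu>"
    unfolding mixture_def
  proof (rule emeasure_measure_of[OF refl])
    show "sets \<mu> \<subseteq> Pow (space \<mu>)" by (rule sets.space_closed)
    show "B \<in> Sigma_Algebra.sets (measure_of (space \<mu>) (sets \<mu>) (\<lambda>B. ennreal t * emeasure \<mu> B + ennreal (1 - t) * emeasure \<nu> B))"
      using B sets.space_closed[of \<mu>] by (simp add: sets.sigma_sets_eq)
    show "positive (Sigma_Algebra.sets (measure_of (space \<mu>) (sets \<mu>) (\<lambda>B. ennreal t * emeasure \<mu> B + ennreal (1 - t) * emeasure \<nu> B)))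
      (\<lambda>B. ennreal t * emeasure \<mu> B + ennreal (1 - t) * emeasure \<nu> B)"
      by (simp add: positive_def)
    show "countably_additive (Sigma_Algebra.sets (measure_of (space \<mu>) (sets \<mu>) (\<lambda>B. ennreal t * emeasure \<mu> B + ennreal (1 - t) * emeasure \<nu> B)))
      (\<lambda>B. ennreal t * emeasure \<mu> B + ennreal (1 - t) * emeasure \<nu> B)"
    proof (rule countably_additiveI)
      fix F :: "nat \<Rightarrow> _" assume F: "range F \<subseteq> Sigma_Algebra.sets (measure_of (space \<mu>) (sets \<mu>) (\<lambda>B. ennreal t * emeasure \<mu> B + ennreal (1 - t) * emeasure \<nu> B))"
        and d: "disjoint_family F"
      have F': "range F \<subseteq> sets \<mu>" "range F \<subseteq> sets \<nu>" using F sets sets.space_closed[of \<mu>] by (simp_all add: sets.sigma_sets_eq)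
      have "(\<Sum>i. ennreal t * emeasure \<mu> (F i) + ennreal (1 - t) * emeasure \<nu> (F i)) =
        ennreal t * (\<Sum>i. emeasure \<mu> (F i)) + ennreal (1 - t) * (\<Sum>i. emeasure \<nu> (F i))"
        by (simp add: suminf_add[symmetric] ennreal_suminf_cmult)
      then show "(\<Sum>i. ennreal t * emeasure \<mu> (F i) + ennreal (1 - t) * emeasure \<nu> (F i)) =
        ennreal t * emeasure \<mu> (\<Union>i. F i) + ennreal (1 - t) * emeasure \<nu> (\<Union>i. F i)"
        using suminf_emeasure[OF F'(1) d] suminf_emeasure[OF F'(2) d] by simp
    qed
  qed
qed

lemma distr_mixture:
  assumes sets: "sets \<nu> = sets \<mu>" and f: "f \<in> measurable \<mu> N"
  shows "distr (mixture t \<mu> \<nu>) N f = mixture t (distr \<mu> N f) (distr \<nu> N f)"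
proof (rule measure_eqI)
  note mix = mixture_props[OF sets, where t = t]
  have f': "f \<in> measurable (mixture t \<mu> \<nu>) N" "f \<in> measurable \<nu> N"
    using f measurable_cong_sets[OF mix(1) refl] measurable_cong_sets[OF sets refl] by blast+
  have mix': "sets (distr \<nu> N f) = sets (distr \<mu> N f)" by simp
  show "sets (distr (mixture t \<mu> \<nu>) N f) = sets (mixture t (distr \<mu> N f) (distr \<nu> N f))"
    using mixture_props(1)[OF mix'] by simp
  fix B assume "B \<in> sets (distr (mixture t \<mu> \<nu>) N f)"
  then have B: "B \<in> sets N" by simp
  have sp: "space \<nu> = space \<mu>" using sets_eq_imp_space_eq[OF sets] .
  have "emeasure (distr (mixture t \<mu> \<nu>) N f) B = emeasure (mixture t \<mu> \<nu>) (f -` B \<inter> space \<mu>)"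
    using emeasure_distr[OF f'(1) B] mix(2) by simp
  also have "\<dots> = ennreal t * emeasure \<mu> (f -` B \<inter> space \<mu>) + ennreal (1 - t) * emeasure \<nu> (f -` B \<inter> space \<mu>)"
    using measurable_sets[OF f B] by (rule mix(3))
  also have "\<dots> = ennreal t * emeasure (distr \<mu> N f) B + ennreal (1 - t) * emeasure (distr \<nu> N f) B"
    using emeasure_distr[OF f B] emeasure_distr[OF f'(2) B] sp by simp
  also have "\<dots> = emeasure (mixture t (distr \<mu> N f) (distr \<nu> N f)) B"
    using B by (intro mixture_props(3)[OF mix', symmetric]) simp
  finally show "emeasure (distr (mixture t \<mu> \<nu>) N f) B = emeasure (mixture t (distr \<mu> N f) (distr \<nu> N f)) B" .
qed


lemma AE_distr_path:
  assumes fin: "\<And>n. finite (A n)" and Y: "Y \<in> measurable M (path_space A)"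
    and dep: "\<And>x y. x \<in> PiE {1..} A \<Longrightarrow> y \<in> PiE {1..} A \<Longrightarrow> (\<And>k. 1 \<le> k \<Longrightarrow> k \<le> N \<Longrightarrow> x k = y k) \<Longrightarrow> P x = P y"
    and AE: "AE \<omega> in M. P (Y \<omega>)"
  shows "AE x in distr M (path_space A) Y. P x"
proof (subst AE_distr_iff[OF Y])
  show "{x \<in> space (path_space A). P x} \<in> sets (path_space A)"
    unfolding space_path_space by (rule sets_path_cylinder[OF fin dep])
qed (rule AE)

section \<open>Laws of erased-interval processes and of their hypergraphs\<close>

context eip begin

lemma measurable_hypergraph_process: "1 \<le> n \<Longrightarrow> hypergraph_process I \<eta> n \<in> measurable M (count_space UNIV)"
proof (rule measurableI)
  fix B assume n: "1 \<le> n"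
  have "hypergraph_process I \<eta> n -` B \<inter> space M = {\<omega> \<in> space M. permute_hypergraph (perm_of (ers \<omega>) n) (I n \<omega>) \<in> B}"
    by (auto simp: hypergraph_process_def)
  also have "\<dots> \<in> events" by (rule event_perm_I[OF n, of "\<lambda>p J. permute_hypergraph p J \<in> B"])
  finally show "hypergraph_process I \<eta> n -` B \<inter> space M \<in> events" .
qed simp

lemma hypergraph_process_eq_H:
  assumes "erased_path (\<lambda>n. I n \<omega>) (ers \<omega>)"
  shows "hypergraph_process I \<eta> n \<omega> = erased_path.H (\<lambda>n. I n \<omega>) (ers \<omega>) n"
  by (simp add: hypergraph_process_def erased_path.H_def[OF assms])

text \<open>Composition with \<open>p\<close> is a bijection of the permutations of
  \<open>{1..n}\<close>, so the counts in \<open>prob_perm_I\<close> agree.\<close>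

lemma prob_permute_hypergraph_process:
  assumes n: "1 \<le> n" and p: "p permutes {1..n}"
  shows "prob {\<omega> \<in> space M. permute_hypergraph p (hypergraph_process I \<eta> n \<omega>) \<in> B} =
    prob {\<omega> \<in> space M. hypergraph_process I \<eta> n \<omega> \<in> B}"
proof -
  have "card {q. q permutes {1..n} \<and> permute_hypergraph p (permute_hypergraph q J) \<in> B} =
      card {q. q permutes {1..n} \<and> permute_hypergraph q J \<in> B}" for J
  proof (rule bij_betw_same_card[of "\<lambda>q. p \<circ> q"], rule bij_betwI[where g = "\<lambda>q. inv p \<circ> q"])
    show "(\<lambda>q. p \<circ> q) \<in> {q. q permutes {1..n} \<and> permute_hypergraph p (permute_hypergraph q J) \<in> B} \<rightarrow>
        {q. q permutes {1..n} \<and> permute_hypergraph q J \<in> B}"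
      using p by (auto simp: permute_hypergraph_comp intro: permutes_compose)
    have pq: "p \<circ> (inv p \<circ> q) = q" for q using permutes_inverses(1)[OF p] by (simp add: fun_eq_iff)
    show "(\<lambda>q. inv p \<circ> q) \<in> {q. q permutes {1..n} \<and> permute_hypergraph q J \<in> B} \<rightarrow>
        {q. q permutes {1..n} \<and> permute_hypergraph p (permute_hypergraph q J) \<in> B}"
      using permutes_inv[OF p] by (auto simp: permute_hypergraph_comp pq intro: permutes_compose)
  qed (use permutes_inverses[OF p] in \<open>auto simp: fun_eq_iff\<close>)
  then show ?thesis
    using prob_perm_I[OF n, of "\<lambda>q J. permute_hypergraph p (permute_hypergraph q J) \<in> B"]
      prob_perm_I[OF n, of "\<lambda>q J. permute_hypergraph q J \<in> B"]
    unfolding hypergraph_process_def by simp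
qed

lemma exchangeable_hypergraph_process: "exchangeable_interval_hypergraph M (hypergraph_process I \<eta>)"
  unfolding exchangeable_interval_hypergraph_def
proof (intro conjI allI impI)
  show "prob_space M" by (rule prob_space_axioms)
next
  fix n :: nat assume n: "1 \<le> n"
  show "hypergraph_process I \<eta> n \<in> measurable M (count_space UNIV)" by (rule measurable_hypergraph_process[OF n])
  show "AE \<omega> in M. hypergraph_process I \<eta> n \<omega> \<in> InHy n"
    using AE_path
  proof eventually_elim
    case (elim \<omega>) show ?case unfolding hypergraph_process_eq_H[OF elim] by (rule erased_path.H_InHy[OF elim n])
  qed
  show "AE \<omega> in M. hypergraph_process I \<eta> n \<omega> = restrict_hypergraph (hypergraph_process I \<eta> (n + 1) \<omega>) n"
    using AE_path
  proof eventually_elim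
    case (elim \<omega>)
    show ?case unfolding hypergraph_process_eq_H[OF elim]
      using erased_path.H_restrict_Suc[OF elim n] by (simp only: Suc_eq_plus1)
  qed
  fix p assume p: "p permutes {1..n}"
  have m: "(\<lambda>\<omega>. permute_hypergraph p (hypergraph_process I \<eta> n \<omega>)) \<in> measurable M (count_space UNIV)"
    using measurable_compose[OF measurable_hypergraph_process[OF n], of "permute_hypergraph p" "count_space UNIV"] by simp
  show "distr M (count_space UNIV) (\<lambda>\<omega>. permute_hypergraph p (hypergraph_process I \<eta> n \<omega>)) =
        distr M (count_space UNIV) (hypergraph_process I \<eta> n)"
  proof (rule measure_eqI)
    fix B
    have "emeasure (distr M (count_space UNIV) (\<lambda>\<omega>. permute_hypergraph p (hypergraph_process I \<eta> n \<omega>))) B =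
        prob {\<omega> \<in> space M. permute_hypergraph p (hypergraph_process I \<eta> n \<omega>) \<in> B}"
      by (subst emeasure_distr[OF m]) (auto simp: emeasure_eq_measure vimage_def Int_def conj_commute)
    also have "\<dots> = prob {\<omega> \<in> space M. hypergraph_process I \<eta> n \<omega> \<in> B}"
      by (simp only: prob_permute_hypergraph_process[OF n p])
    also have "\<dots> = emeasure (distr M (count_space UNIV) (hypergraph_process I \<eta> n)) B"
      by (subst emeasure_distr[OF measurable_hypergraph_process[OF n]]) (auto simp: emeasure_eq_measure vimage_def Int_def conj_commute)
    finally show "emeasure (distr M (count_space UNIV) (\<lambda>\<omega>. permute_hypergraph p (hypergraph_process I \<eta> n \<omega>))) B =
      emeasure (distr M (count_space UNIV) (hypergraph_process I \<eta> n)) B" .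
  qed simp
qed

lemma path_map:
  obtains Y where "Y \<in> measurable M (path_space EIP_states)" "AE \<omega> in M. \<forall>n\<ge>1. (I n \<omega>, \<eta> n \<omega>) = Y \<omega> n"
    "process_law M EIP_states (pair_process I \<eta>) = distr M (path_space EIP_states) Y"
proof (rule process_law_patch[of "pair_process I \<eta>" M EIP_states])
  show "1 \<le> n \<Longrightarrow> AE \<omega> in M. pair_process I \<eta> n \<omega> \<in> EIP_states n" for n
    using eip unfolding erased_interval_process_def by blast
qed (auto simp: measurable_pair EIP_states_nonempty simp del: One_nat_def)

text \<open>\<open>ErInPr\<close> refers to sample spaces of path type, whereas \<open>M\<close> is
  arbitrary; so the process is moved to path space. The locale \<open>eraser_law\<close> is
  convenient here, since its conditions involve finitely many coordinates at a time.\<close>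

lemma eip_process_law:
  "erased_interval_process (process_law M EIP_states (pair_process I \<eta>)) (\<lambda>n x. fst (x n)) (\<lambda>n x. snd (x n))"
proof -
  obtain Y where Y: "Y \<in> measurable M (path_space EIP_states)" and YX: "AE \<omega> in M. \<forall>n\<ge>1. (I n \<omega>, \<eta> n \<omega>) = Y \<omega> n"
    and eq: "process_law M EIP_states (pair_process I \<eta>) = distr M (path_space EIP_states) Y"
    by (rule path_map)
  interpret D: prob_space "distr M (path_space EIP_states) Y" by (rule prob_space_distr[OF Y])
  have sets: "sets (distr M (path_space EIP_states) Y) = sets (path_space EIP_states)" by simp
  have prob_D: "measure (distr M (path_space EIP_states) Y) {x \<in> PiE {1..} EIP_states. P x} = prob {\<omega> \<in> space M. P (Y \<omega>)}"
    if "\<And>x y. (\<And>k. 1 \<le> k \<Longrightarrow> k \<le> N \<Longrightarrow> x k = y k) \<Longrightarrow> P x = P y" for P N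
  proof -
    have "{x \<in> PiE {1..} EIP_states. P x} \<in> sets (path_space EIP_states)"
      by (rule sets_path_cylinder[OF finite_EIP_states that])
    then have "measure (distr M (path_space EIP_states) Y) {x \<in> PiE {1..} EIP_states. P x} = prob (Y -` {x \<in> PiE {1..} EIP_states. P x} \<inter> space M)"
      by (rule measure_distr[OF Y])
    also have "Y -` {x \<in> PiE {1..} EIP_states. P x} \<inter> space M = {\<omega> \<in> space M. P (Y \<omega>)}"
      using measurable_space[OF Y] by (auto simp: space_path_space)
    finally show ?thesis .
  qed
  have "eraser_law (distr M (path_space EIP_states) Y) (\<lambda>n x. fst (x n)) (\<lambda>n x. snd (x n))"
  proof
    fix n :: nat assume n: "1 \<le> n"
    show "pair_process (\<lambda>n x. fst (x n)) (\<lambda>n x. snd (x n)) n \<in> measurable (distr M (path_space EIP_states) Y) (count_space UNIV)"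
      using measurable_coordinate_UNIV[OF sets n] by simp
  next
    have "AE x in distr M (path_space EIP_states) Y. 1 \<le> n \<longrightarrow> fst (x n) = erase_system (fst (x (Suc n))) (snd (x n))" for n
    proof (rule AE_distr_path[OF finite_EIP_states Y, of "Suc n"])
      fix x y :: "nat \<Rightarrow> nat set set \<times> nat" assume xy: "\<And>k. 1 \<le> k \<Longrightarrow> k \<le> Suc n \<Longrightarrow> x k = y k"
      show "(1 \<le> n \<longrightarrow> fst (x n) = erase_system (fst (x (Suc n))) (snd (x n))) =
        (1 \<le> n \<longrightarrow> fst (y n) = erase_system (fst (y (Suc n))) (snd (y n)))"
        using xy[of n] xy[of "Suc n"] by (cases "1 \<le> n") simp_all
    next
      show "AE \<omega> in M. 1 \<le> n \<longrightarrow> fst (Y \<omega> n) = erase_system (fst (Y \<omega> (Suc n))) (snd (Y \<omega> n))"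
        using YX AE_path
      proof eventually_elim
        case (elim \<omega>)
        show ?case
        proof
          assume n: "1 \<le> n"
          then have "1 \<le> Suc n" by simp
          then have "(I n \<omega>, \<eta> n \<omega>) = Y \<omega> n" "(I (Suc n) \<omega>, \<eta> (Suc n) \<omega>) = Y \<omega> (Suc n)" using elim(1) n by blast+
          then show "fst (Y \<omega> n) = erase_system (fst (Y \<omega> (Suc n))) (snd (Y \<omega> n))"
            using erased_path.J_erase[OF elim(2) n] by (metis fst_conv snd_conv)
        qed
      qed
    qed
    then have "AE x in distr M (path_space EIP_states) Y. \<forall>n. 1 \<le> n \<longrightarrow> fst (x n) = erase_system (fst (x (Suc n))) (snd (x n))"
      unfolding AE_all_countable by blast
    then show "AE x in distr M (path_space EIP_states) Y. erased_path (\<lambda>n. fst (x n)) (\<lambda>m. snd (x m))"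
      using AE_space
    proof eventually_elim
      case (elim x)
      have st: "x n \<in> EIP_states n" if "1 \<le> n" for n using elim(2) that by (auto simp: space_path_space dest: PiE_mem[where x = n])
      show ?case
      proof
        fix n :: nat assume n: "1 \<le> n"
        show "fst (x n) \<in> InSy n" "snd (x n) \<in> {1..Suc n}" using st[OF n] by (auto simp: EIP_states_def mem_Times_iff)
        show "fst (x n) = erase_system (fst (x (Suc n))) (snd (x n))" using elim(1) n by blast
      qed
    qed
  next
    fix n :: nat and e J assume n: "1 \<le> n" and e: "e \<in> erasers n"
    let ?D = "distr M (path_space EIP_states) Y"
    have sp: "space ?D = PiE {1..} EIP_states" by (simp add: space_path_space)
    have 1: "{x \<in> space ?D. \<forall>k\<in>{1..<n}. snd (x k) = e k} \<inter> {x \<in> space ?D. fst (x n) = J} =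
      {x \<in> PiE {1..} EIP_states. (\<forall>k\<in>{1..<n}. snd (x k) = e k) \<and> fst (x n) = J}" unfolding sp by blast
    have 2: "{x \<in> space ?D. fst (x n) = J} = {x \<in> PiE {1..} EIP_states. fst (x n) = J}" unfolding sp by blast
    have "measure ?D {x \<in> PiE {1..} EIP_states. (\<forall>k\<in>{1..<n}. snd (x k) = e k) \<and> fst (x n) = J} =
       prob {\<omega> \<in> space M. (\<forall>k\<in>{1..<n}. snd (Y \<omega> k) = e k) \<and> fst (Y \<omega> n) = J}"
      by (rule prob_D[of n]) (use n in simp)
    also have "\<dots> = prob ({\<omega> \<in> space M. \<forall>k\<in>{1..<n}. \<eta> k \<omega> = e k} \<inter> {\<omega> \<in> space M. I n \<omega> = J})"
    proof (rule finite_measure_eq_AE)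
      have "Y -` {x \<in> PiE {1..} EIP_states. (\<forall>k\<in>{1..<n}. snd (x k) = e k) \<and> fst (x n) = J} \<inter> space M \<in> events"
        by (intro measurable_sets[OF Y] sets_path_cylinder[OF finite_EIP_states, where N = n]) (use n in simp)
      also have "Y -` {x \<in> PiE {1..} EIP_states. (\<forall>k\<in>{1..<n}. snd (x k) = e k) \<and> fst (x n) = J} \<inter> space M =
        {\<omega> \<in> space M. (\<forall>k\<in>{1..<n}. snd (Y \<omega> k) = e k) \<and> fst (Y \<omega> n) = J}"
        using measurable_space[OF Y] by (auto simp: space_path_space)
      finally show "{\<omega> \<in> space M. (\<forall>k\<in>{1..<n}. snd (Y \<omega> k) = e k) \<and> fst (Y \<omega> n) = J} \<in> events" .
      show "{\<omega> \<in> space M. \<forall>k\<in>{1..<n}. \<eta> k \<omega> = e k} \<inter> {\<omega> \<in> space M. I n \<omega> = J} \<in> events"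
        by (intro sets.Int event_prefix[OF n] event_I[OF n])
      show "AE \<omega> in M. \<omega> \<in> {\<omega> \<in> space M. (\<forall>k\<in>{1..<n}. snd (Y \<omega> k) = e k) \<and> fst (Y \<omega> n) = J} \<longleftrightarrow>
          \<omega> \<in> {\<omega> \<in> space M. \<forall>k\<in>{1..<n}. \<eta> k \<omega> = e k} \<inter> {\<omega> \<in> space M. I n \<omega> = J}"
        using YX
      proof eventually_elim
        case (elim \<omega>)
        have "snd (Y \<omega> k) = \<eta> k \<omega>" "fst (Y \<omega> k) = I k \<omega>" if "1 \<le> k" for k using elim that by (metis fst_conv snd_conv)+
        then show ?case using n by auto
      qed
    qed
    also have "\<dots> = prob {\<omega> \<in> space M. I n \<omega> = J} / fact n" by (rule prob_prefix_eq[OF n e])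
    also have "prob {\<omega> \<in> space M. I n \<omega> = J} = prob {\<omega> \<in> space M. fst (Y \<omega> n) = J}"
    proof (rule finite_measure_eq_AE)
      have "Y -` {x \<in> PiE {1..} EIP_states. fst (x n) = J} \<inter> space M \<in> events"
        by (intro measurable_sets[OF Y] sets_path_cylinder[OF finite_EIP_states, where N = n]) (use n in simp)
      also have "Y -` {x \<in> PiE {1..} EIP_states. fst (x n) = J} \<inter> space M = {\<omega> \<in> space M. fst (Y \<omega> n) = J}"
        using measurable_space[OF Y] by (auto simp: space_path_space)
      finally show "{\<omega> \<in> space M. fst (Y \<omega> n) = J} \<in> events" .
      show "{\<omega> \<in> space M. I n \<omega> = J} \<in> events" by (rule event_I[OF n])
      show "AE \<omega> in M. \<omega> \<in> {\<omega> \<in> space M. I n \<omega> = J} \<longleftrightarrow> \<omega> \<in> {\<omega> \<in> space M. fst (Y \<omega> n) = J}"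
        using YX by eventually_elim (use n in \<open>metis (mono_tags, lifting) fst_conv mem_Collect_eq\<close>)
    qed
    also have "\<dots> = measure ?D {x \<in> PiE {1..} EIP_states. fst (x n) = J}"
      by (rule prob_D[of n, symmetric]) (use n in simp)
    finally show "measure ?D ({x \<in> space ?D. \<forall>k\<in>{1..<n}. snd (x k) = e k} \<inter> {x \<in> space ?D. fst (x n) = J}) =
      measure ?D {x \<in> space ?D. fst (x n) = J} / fact n" unfolding 1 unfolding 2 .
  qed
  then show ?thesis unfolding eq by (rule eraser_law.erased_interval_process)
qed

lemma process_law_in_ErInPr: "process_law M EIP_states (pair_process I \<eta>) \<in> ErInPr"
proof -
  let ?\<mu> = "process_law M EIP_states (pair_process I \<eta>)"
  have "process_law ?\<mu> EIP_states (\<lambda>n x. x n) = ?\<mu>"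
    by (rule process_law_coordinates) (simp add: process_law_def)
  then have "?\<mu> = process_law ?\<mu> EIP_states (pair_process (\<lambda>n x. fst (x n)) (\<lambda>n x. snd (x n)))" by simp
  then show ?thesis unfolding ErInPr_def mem_Collect_eq
    by (intro exI[of _ ?\<mu>] exI[of _ "\<lambda>n x. fst (x n)"] exI[of _ "\<lambda>n x. snd (x n)"] conjI eip_process_law)
qed

text \<open>Both sides are the image of \<open>M\<close> under
  \<open>hypergraph_path \<circ> Y\<close>, where \<open>Y\<close> is a measurable version of the
  path.\<close>

lemma hypergraph_law_process_law:
  "hypergraph_law (process_law M EIP_states (pair_process I \<eta>)) = process_law M InHy (hypergraph_process I \<eta>)"
proof -
  obtain Y where Y: "Y \<in> measurable M (path_space EIP_states)" and YX: "AE \<omega> in M. \<forall>n\<ge>1. (I n \<omega>, \<eta> n \<omega>) = Y \<omega> n"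
    and eq: "process_law M EIP_states (pair_process I \<eta>) = distr M (path_space EIP_states) Y"
    by (rule path_map)
  have "hypergraph_law (process_law M EIP_states (pair_process I \<eta>)) = distr M (path_space InHy) (hypergraph_path \<circ> Y)"
    unfolding hypergraph_law_eq eq by (rule distr_distr[OF measurable_hypergraph_path Y])
  also have "\<dots> = process_law M InHy (hypergraph_process I \<eta>)"
  proof (rule process_law_eq_distr[symmetric])
    show "hypergraph_path \<circ> Y \<in> measurable M (path_space InHy)" using Y measurable_hypergraph_path by (rule measurable_comp)
    show "AE \<omega> in M. \<forall>n\<ge>1. hypergraph_process I \<eta> n \<omega> = (hypergraph_path \<circ> Y) \<omega> n"
      using YX
    proof eventually_elim
      case (elim \<omega>)
      show ?case
      proof (intro allI impI)
        fix n :: nat assume n: "1 \<le> n"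
        have "hypergraph_path (Y \<omega>) n = hypergraph_path (\<lambda>k. (I k \<omega>, \<eta> k \<omega>)) n"
          by (rule hypergraph_path_cong) (use elim in simp)
        then show "hypergraph_process I \<eta> n \<omega> = (hypergraph_path \<circ> Y) \<omega> n"
          using n by (simp add: hypergraph_path_def hypergraph_process_def)
      qed
    qed
  qed (auto simp: measurable_hypergraph_process InHy_nonempty simp del: One_nat_def)
  finally show ?thesis .
qed

end

text \<open>As for erased-interval processes, the coordinate process under the law takes over the
  role of \<open>H\<close>, with path space as sample space.\<close>

lemma process_law_in_ExInHy:
  assumes "exchangeable_interval_hypergraph M H"
  shows "process_law M InHy H \<in> ExInHy"
proof -
  interpret prob_space M using assms by (simp add: exchangeable_interval_hypergraph_def)
  have H: "1 \<le> n \<Longrightarrow> H n \<in> measurable M (count_space UNIV)"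
    "1 \<le> n \<Longrightarrow> AE \<omega> in M. H n \<omega> \<in> InHy n"
    "1 \<le> n \<Longrightarrow> AE \<omega> in M. H n \<omega> = restrict_hypergraph (H (n + 1) \<omega>) n"
    "1 \<le> n \<Longrightarrow> p permutes {1..n} \<Longrightarrow> distr M (count_space UNIV) (\<lambda>\<omega>. permute_hypergraph p (H n \<omega>)) =
        distr M (count_space UNIV) (H n)" for n p
    using assms unfolding exchangeable_interval_hypergraph_def by blast+
  obtain Y where Y: "Y \<in> measurable M (path_space InHy)" and YX: "AE \<omega> in M. \<forall>n\<ge>1. H n \<omega> = Y \<omega> n"
    and eq: "process_law M InHy H = distr M (path_space InHy) Y"
    by (rule process_law_patch[of H M InHy, OF H(1) InHy_nonempty H(2)])
  let ?\<nu> = "distr M (path_space InHy) Y"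
  have sets: "sets ?\<nu> = sets (path_space InHy)" by simp
  have "exchangeable_interval_hypergraph ?\<nu> (\<lambda>n x. x n)"
    unfolding exchangeable_interval_hypergraph_def
  proof (intro conjI allI impI)
    show "prob_space ?\<nu>" by (rule prob_space_distr[OF Y])
  next
    fix n :: nat assume n: "1 \<le> n"
    show "(\<lambda>x. x n) \<in> measurable ?\<nu> (count_space UNIV)" by (rule measurable_coordinate_UNIV[OF sets n])
    show "AE x in ?\<nu>. x n \<in> InHy n"
      by (rule AE_I2) (use n in \<open>auto simp: space_path_space dest: PiE_mem[where x = n]\<close>)
    show "AE x in ?\<nu>. x n = restrict_hypergraph (x (n + 1)) n"
    proof (rule AE_distr_path[OF finite_InHy Y, of "n + 1"])
      fix x y :: "nat \<Rightarrow> nat set set" assume "\<And>k. 1 \<le> k \<Longrightarrow> k \<le> n + 1 \<Longrightarrow> x k = y k"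
      from this[of n] this[of "n+1"] show "(x n = restrict_hypergraph (x (n + 1)) n) = (y n = restrict_hypergraph (y (n + 1)) n)"
        using n by simp
    next
      have "1 \<le> n + 1" by simp
      show "AE \<omega> in M. Y \<omega> n = restrict_hypergraph (Y \<omega> (n + 1)) n"
        using YX H(3)[OF n] by eventually_elim (use n \<open>1 \<le> n + 1\<close> in metis)
    qed
    fix p assume p: "p permutes {1..n}"
    have m: "(\<lambda>x. x n) \<in> measurable (path_space InHy) (count_space UNIV)" by (rule measurable_coordinate_UNIV[OF refl n])
    have m': "(\<lambda>x. permute_hypergraph p (x n)) \<in> measurable (path_space InHy) (count_space UNIV)"
      using measurable_compose[OF m, of "permute_hypergraph p" "count_space UNIV"] by simp
    have YH: "AE \<omega> in M. Y \<omega> n = H n \<omega>" using YX by eventually_elim (use n in simp)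
    have "distr ?\<nu> (count_space UNIV) (\<lambda>x. permute_hypergraph p (x n)) = distr M (count_space UNIV) ((\<lambda>x. permute_hypergraph p (x n)) \<circ> Y)"
      by (rule distr_distr[OF m' Y])
    also have "\<dots> = distr M (count_space UNIV) (\<lambda>\<omega>. permute_hypergraph p (H n \<omega>))"
    proof (rule distr_cong_AE[OF refl refl])
      show "AE \<omega> in M. ((\<lambda>x. permute_hypergraph p (x n)) \<circ> Y) \<omega> = permute_hypergraph p (H n \<omega>)"
        using YH by eventually_elim simp
      show "(\<lambda>x. permute_hypergraph p (x n)) \<circ> Y \<in> measurable M (count_space UNIV)" using Y m' by (rule measurable_comp)
      show "(\<lambda>\<omega>. permute_hypergraph p (H n \<omega>)) \<in> measurable M (count_space UNIV)"
        using measurable_compose[OF H(1)[OF n], of "permute_hypergraph p" "count_space UNIV"] by simp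
    qed
    also have "\<dots> = distr M (count_space UNIV) (H n)" by (rule H(4)[OF n p])
    also have "\<dots> = distr M (count_space UNIV) ((\<lambda>x. x n) \<circ> Y)"
    proof (rule distr_cong_AE[OF refl refl])
      show "AE \<omega> in M. H n \<omega> = ((\<lambda>x. x n) \<circ> Y) \<omega>" using YH by eventually_elim simp
      show "(\<lambda>x. x n) \<circ> Y \<in> measurable M (count_space UNIV)" using Y m by (rule measurable_comp)
    qed (rule H(1)[OF n])
    also have "\<dots> = distr ?\<nu> (count_space UNIV) (\<lambda>x. x n)" by (rule distr_distr[OF m Y, symmetric])
    finally show "distr ?\<nu> (count_space UNIV) (\<lambda>x. permute_hypergraph p (x n)) = distr ?\<nu> (count_space UNIV) (\<lambda>x. x n)" .
  qed
  moreover have "?\<nu> = process_law ?\<nu> InHy (\<lambda>n x. x n)" by (simp add: process_law_coordinates)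
  ultimately show ?thesis unfolding eq ExInHy_def by blast
qed

lemma eipI: "erased_interval_process M I \<eta> \<Longrightarrow> eip M I \<eta>"
  by (simp add: eip_def eip_axioms_def erased_interval_process_def)

lemma ErInPrE:
  assumes "\<mu> \<in> ErInPr"
  obtains M :: "(nat \<Rightarrow> nat set set \<times> nat) measure" and I \<eta> where "eip M I \<eta>"
    "\<mu> = process_law M EIP_states (pair_process I \<eta>)"
proof -
  obtain M :: "(nat \<Rightarrow> nat set set \<times> nat) measure" and I \<eta> where "erased_interval_process M I \<eta>"
    "\<mu> = process_law M EIP_states (pair_process I \<eta>)" using assms by (auto simp: ErInPr_def)
  then show ?thesis using that eipI by blast
qed

lemma sets_ErInPr: "\<mu> \<in> ErInPr \<Longrightarrow> sets \<mu> = sets (path_space EIP_states)"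
  by (auto simp: ErInPr_def process_law_def)

lemma hypergraph_law_in_ExInHy:
  assumes "\<mu> \<in> ErInPr" shows "hypergraph_law \<mu> \<in> ExInHy"
proof -
  obtain M :: "(nat \<Rightarrow> nat set set \<times> nat) measure" and I \<eta> where e: "eip M I \<eta>" and \<mu>: "\<mu> = process_law M EIP_states (pair_process I \<eta>)"
    using ErInPrE[OF assms] by blast
  show ?thesis unfolding \<mu> eip.hypergraph_law_process_law[OF e]
    by (rule process_law_in_ExInHy[OF eip.exchangeable_hypergraph_process[OF e]])
qed

text \<open>The constant test function 0 with \<open>U = UNIV\<close> makes the whole of
  \<open>P\<close> a subbasic open set.\<close>

lemma topspace_weak_topology: "topspace (weak_topology X P) = P"
proof -
  have "P = {\<mu> \<in> P. (\<integral>x. (\<lambda>_. 0::real) x \<partial>\<mu>) \<in> UNIV}" by simp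
  moreover have "continuous_map X euclideanreal (\<lambda>_. 0)" "bounded ((\<lambda>_. 0::real) ` topspace X)"
    by (auto intro: bounded_subset[of "{0}"])
  ultimately have "P \<in> {{\<mu> \<in> P. (\<integral>x. f x \<partial>\<mu>) \<in> U} | f U. continuous_map X euclideanreal f \<and> bounded (f ` topspace X) \<and> open U}"
    by blast
  then show ?thesis unfolding weak_topology_def topology_generated_by_topspace by blast
qed

text \<open>By change of variables a test function \<open>f\<close> on hypergraph paths pulls back
  to \<open>f \<circ> hypergraph_path\<close>, which is again bounded and continuous. Subbasic open
  sets therefore pull back to subbasic open sets.\<close>

lemma continuous_hypergraph_law:
  "continuous_map (weak_topology (path_topology EIP_states) ErInPr) (weak_topology (path_topology InHy) ExInHy) hypergraph_law"
  unfolding weak_topology_def[of "path_topology InHy"]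
proof (rule continuous_on_generated_topo)
  fix S assume "S \<in> {{\<mu> \<in> ExInHy. (\<integral>x. f x \<partial>\<mu>) \<in> U} | f U. continuous_map (path_topology InHy) euclideanreal f \<and>
    bounded (f ` topspace (path_topology InHy)) \<and> open U}"
  then obtain f U where S: "S = {\<mu> \<in> ExInHy. (\<integral>x. f x \<partial>\<mu>) \<in> U}" and f: "continuous_map (path_topology InHy) euclideanreal f"
    and b: "bounded (f ` topspace (path_topology InHy))" and U: "open U" by blast
  let ?g = "\<lambda>x. f (hypergraph_path x)"
  have fm: "f \<in> borel_measurable (path_space InHy)" by (rule borel_measurable_path_continuous[OF finite_InHy f])
  have int: "(\<integral>x. f x \<partial>(hypergraph_law \<mu>)) = (\<integral>x. ?g x \<partial>\<mu>)" if "\<mu> \<in> ErInPr" for \<mu>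
  proof -
    have "hypergraph_path \<in> measurable \<mu> (path_space InHy)"
      using measurable_hypergraph_path measurable_cong_sets[OF sets_ErInPr[OF that] refl] by blast
    from integral_distr[OF this fm] show ?thesis unfolding hypergraph_law_eq .
  qed
  have "hypergraph_law -` S \<inter> topspace (weak_topology (path_topology EIP_states) ErInPr) = {\<mu> \<in> ErInPr. (\<integral>x. ?g x \<partial>\<mu>) \<in> U}"
    unfolding S topspace_weak_topology using hypergraph_law_in_ExInHy int by auto
  moreover have "continuous_map (path_topology EIP_states) euclideanreal ?g"
    using continuous_map_compose[OF continuous_map_hypergraph_path f] by (simp add: comp_def)
  moreover have "bounded (?g ` topspace (path_topology EIP_states))"
    by (rule bounded_subset[OF b]) (use hypergraph_path_in in \<open>auto simp: topspace_path_topology\<close>)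
  ultimately show "openin (weak_topology (path_topology EIP_states) ErInPr)
      (hypergraph_law -` S \<inter> topspace (weak_topology (path_topology EIP_states) ErInPr))"
    using U unfolding weak_topology_def[of "path_topology EIP_states"]
    by (intro topology_generated_by_Basis) blast
next
  have "topspace (weak_topology (path_topology InHy) ExInHy) = ExInHy" by (rule topspace_weak_topology)
  then have u: "\<Union> {{\<mu> \<in> ExInHy. (\<integral>x. f x \<partial>\<mu>) \<in> U} | f U. continuous_map (path_topology InHy) euclideanreal f \<and>
    bounded (f ` topspace (path_topology InHy)) \<and> open U} = ExInHy"
    unfolding weak_topology_def topology_generated_by_topspace .
  show "hypergraph_law ` topspace (weak_topology (path_topology EIP_states) ErInPr) \<subseteq>
    \<Union> {{\<mu> \<in> ExInHy. (\<integral>x. f x \<partial>\<mu>) \<in> U} | f U. continuous_map (path_topology InHy) euclideanreal f \<and>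
    bounded (f ` topspace (path_topology InHy)) \<and> open U}"
    unfolding u topspace_weak_topology using hypergraph_law_in_ExInHy by blast
qed

lemma affine_hypergraph_law: "affine_map_on ErInPr hypergraph_law"
  unfolding affine_map_on_def hypergraph_law_eq
proof (intro ballI)
  fix \<mu> \<nu> :: "(nat \<Rightarrow> nat set set \<times> nat) measure" and t :: real assume m: "\<mu> \<in> ErInPr" "\<nu> \<in> ErInPr"
  have "hypergraph_path \<in> measurable \<mu> (path_space InHy)"
    using measurable_hypergraph_path measurable_cong_sets[OF sets_ErInPr[OF m(1)] refl] by blast
  then show "distr (mixture t \<mu> \<nu>) (path_space InHy) hypergraph_path =
      mixture t (distr \<mu> (path_space InHy) hypergraph_path) (distr \<nu> (path_space InHy) hypergraph_path)"
    using sets_ErInPr[OF m(1)] sets_ErInPr[OF m(2)] by (intro distr_mixture) simp_all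
qed

lemma (in eip) scaling_limit_and_formula:
  "AE \<omega> in M. scaling_limit (\<lambda>n. I n \<omega>) (limit_system (\<lambda>n. I n \<omega>))"
  "1 \<le> n \<Longrightarrow> AE \<omega> in M. hypergraph_process I \<eta> n \<omega> =
     {{j \<in> {1..n}. x < U_of (ers \<omega>) j \<and> U_of (ers \<omega>) j < y} | x y. (x, y) \<in> limit_system (\<lambda>n. I n \<omega>)}
     \<union> {{j} | j. j \<in> {1..n}} \<union> {{}}"
proof -
  have *: "scaling_limit (\<lambda>n. I n \<omega>) (limit_system (\<lambda>n. I n \<omega>)) \<and> (1 \<le> n \<longrightarrow> hypergraph_process I \<eta> n \<omega> =
     {{j \<in> {1..n}. x < U_of (ers \<omega>) j \<and> U_of (ers \<omega>) j < y} | x y. (x, y) \<in> limit_system (\<lambda>n. I n \<omega>)}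
     \<union> {{j} | j. j \<in> {1..n}} \<union> {{}})" if t: "typical_path (\<lambda>n. I n \<omega>) (ers \<omega>) (U_of (ers \<omega>))" for \<omega>
  proof -
    interpret typical_path "\<lambda>n. I n \<omega>" "ers \<omega>" "U_of (ers \<omega>)" by (rule t)
    have "limit_system (\<lambda>n. I n \<omega>) = K" using J_InSy scaling_limit_K by (rule limit_systemI)
    then show ?thesis using scaling_limit_K H_eq_K[of n] hypergraph_process_eq_H[OF erased_path_axioms] by simp
  qed
  show "AE \<omega> in M. scaling_limit (\<lambda>n. I n \<omega>) (limit_system (\<lambda>n. I n \<omega>))"
    using AE_typical_path by eventually_elim (use * in blast)
  show "AE \<omega> in M. hypergraph_process I \<eta> n \<omega> =
     {{j \<in> {1..n}. x < U_of (ers \<omega>) j \<and> U_of (ers \<omega>) j < y} | x y. (x, y) \<in> limit_system (\<lambda>n. I n \<omega>)}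
     \<union> {{j} | j. j \<in> {1..n}} \<union> {{}}" if "1 \<le> n"
    using AE_typical_path by eventually_elim (use * that in blast)
qed

section \<open>Surjectivity\<close>

lemma pair_pmf_of_set_prod:
  assumes "finite A" "A \<noteq> {}" "finite B" "B \<noteq> {}"
  shows "pair_pmf (pmf_of_set A) (pmf_of_set B) = pmf_of_set (A \<times> B)"
proof (rule pmf_eqI, clarify)
  fix a b
  show "pmf (pair_pmf (pmf_of_set A) (pmf_of_set B)) (a, b) = pmf (pmf_of_set (A \<times> B)) (a, b)"
    using assms by (simp add: pmf_pair pmf_of_set card_cartesian_product indicator_def)
qed

section \<open>Laws at a single level: relabelling and erasing\<close>

definition eraser_pmf :: "nat \<Rightarrow> (nat \<Rightarrow> nat) pmf" where
  "eraser_pmf n = pmf_of_set (erasers n)"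

definition eta_pmf :: "nat \<Rightarrow> nat pmf" where
  "eta_pmf n = pmf_of_set {1..Suc n}"

lemma erasers_nonempty: "erasers n \<noteq> {}"
  using card_erasers[of n] by (metis card.empty fact_nonzero)

lemma set_eta_pmf: "set_pmf (eta_pmf n) = {1..Suc n}"
  unfolding eta_pmf_def by (rule set_pmf_of_set) auto

lemma eraser_pmf_Suc:
  assumes "1 \<le> n"
  shows "eraser_pmf (Suc n) = map_pmf (\<lambda>(e, k). e(n := k)) (pair_pmf (eraser_pmf n) (eta_pmf n))"
proof -
  have "{1..Suc n} \<noteq> {}" "finite {1..Suc n}" by auto
  then have "pair_pmf (eraser_pmf n) (eta_pmf n) = pmf_of_set (erasers n \<times> {1..Suc n})"
    unfolding eraser_pmf_def eta_pmf_def
    by (intro pair_pmf_of_set_prod finite_erasers erasers_nonempty)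
  moreover have "map_pmf (\<lambda>(e, k). e(n := k)) (pmf_of_set (erasers n \<times> {1..Suc n})) =
      pmf_of_set ((\<lambda>(e, k). e(n := k)) ` (erasers n \<times> {1..Suc n}))"
  proof (rule map_pmf_of_set_inj[OF erasers_Suc(2)[OF assms]])
    show "erasers n \<times> {1..Suc n} \<noteq> {}" using erasers_nonempty[of n] \<open>{1..Suc n} \<noteq> {}\<close> by blast
    show "finite (erasers n \<times> {1..Suc n})" by (intro finite_cartesian_product finite_erasers finite_atLeastAtMost)
  qed
  ultimately show ?thesis unfolding eraser_pmf_def erasers_Suc(1)[OF assms] by simp
qed

lemma map_perm_of_eraser_pmf: "map_pmf (\<lambda>e. perm_of e n) (eraser_pmf n) = pmf_of_set {p. p permutes {1..n}}"
  unfolding eraser_pmf_def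
  by (rule map_pmf_of_set_bij_betw[OF bij_erasers erasers_nonempty finite_erasers])

text \<open>The law of \<open>S\<^sub>n(I\<^sub>n)\<close> when \<open>I\<^sub>n\<close> has law
  \<open>q\<close> and the erasers are independent of it. In the same way \<open>erase_law\<close>
  passes from the law at level \<open>Suc n\<close> to that at level \<open>n\<close>.\<close>

definition label_law :: "nat \<Rightarrow> nat set set pmf \<Rightarrow> nat set set pmf" where
  "label_law n q = bind_pmf q (\<lambda>J. map_pmf (\<lambda>e. permute_hypergraph (perm_of e n) J) (eraser_pmf n))"

definition erase_law :: "nat \<Rightarrow> nat set set pmf \<Rightarrow> nat set set pmf" where
  "erase_law n q = bind_pmf q (\<lambda>J. map_pmf (erase_system J) (eta_pmf n))"

lemma set_erase_law:
  assumes "set_pmf q \<subseteq> InSy (Suc n)" shows "set_pmf (erase_law n q) \<subseteq> InSy n"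
  unfolding erase_law_def using assms by (auto simp: set_eta_pmf intro!: erase_system_InSy)

text \<open>For fixed erasers this is \<open>restrict_permute\<close>. The last eraser is
  independent of the earlier ones, so it may be drawn first and used for erasing, before the shorter
  relabelling is drawn.\<close>

lemma restrict_label_law:
  assumes n: "1 \<le> n" and q: "set_pmf q \<subseteq> InSy (Suc n)"
  shows "map_pmf (\<lambda>G. restrict_hypergraph G n) (label_law (Suc n) q) = label_law n (erase_law n q)"
proof -
  have "map_pmf (\<lambda>G. restrict_hypergraph G n) (map_pmf (\<lambda>e. permute_hypergraph (perm_of e (Suc n)) J) (eraser_pmf (Suc n))) =
      bind_pmf (map_pmf (erase_system J) (eta_pmf n)) (\<lambda>J'. map_pmf (\<lambda>e. permute_hypergraph (perm_of e n) J') (eraser_pmf n))"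
    if J: "J \<in> InSy (Suc n)" for J
  proof -
    have "map_pmf (\<lambda>G. restrict_hypergraph G n) (map_pmf (\<lambda>e. permute_hypergraph (perm_of e (Suc n)) J) (eraser_pmf (Suc n))) =
      map_pmf (\<lambda>(e, k). restrict_hypergraph (permute_hypergraph (perm_of (e(n := k)) (Suc n)) J) n) (pair_pmf (eraser_pmf n) (eta_pmf n))"
      unfolding eraser_pmf_Suc[OF n] by (simp add: map_pmf_comp case_prod_unfold)
    also have "\<dots> = map_pmf (\<lambda>(e, k). permute_hypergraph (perm_of e n) (erase_system J k)) (pair_pmf (eraser_pmf n) (eta_pmf n))"
    proof (rule map_pmf_cong[OF refl], clarify)
      fix e k assume "(e, k) \<in> set_pmf (pair_pmf (eraser_pmf n) (eta_pmf n))"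
      then have "k \<in> {1..Suc n}" by (simp add: set_eta_pmf)
      then have "restrict_hypergraph (permute_hypergraph (perm_of (e(n := k)) (Suc n)) J) n =
        permute_hypergraph (perm_of (e(n := k)) n) (erase_system J k)"
        using restrict_permute[OF J, of "e(n := k)"] by simp
      moreover have "perm_of (e(n := k)) n = perm_of e n" by (rule perm_of_cong) simp
      ultimately show "restrict_hypergraph (permute_hypergraph (perm_of (e(n := k)) (Suc n)) J) n = permute_hypergraph (perm_of e n) (erase_system J k)"
        by simp
    qed
    also have "\<dots> = bind_pmf (eraser_pmf n) (\<lambda>e. bind_pmf (eta_pmf n) (\<lambda>k. return_pmf (permute_hypergraph (perm_of e n) (erase_system J k))))"
      by (simp add: pair_pmf_def map_bind_pmf)
    also have "\<dots> = bind_pmf (eta_pmf n) (\<lambda>k. bind_pmf (eraser_pmf n) (\<lambda>e. return_pmf (permute_hypergraph (perm_of e n) (erase_system J k))))"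
      by (rule bind_commute_pmf)
    also have "\<dots> = bind_pmf (map_pmf (erase_system J) (eta_pmf n)) (\<lambda>J'. map_pmf (\<lambda>e. permute_hypergraph (perm_of e n) J') (eraser_pmf n))"
      unfolding bind_map_pmf by (simp only: map_pmf_def)
    finally show ?thesis .
  qed
  then show ?thesis
    unfolding label_law_def erase_law_def map_bind_pmf bind_assoc_pmf
    by (intro bind_pmf_cong refl) (use q in blast)
qed

text \<open>Sorting \<open>G\<close> deterministically and then relabelling uniformly at random amounts to a
  uniform relabelling of \<open>G\<close>, because the sorting permutation is absorbed.\<close>

lemma label_law_surj:
  assumes h: "set_pmf h \<subseteq> InHy n" and ex: "\<And>p. p permutes {1..n} \<Longrightarrow> map_pmf (permute_hypergraph p) h = h"
  obtains q where "set_pmf q \<subseteq> InSy n" "label_law n q = h"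
proof -
  have "\<forall>G. \<exists>p. G \<in> InHy n \<longrightarrow> p permutes {1..n} \<and> permute_hypergraph p G \<in> InSy n"
    using InHy_sort by metis
  then obtain s where s: "\<And>G. G \<in> InHy n \<Longrightarrow> s G permutes {1..n} \<and> permute_hypergraph (s G) G \<in> InSy n" by metis
  define q where "q = map_pmf (\<lambda>G. permute_hypergraph (s G) G) h"
  define P where "P = pmf_of_set {p. p permutes {1..n}}"
  have fin: "finite {p. p permutes {1..n}}" "{p. p permutes {1..n}} \<noteq> {}"
    using permutes_id[of "{1..n}"] by (simp add: finite_permutations, blast)
  have setP: "set_pmf P = {p. p permutes {1..n}}" unfolding P_def using fin by (simp add: set_pmf_of_set)
  have comp: "map_pmf (\<lambda>p. p \<circ> s G) P = P" if G: "G \<in> InHy n" for G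
    unfolding P_def
  proof (rule map_pmf_of_set_bij_betw[OF _ fin(2,1)], rule bij_betwI[where g = "\<lambda>p. p \<circ> inv (s G)"])
    show "(\<lambda>p. p \<circ> s G) \<in> {p. p permutes {1..n}} \<rightarrow> {p. p permutes {1..n}}"
      using s[OF G] by (auto intro: permutes_compose)
    show "(\<lambda>p. p \<circ> inv (s G)) \<in> {p. p permutes {1..n}} \<rightarrow> {p. p permutes {1..n}}"
      using s[OF G] by (auto intro: permutes_compose permutes_inv)
  qed (use permutes_inverses[of "s G" "{1..n}"] s[OF G] in \<open>auto simp: fun_eq_iff\<close>)
  have "set_pmf q \<subseteq> InSy n" using h s by (auto simp: q_def)
  moreover have "label_law n q = h"
  proof -
    have "label_law n q = bind_pmf h (\<lambda>G. map_pmf (\<lambda>e. permute_hypergraph (perm_of e n) (permute_hypergraph (s G) G)) (eraser_pmf n))"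
      unfolding label_law_def q_def by (simp add: bind_map_pmf)
    also have "\<dots> = bind_pmf h (\<lambda>G. map_pmf (\<lambda>p. permute_hypergraph p (permute_hypergraph (s G) G)) P)"
      unfolding P_def map_perm_of_eraser_pmf[symmetric] by (simp add: map_pmf_comp)
    also have "\<dots> = bind_pmf h (\<lambda>G. map_pmf (\<lambda>p. permute_hypergraph p G) P)"
    proof (rule bind_pmf_cong[OF refl])
      fix G assume "G \<in> set_pmf h"
      then have G: "G \<in> InHy n" using h by blast
      have "map_pmf (\<lambda>p. permute_hypergraph p (permute_hypergraph (s G) G)) P = map_pmf (\<lambda>p. permute_hypergraph p G) (map_pmf (\<lambda>p. p \<circ> s G) P)"
        by (simp add: map_pmf_comp permute_hypergraph_comp)
      then show "map_pmf (\<lambda>p. permute_hypergraph p (permute_hypergraph (s G) G)) P = map_pmf (\<lambda>p. permute_hypergraph p G) P"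
        unfolding comp[OF G] .
    qed
    also have "\<dots> = bind_pmf P (\<lambda>p. map_pmf (permute_hypergraph p) h)"
      unfolding map_pmf_def by (rule bind_commute_pmf)
    also have "\<dots> = bind_pmf P (\<lambda>p. h)" by (rule bind_pmf_cong[OF refl]) (simp add: setP ex)
    finally show ?thesis by simp
  qed
  ultimately show ?thesis using that by blast
qed

section \<open>Consistent laws on interval systems by compactness\<close>

lemma pmf_bind_finite:
  assumes "finite S" "set_pmf q \<subseteq> S"
  shows "pmf (bind_pmf q f) y = (\<Sum>x\<in>S. pmf (f x) y * pmf q x)"
  unfolding pmf_bind by (rule integral_measure_pmf_real[OF assms(1)]) (use assms(2) in auto)

lemma embed_pmf_finite:
  assumes "finite S" "\<And>x. 0 \<le> v x" "\<And>x. x \<notin> S \<Longrightarrow> v x = 0" "(\<Sum>x\<in>S. v x) = 1"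
  obtains q where "\<And>x. pmf q x = v x" "set_pmf q \<subseteq> S"
proof -
  have "(\<integral>\<^sup>+x. ennreal (v x) \<partial>count_space UNIV) = (\<Sum>x\<in>S. ennreal (v x))"
    by (rule nn_integral_count_space') (use assms in auto)
  also have "\<dots> = ennreal (\<Sum>x\<in>S. v x)" using assms(2) by (intro sum_ennreal) simp
  finally have "(\<integral>\<^sup>+x. ennreal (v x) \<partial>count_space UNIV) = 1" using assms(4) by simp
  then have e: "pmf (embed_pmf v) x = v x" for x using assms(2) by (intro pmf_embed_pmf)
  then have "set_pmf (embed_pmf v) \<subseteq> S" using assms(3) by (metis pmf_eq_0_set_pmf subsetI)
  then show ?thesis using e that by blast
qed

text \<open>Sequences of laws on finite sets form a compact space, in which finitely many consistency
  conditions cut out a closed set.\<close>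

lemma consistent_pmf_sequence:
  fixes S :: "nat \<Rightarrow> 'b set" and \<tau> :: "nat \<Rightarrow> 'b \<Rightarrow> 'c pmf" and \<kappa> :: "nat \<Rightarrow> 'b \<Rightarrow> 'b pmf" and h :: "nat \<Rightarrow> 'c pmf"
  assumes fin: "\<And>n. finite (S n)"
    and ex: "\<And>N. \<exists>q. \<forall>n. 1 \<le> n \<and> n \<le> N \<longrightarrow> set_pmf (q n) \<subseteq> S n \<and> bind_pmf (q n) (\<tau> n) = h n \<and>
        (n < N \<longrightarrow> q n = bind_pmf (q (Suc n)) (\<kappa> n))"
  obtains q where "\<And>n. 1 \<le> n \<Longrightarrow> set_pmf (q n) \<subseteq> S n" "\<And>n. 1 \<le> n \<Longrightarrow> bind_pmf (q n) (\<tau> n) = h n"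
    "\<And>n. 1 \<le> n \<Longrightarrow> q n = bind_pmf (q (Suc n)) (\<kappa> n)"
proof -
  \<comment> \<open>Sequences of laws are coded as vectors of point masses \<open>v (n, x)\<close>.
    \<open>T n\<close> collects the conditions at level \<open>n\<close> and \<open>R n\<close>
    links two levels; both are closed, because the sums over the finite sets \<open>S n\<close>
    involve finitely many coordinates.\<close>
  define T where "T n = {v :: nat \<times> 'b \<Rightarrow> real. (\<forall>x\<in>-S n. v (n, x) = 0) \<and> (\<Sum>x\<in>S n. v (n, x)) = 1 \<and>
      (\<forall>y. (\<Sum>x\<in>S n. pmf (\<tau> n x) y * v (n, x)) = pmf (h n) y)}" for n
  define R where "R n = {v :: nat \<times> 'b \<Rightarrow> real. \<forall>y. v (n, y) = (\<Sum>x\<in>S (Suc n). pmf (\<kappa> n x) y * v (Suc n, x))}" for n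
  define D where "D N = (\<Inter>n\<in>{1..N}. T n) \<inter> (\<Inter>n\<in>{1..<N}. R n)" for N
  define B where "B = PiE (UNIV :: (nat \<times> 'b) set) (\<lambda>_. {0..1::real})"
  have "compactin (product_topology (\<lambda>_. euclidean) UNIV) B" unfolding B_def compactin_PiE by simp
  then have compact: "compact B" unfolding euclidean_product_topology by simp
  have clT: "closed (T n)" for n
  proof -
    have "T n = (\<Inter>x\<in>-S n. {v. v (n, x) = 0}) \<inter> {v. (\<Sum>x\<in>S n. v (n, x)) = 1} \<inter>
      (\<Inter>y. {v. (\<Sum>x\<in>S n. pmf (\<tau> n x) y * v (n, x)) = pmf (h n) y})" unfolding T_def by blast
    also have "closed \<dots>"
      by (intro closed_Int closed_INT ballI closed_Collect_eq continuous_on_sum continuous_on_mult continuous_on_const continuous_on_product_coordinates)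
    finally show ?thesis .
  qed
  have clR: "closed (R n)" for n
  proof -
    have "R n = (\<Inter>y. {v. v (n, y) = (\<Sum>x\<in>S (Suc n). pmf (\<kappa> n x) y * v (Suc n, x))})" unfolding R_def by blast
    also have "closed \<dots>"
      by (intro closed_INT ballI closed_Collect_eq continuous_on_sum continuous_on_mult continuous_on_const continuous_on_product_coordinates)
    finally show ?thesis .
  qed
  have clD: "closed (D N)" for N unfolding D_def using clT clR by (intro closed_Int closed_INT ballI)
  have ne: "B \<inter> D N \<noteq> {}" for N
  proof -
    obtain q where q: "\<And>n. 1 \<le> n \<Longrightarrow> n \<le> N \<Longrightarrow> set_pmf (q n) \<subseteq> S n" "\<And>n. 1 \<le> n \<Longrightarrow> n \<le> N \<Longrightarrow> bind_pmf (q n) (\<tau> n) = h n"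
      "\<And>n. 1 \<le> n \<Longrightarrow> n < N \<Longrightarrow> q n = bind_pmf (q (Suc n)) (\<kappa> n)" using ex[of N] by (metis less_imp_le)
    define v where "v = (\<lambda>(n, x). pmf (q n) x)"
    have "v \<in> B" by (auto simp: B_def v_def pmf_le_1 split: prod.split)
    moreover have "v \<in> T n" if n: "1 \<le> n" "n \<le> N" for n
      unfolding T_def v_def mem_Collect_eq prod.case
    proof (intro conjI ballI allI)
      fix x assume "x \<in> - S n" then show "pmf (q n) x = 0" using q(1)[OF n] by (auto simp: set_pmf_iff)
    next
      show "(\<Sum>x\<in>S n. pmf (q n) x) = 1" by (rule sum_pmf_eq_1[OF fin q(1)[OF n]])
    next
      fix y show "(\<Sum>x\<in>S n. pmf (\<tau> n x) y * pmf (q n) x) = pmf (h n) y"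
        using pmf_bind_finite[OF fin q(1)[OF n], of "\<tau> n" y] q(2)[OF n] by simp
    qed
    moreover have "v \<in> R n" if n: "1 \<le> n" "n < N" for n
      unfolding R_def v_def mem_Collect_eq prod.case
    proof
      fix y
      have "set_pmf (q (Suc n)) \<subseteq> S (Suc n)" using q(1)[of "Suc n"] n by simp
      then show "pmf (q n) y = (\<Sum>x\<in>S (Suc n). pmf (\<kappa> n x) y * pmf (q (Suc n)) x)"
        by (subst q(3)[OF n], rule pmf_bind_finite[OF fin])
    qed
    ultimately have "v \<in> B \<inter> D N" unfolding D_def by auto
    then show ?thesis by blast
  qed
  \<comment> \<open>The sets \<open>D N\<close> decrease, so a finite intersection contains one of
    them, and each meets the compact cube \<open>B\<close> by the hypothesis for that level.\<close>
  have "B \<inter> (\<Inter>N. D N) \<noteq> {}"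
  proof (rule compact_imp_fip_image[OF compact clD])
    fix I' :: "nat set" assume I': "finite I'"
    obtain N where N: "\<And>i. i \<in> I' \<Longrightarrow> i \<le> N" using I' by (meson finite_nat_set_iff_bounded_le)
    have "D N \<subseteq> (\<Inter>i\<in>I'. D i)" unfolding D_def using N by fastforce
    then show "B \<inter> (\<Inter>i\<in>I'. D i) \<noteq> {}" using ne[of N] by blast
  qed
  then obtain v where v: "v \<in> B" "\<And>N. v \<in> D N" by blast
  have vT: "v \<in> T n" if "1 \<le> n" for n using v(2)[of n] that unfolding D_def by auto
  have vR: "v \<in> R n" if "1 \<le> n" for n using v(2)[of "Suc n"] that unfolding D_def by auto
  have v0: "0 \<le> v x" for x using v(1) by (cases x) (auto simp: B_def PiE_iff)
  have "\<forall>n. \<exists>p. 1 \<le> n \<longrightarrow> (\<forall>x. pmf p x = v (n, x)) \<and> set_pmf p \<subseteq> S n"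
  proof
    fix n
    show "\<exists>p. 1 \<le> n \<longrightarrow> (\<forall>x. pmf p x = v (n, x)) \<and> set_pmf p \<subseteq> S n"
    proof (cases "1 \<le> n")
      case True
      have "(\<Sum>x\<in>S n. v (n, x)) = 1" "\<And>x. x \<notin> S n \<Longrightarrow> v (n, x) = 0" using vT[OF True] by (auto simp: T_def)
      then show ?thesis using embed_pmf_finite[OF fin, of "\<lambda>x. v (n, x)" n] v0 by metis
    qed simp
  qed
  then obtain q where q: "\<And>n x. 1 \<le> n \<Longrightarrow> pmf (q n) x = v (n, x)" "\<And>n. 1 \<le> n \<Longrightarrow> set_pmf (q n) \<subseteq> S n" by metis
  show ?thesis
  proof (rule that[OF q(2)])
    fix n :: nat assume n: "1 \<le> n"
    show "bind_pmf (q n) (\<tau> n) = h n"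
    proof (rule pmf_eqI)
      fix y show "pmf (bind_pmf (q n) (\<tau> n)) y = pmf (h n) y"
        unfolding pmf_bind_finite[OF fin q(2)[OF n]] q(1)[OF n] using vT[OF n] by (simp add: T_def)
    qed
    have n': "1 \<le> Suc n" by simp
    show "q n = bind_pmf (q (Suc n)) (\<kappa> n)"
    proof (rule pmf_eqI)
      fix y show "pmf (q n) y = pmf (bind_pmf (q (Suc n)) (\<kappa> n)) y"
        unfolding pmf_bind_finite[OF fin q(2)[OF n']] q(1)[OF n] q(1)[OF n'] using vR[OF n] by (simp add: R_def)
    qed
  qed
qed

text \<open>On an uncountable type such as \<open>nat set set\<close> a measure on all subsets need
  not be visibly discrete. Being concentrated on a finite set, this one has almost surely positive
  point masses, which is the carrier condition for a \<open>pmf\<close>.\<close>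

lemma pmf_of_finite_distr:
  assumes M: "prob_space M" and X: "X \<in> measurable M (count_space UNIV)" and S: "finite S" and AE: "AE \<omega> in M. X \<omega> \<in> S"
  obtains p where "measure_pmf p = distr M (count_space UNIV) X" "set_pmf p \<subseteq> S"
proof -
  let ?D = "distr M (count_space UNIV) X"
  interpret D: prob_space ?D using M X by (rule prob_space.prob_space_distr)
  have aS: "AE x in ?D. x \<in> S" using AE by (subst AE_distr_iff[OF X]) auto
  have "AE x in ?D. \<forall>s\<in>S. measure ?D {s} = 0 \<longrightarrow> x \<noteq> s"
  proof (rule AE_finite_allI[OF S])
    fix s
    show "AE x in ?D. measure ?D {s} = 0 \<longrightarrow> x \<noteq> s"
    proof (cases "measure ?D {s} = 0")
      case True
      then have "AE x in ?D. x \<notin> {s}" by (subst (asm) D.prob_eq_0) auto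
      then show ?thesis by simp
    qed simp
  qed
  with aS have a: "AE x in ?D. measure ?D {x} \<noteq> 0"
  proof eventually_elim
    case (elim x)
    from bspec[OF elim(2,1)] show ?case by blast
  qed
  have eq: "measure_pmf (Abs_pmf ?D) = ?D"
    by (rule Abs_pmf_inverse, rule CollectI, intro conjI a D.prob_space_axioms) simp
  have "set_pmf (Abs_pmf ?D) \<subseteq> S"
    using aS AE_measure_pmf_iff[of "\<lambda>x. x \<in> S" "Abs_pmf ?D"] unfolding eq by blast
  then show ?thesis using that eq by blast
qed

lemma exchangeable_pmfs:
  assumes H: "exchangeable_interval_hypergraph M H"
  obtains h where "\<And>n. 1 \<le> n \<Longrightarrow> measure_pmf (h n) = distr M (count_space UNIV) (H n)"
    "\<And>n. 1 \<le> n \<Longrightarrow> set_pmf (h n) \<subseteq> InHy n"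
    "\<And>n p. 1 \<le> n \<Longrightarrow> p permutes {1..n} \<Longrightarrow> map_pmf (permute_hypergraph p) (h n) = h n"
    "\<And>n. 1 \<le> n \<Longrightarrow> map_pmf (\<lambda>G. restrict_hypergraph G n) (h (Suc n)) = h n"
proof -
  have M: "prob_space M" and m: "\<And>n. 1 \<le> n \<Longrightarrow> H n \<in> measurable M (count_space UNIV)"
    and a: "\<And>n. 1 \<le> n \<Longrightarrow> AE \<omega> in M. H n \<omega> \<in> InHy n"
    and r: "\<And>n. 1 \<le> n \<Longrightarrow> AE \<omega> in M. H n \<omega> = restrict_hypergraph (H (n + 1) \<omega>) n"
    and p: "\<And>n p. 1 \<le> n \<Longrightarrow> p permutes {1..n} \<Longrightarrow>
        distr M (count_space UNIV) (\<lambda>\<omega>. permute_hypergraph p (H n \<omega>)) = distr M (count_space UNIV) (H n)"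
    using H unfolding exchangeable_interval_hypergraph_def by blast+
  have "\<forall>n. \<exists>q. 1 \<le> n \<longrightarrow> measure_pmf q = distr M (count_space UNIV) (H n) \<and> set_pmf q \<subseteq> InHy n"
    using pmf_of_finite_distr[OF M m finite_InHy a] by metis
  then obtain h where h: "\<And>n. 1 \<le> n \<Longrightarrow> measure_pmf (h n) = distr M (count_space UNIV) (H n)"
    "\<And>n. 1 \<le> n \<Longrightarrow> set_pmf (h n) \<subseteq> InHy n" by metis
  have map_h: "measure_pmf (map_pmf g (h n)) = distr M (count_space UNIV) (\<lambda>\<omega>. g (H n \<omega>))" if "1 \<le> n" for n and g :: "nat set set \<Rightarrow> nat set set"
    unfolding map_pmf_rep_eq h(1)[OF that] using distr_distr[OF _ m[OF that], of g "count_space UNIV"] by (simp add: comp_def)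
  show ?thesis
  proof (rule that[OF h])
    fix n :: nat and q :: "nat \<Rightarrow> nat" assume n: "1 \<le> n" and q: "q permutes {1..n}"
    show "map_pmf (permute_hypergraph q) (h n) = h n"
      by (rule measure_pmf_inject[THEN iffD1]) (simp only: map_h[OF n] h(1)[OF n] p[OF n q])
  next
    fix n :: nat assume n: "1 \<le> n"
    then have n': "1 \<le> Suc n" by simp
    have "distr M (count_space UNIV) (\<lambda>\<omega>. restrict_hypergraph (H (Suc n) \<omega>) n) = distr M (count_space UNIV) (H n)"
    proof (rule distr_cong_AE[OF refl refl])
      show "AE \<omega> in M. restrict_hypergraph (H (Suc n) \<omega>) n = H n \<omega>" using r[OF n] by eventually_elim simp
      show "(\<lambda>\<omega>. restrict_hypergraph (H (Suc n) \<omega>) n) \<in> measurable M (count_space UNIV)"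
        using measurable_compose[OF m[OF n'], of "\<lambda>G. restrict_hypergraph G n" "count_space UNIV"] by simp
    qed (rule m[OF n])
    then show "map_pmf (\<lambda>G. restrict_hypergraph G n) (h (Suc n)) = h n"
      by (intro measure_pmf_inject[THEN iffD1]) (simp only: map_h[OF n'] h(1)[OF n])
  qed
qed

text \<open>For each \<open>N\<close> a law of sorted hypergraphs at level \<open>N\<close> is
  erased downwards. By \<open>restrict_label_law\<close> and the consistency of \<open>h\<close>,
  its relabelling has law \<open>h n\<close> at every lower level, as the compactness lemma
  requires.\<close>

lemma consistent_interval_laws:
  assumes h: "\<And>n. 1 \<le> n \<Longrightarrow> set_pmf (h n) \<subseteq> InHy n"
    "\<And>n p. 1 \<le> n \<Longrightarrow> p permutes {1..n} \<Longrightarrow> map_pmf (permute_hypergraph p) (h n) = h n"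
    "\<And>n. 1 \<le> n \<Longrightarrow> map_pmf (\<lambda>G. restrict_hypergraph G n) (h (Suc n)) = h n"
  obtains q where "\<And>n. 1 \<le> n \<Longrightarrow> set_pmf (q n) \<subseteq> InSy n" "\<And>n. 1 \<le> n \<Longrightarrow> label_law n (q n) = h n"
    "\<And>n. 1 \<le> n \<Longrightarrow> q n = erase_law n (q (Suc n))"
proof (rule consistent_pmf_sequence[of InSy "\<lambda>n J. map_pmf (\<lambda>e. permute_hypergraph (perm_of e n) J) (eraser_pmf n)" h
      "\<lambda>n J. map_pmf (erase_system J) (eta_pmf n)", OF finite_InSy])
  fix N
  show "\<exists>q. \<forall>n. 1 \<le> n \<and> n \<le> N \<longrightarrow> set_pmf (q n) \<subseteq> InSy n \<and>
      bind_pmf (q n) (\<lambda>J. map_pmf (\<lambda>e. permute_hypergraph (perm_of e n) J) (eraser_pmf n)) = h n \<and>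
      (n < N \<longrightarrow> q n = bind_pmf (q (Suc n)) (\<lambda>J. map_pmf (erase_system J) (eta_pmf n)))"
    unfolding label_law_def[symmetric] erase_law_def[symmetric]
  proof (cases "1 \<le> N")
    case True
    obtain q where q: "set_pmf q \<subseteq> InSy N" "label_law N q = h N"
      using label_law_surj[OF h(1,2)[OF True]] by blast
    \<comment> \<open>\<open>r d\<close> is the law at level \<open>N - d\<close>; the recursion
      runs downwards from the top level.\<close>
    define r where "r = rec_nat q (\<lambda>d. erase_law (N - Suc d))"
    have r: "r 0 = q" "r (Suc d) = erase_law (N - Suc d) (r d)" for d by (simp_all add: r_def)
    have P: "set_pmf (r d) \<subseteq> InSy (N - d) \<and> label_law (N - d) (r d) = h (N - d)" if "d < N" for d
      using that
    proof (induction d)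
      case 0 then show ?case using q r by simp
    next
      case (Suc d)
      define n where "n = N - Suc d"
      have n: "1 \<le> n" "Suc n = N - d" using Suc.prems by (auto simp: n_def)
      have IH: "set_pmf (r d) \<subseteq> InSy (Suc n)" "label_law (Suc n) (r d) = h (Suc n)" using Suc n by auto
      have "label_law n (erase_law n (r d)) = h n"
        using restrict_label_law[OF n(1) IH(1)] IH(2) h(3)[OF n(1)] by simp
      then show ?case using set_erase_law[OF IH(1)] by (simp add: r n_def[symmetric])
    qed
    show "\<exists>q. \<forall>n. 1 \<le> n \<and> n \<le> N \<longrightarrow> set_pmf (q n) \<subseteq> InSy n \<and> label_law n (q n) = h n \<and> (n < N \<longrightarrow> q n = erase_law n (q (Suc n)))"
    proof (intro exI[of _ "\<lambda>n. r (N - n)"] allI impI conjI)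
      fix n assume n: "1 \<le> n \<and> n \<le> N"
      then have "N - n < N" "N - (N - n) = n" by auto
      with P[of "N - n"] show "set_pmf (r (N - n)) \<subseteq> InSy n" "label_law n (r (N - n)) = h n" by simp_all
      assume "n < N"
      then have "N - n = Suc (N - Suc n)" "N - Suc (N - Suc n) = n" by auto
      then show "r (N - n) = erase_law n (r (N - Suc n))" using r(2)[of "N - Suc n"] by simp
    qed
  qed auto
next
  fix q :: "nat \<Rightarrow> nat set set pmf"
  assume a: "\<And>n. 1 \<le> n \<Longrightarrow> set_pmf (q n) \<subseteq> InSy n"
    "\<And>n. 1 \<le> n \<Longrightarrow> bind_pmf (q n) (\<lambda>J. map_pmf (\<lambda>e. permute_hypergraph (perm_of e n) J) (eraser_pmf n)) = h n"
    "\<And>n. 1 \<le> n \<Longrightarrow> q n = bind_pmf (q (Suc n)) (\<lambda>J. map_pmf (erase_system J) (eta_pmf n))"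
  show thesis by (rule that[of q, unfolded label_law_def erase_law_def, OF a])
qed


section \<open>The backward Markov chain\<close>

lemma erase_law_pair: "erase_law n q = map_pmf (\<lambda>(J, k). erase_system J k) (pair_pmf q (eta_pmf n))"
  unfolding erase_law_def pair_pmf_def map_bind_pmf by (simp add: map_pmf_def bind_return_pmf)

text \<open>The definition erases at the top first; this splits off the erasure at the bottom, which
  comes last.\<close>

lemma erase_down_Suc: "erase_down h m (Suc d) J = erase_system (erase_down h (Suc m) d J) (h m)"
  by (induction d arbitrary: J) auto

locale interval_laws =
  fixes q :: "nat \<Rightarrow> nat set set pmf"
  assumes q_InSy: "1 \<le> n \<Longrightarrow> set_pmf (q n) \<subseteq> InSy n"
    and q_erase: "1 \<le> n \<Longrightarrow> q n = erase_law n (q (Suc n))"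
begin

text \<open>The transition kernel of the reversed chain: the next system and its eraser, conditioned
  on \<open>J\<close> being the result of the erasure.\<close>

definition step_pmf :: "nat \<Rightarrow> nat set set \<Rightarrow> (nat set set \<times> nat) pmf" where
  "step_pmf n J = cond_pmf (pair_pmf (q (Suc n)) (eta_pmf n)) {(J', k). erase_system J' k = J}"

lemma step_nonempty:
  assumes "1 \<le> n" "J \<in> set_pmf (q n)"
  shows "set_pmf (pair_pmf (q (Suc n)) (eta_pmf n)) \<inter> {(J', k). erase_system J' k = J} \<noteq> {}"
proof -
  have "J \<in> set_pmf (map_pmf (\<lambda>(J, k). erase_system J k) (pair_pmf (q (Suc n)) (eta_pmf n)))"
    using assms q_erase[OF assms(1)] erase_law_pair by metis
  then show ?thesis unfolding set_map_pmf by auto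
qed

lemma set_step_pmf:
  assumes "1 \<le> n" "J \<in> set_pmf (q n)" "x \<in> set_pmf (step_pmf n J)"
  shows "fst x \<in> set_pmf (q (Suc n))" "snd x \<in> {1..Suc n}" "erase_system (fst x) (snd x) = J"
  using assms(3) unfolding step_pmf_def set_cond_pmf[OF step_nonempty[OF assms(1,2)]]
  by (auto simp: set_eta_pmf)

lemma pmf_step_pmf:
  assumes n: "1 \<le> n" and J: "J \<in> set_pmf (q n)" and k: "k \<in> {1..Suc n}" and e: "erase_system J' k = J"
  shows "pmf (step_pmf n J) (J', k) = pmf (q (Suc n)) J' / real (Suc n) / pmf (q n) J"
proof -
  have "pmf (q n) J = pmf (map_pmf (\<lambda>(J, k). erase_system J k) (pair_pmf (q (Suc n)) (eta_pmf n))) J"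
    using q_erase[OF n] erase_law_pair by metis
  also have "\<dots> = measure (pair_pmf (q (Suc n)) (eta_pmf n)) {(J', k). erase_system J' k = J}"
    unfolding pmf_map by (rule arg_cong[where f = "measure _"]) auto
  finally have m: "measure (pair_pmf (q (Suc n)) (eta_pmf n)) {(J', k). erase_system J' k = J} = pmf (q n) J" ..
  have "pmf (eta_pmf n) k = 1 / real (Suc n)" unfolding eta_pmf_def using k by (subst pmf_of_set) auto
  then show ?thesis
    unfolding step_pmf_def pmf_cond[OF step_nonempty[OF n J]] m using e by (simp add: pmf_pair)
qed

lemma erase_set_q:
  assumes "1 \<le> n" "J \<in> set_pmf (q (Suc n))" "k \<in> {1..Suc n}"
  shows "erase_system J k \<in> set_pmf (q n)"
  unfolding q_erase[OF assms(1)] erase_law_def set_bind_pmf set_map_pmf set_eta_pmf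
  using assms(2,3) by (intro UN_I[of J] imageI)

lemma set_q_1: "set_pmf (q 1) = {{{}, {1}}}"
proof -
  have "J = {{}, {1}}" if "J \<in> set_pmf (q 1)" for J using q_InSy[of 1] that InSy_1 by blast
  then show ?thesis using set_pmf_not_empty[of "q 1"] by blast
qed

text \<open>One independent draw for every level and every system: \<open>\<omega> (n, J)\<close> is
  the transition made if the chain is in state \<open>J\<close> at level \<open>n\<close>. The
  dependent chain thus becomes a function on a product space.\<close>

definition W :: "(nat \<times> nat set set \<Rightarrow> nat set set \<times> nat) measure" where
  "W = PiM UNIV (\<lambda>i. measure_pmf (step_pmf (fst i) (snd i)))"

sublocale P: product_prob_space "\<lambda>i. measure_pmf (step_pmf (fst i) (snd i))" UNIV
  by unfold_locales

sublocale W: prob_space W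
  unfolding W_def by (rule P.prob_space_axioms)

text \<open>Replaces exceptional values by the trivial system, so that \<open>chain\<close> stays in
  a finite set for every \<open>\<omega>\<close> and its events are finite unions.\<close>

definition clamp :: "nat \<Rightarrow> nat set set \<Rightarrow> nat set set" where
  "clamp n J = (if J \<in> InSy n then J else {{}} \<union> {{j} | j. j \<in> {1..n}})"

primrec chain :: "nat \<Rightarrow> (nat \<times> nat set set \<Rightarrow> nat set set \<times> nat) \<Rightarrow> nat set set" where
  "chain 0 \<omega> = {{}, {1}}"
| "chain (Suc n) \<omega> = (if n = 0 then {{}, {1}} else clamp (Suc n) (fst (\<omega> (n, chain n \<omega>))))"

definition chain_eta :: "nat \<Rightarrow> (nat \<times> nat set set \<Rightarrow> nat set set \<times> nat) \<Rightarrow> nat" where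
  "chain_eta n \<omega> = snd (\<omega> (n, chain n \<omega>))"

lemma chain_InSy: "1 \<le> n \<Longrightarrow> chain n \<omega> \<in> InSy n"
proof (cases n)
  case (Suc m)
  then show ?thesis using InSy_1 InSy_nonempty[of n] by (cases "m = 0") (auto simp: clamp_def)
qed simp

lemma event_component: "{\<omega> \<in> space W. P (\<omega> i)} \<in> W.events"
proof -
  have "(\<lambda>\<omega>. \<omega> i) \<in> measurable W (measure_pmf (step_pmf (fst i) (snd i)))"
    unfolding W_def by (rule measurable_component_singleton) simp
  from measurable_sets[OF this, of "Collect P"] show ?thesis by (simp add: vimage_def Int_def conj_commute)
qed

lemma event_chain:
  assumes "1 \<le> n" shows "{\<omega> \<in> space W. chain n \<omega> = J} \<in> W.events"
  using assms
proof (induction n arbitrary: J rule: nat_induct_at_least)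
  case base
  show ?case by (cases "{{}, {1}} = J") auto
next
  case (Suc n)
  have "{\<omega> \<in> space W. chain (Suc n) \<omega> = J} =
    (\<Union>J'\<in>InSy n. {\<omega> \<in> space W. chain n \<omega> = J'} \<inter> {\<omega> \<in> space W. clamp (Suc n) (fst (\<omega> (n, J'))) = J})"
    using chain_InSy[OF Suc.hyps] Suc.hyps by auto
  also have "\<dots> \<in> W.events" using Suc.IH event_component finite_InSy by (intro sets.finite_UN sets.Int) auto
  finally show ?case .
qed

lemma measurable_chain:
  assumes n: "1 \<le> n" shows "pair_process chain chain_eta n \<in> measurable W (count_space UNIV)"
proof (rule measurableI)
  fix B
  have "pair_process chain chain_eta n -` B \<inter> space W =
    (\<Union>J\<in>InSy n. {\<omega> \<in> space W. chain n \<omega> = J} \<inter> {\<omega> \<in> space W. (J, snd (\<omega> (n, J))) \<in> B})"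
    using chain_InSy[OF n] by (auto simp: chain_eta_def)
  also have "\<dots> \<in> W.events"
    using event_chain[OF n] event_component[of "\<lambda>x. (J, snd x) \<in> B" for J] finite_InSy
    by (intro sets.finite_UN sets.Int) auto
  finally show "pair_process chain chain_eta n -` B \<inter> space W \<in> W.events" .
qed simp

definition supported :: "(nat \<times> nat set set \<Rightarrow> nat set set \<times> nat) \<Rightarrow> bool" where
  "supported \<omega> \<longleftrightarrow> (\<forall>n. \<forall>J\<in>InSy n. \<omega> (n, J) \<in> set_pmf (step_pmf n J))"

lemma AE_supported: "AE \<omega> in W. supported \<omega>"
  unfolding supported_def AE_all_countable
proof (intro allI AE_finite_allI finite_InSy)
  fix n J
  show "AE \<omega> in W. \<omega> (n, J) \<in> set_pmf (step_pmf n J)"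
    unfolding W_def by (rule P.AE_component) (auto simp: AE_measure_pmf_iff)
qed

lemma chain_support:
  assumes s: "supported \<omega>" and n: "1 \<le> n"
  shows "chain n \<omega> \<in> set_pmf (q n)"
  using n
proof (induction n rule: nat_induct_at_least)
  case base then show ?case using set_q_1 by simp
next
  case (Suc n)
  have "\<omega> (n, chain n \<omega>) \<in> set_pmf (step_pmf n (chain n \<omega>))"
    using s chain_InSy[OF Suc.hyps] unfolding supported_def by blast
  from set_step_pmf(1)[OF Suc.hyps Suc.IH this] show ?case
    using Suc.hyps q_InSy[of "Suc n"] by (auto simp: clamp_def)
qed

lemma chain_step:
  assumes s: "supported \<omega>" and n: "1 \<le> n"
  shows "\<omega> (n, chain n \<omega>) = (chain (Suc n) \<omega>, chain_eta n \<omega>)" "chain_eta n \<omega> \<in> {1..Suc n}"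
    "chain n \<omega> = erase_system (chain (Suc n) \<omega>) (chain_eta n \<omega>)"
proof -
  have x: "\<omega> (n, chain n \<omega>) \<in> set_pmf (step_pmf n (chain n \<omega>))"
    using s chain_InSy[OF n] unfolding supported_def by blast
  note S = set_step_pmf[OF n chain_support[OF s n] x]
  have "fst (\<omega> (n, chain n \<omega>)) \<in> InSy (Suc n)" using S(1) q_InSy[of "Suc n"] by auto
  then have f: "chain (Suc n) \<omega> = fst (\<omega> (n, chain n \<omega>))" using n by (simp add: clamp_def)
  show "\<omega> (n, chain n \<omega>) = (chain (Suc n) \<omega>, chain_eta n \<omega>)" unfolding f chain_eta_def by simp
  show "chain_eta n \<omega> \<in> {1..Suc n}" using S(2) by (simp add: chain_eta_def)
  show "chain n \<omega> = erase_system (chain (Suc n) \<omega>) (chain_eta n \<omega>)" unfolding f chain_eta_def by (rule S(3)[symmetric])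
qed

lemma erased_path_chain:
  assumes "supported \<omega>" shows "erased_path (\<lambda>n. chain n \<omega>) (\<lambda>m. chain_eta m \<omega>)"
proof
  fix n :: nat assume n: "1 \<le> n"
  show "chain n \<omega> \<in> InSy n" by (rule chain_InSy[OF n])
  show "chain_eta n \<omega> \<in> {1..Suc n}" by (rule chain_step(2)[OF assms n])
  show "chain n \<omega> = erase_system (chain (Suc n) \<omega>) (chain_eta n \<omega>)" by (rule chain_step(3)[OF assms n])
qed

lemma event_prefix_chain:
  assumes n: "1 \<le> n"
  shows "{\<omega> \<in> space W. \<forall>k\<in>{1..<n}. chain_eta k \<omega> = e k} \<inter> {\<omega> \<in> space W. chain n \<omega> = J} \<in> W.events"
proof (intro sets.Int event_chain[OF n] sets.sets_Collect_finite_All)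
  fix k assume "k \<in> {1..<n}"
  then have "1 \<le> k" by simp
  from measurable_sets[OF measurable_chain[OF this], of "{x. snd x = e k}"]
  show "{\<omega> \<in> space W. chain_eta k \<omega> = e k} \<in> W.events" by (simp add: vimage_def Int_def conj_commute)
qed simp

text \<open>On supported points the path is determined backwards by its last system and the erasers,
  so the event is a cylinder, and the product of the transition probabilities telescopes.\<close>

lemma prob_path:
  assumes n: "1 \<le> n" and e: "e \<in> erasers n"
  shows "W.prob ({\<omega> \<in> space W. \<forall>k\<in>{1..<n}. chain_eta k \<omega> = e k} \<inter> {\<omega> \<in> space W. chain n \<omega> = J}) = pmf (q n) J / fact n"
proof (cases "J \<in> set_pmf (q n)")
  case False
  have "AE \<omega> in W. \<not> (\<omega> \<in> {\<omega> \<in> space W. \<forall>k\<in>{1..<n}. chain_eta k \<omega> = e k} \<inter> {\<omega> \<in> space W. chain n \<omega> = J})"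
    using AE_supported by eventually_elim (use chain_support[OF _ n] False in blast)
  then have "W.prob ({\<omega> \<in> space W. \<forall>k\<in>{1..<n}. chain_eta k \<omega> = e k} \<inter> {\<omega> \<in> space W. chain n \<omega> = J}) = 0"
    using W.prob_eq_0[OF event_prefix_chain[OF n]] by blast
  moreover have "pmf (q n) J = 0" using False by (simp add: set_pmf_iff)
  ultimately show ?thesis by simp
next
  case True
  define i where "i k = erase_down e k (n - k) J" for k
  have i_n: "i n = J" by (simp add: i_def)
  have i_step: "i k = erase_system (i (Suc k)) (e k)" if "k < n" for k
  proof -
    have "n - k = Suc (n - Suc k)" using that by simp
    then show ?thesis unfolding i_def by (simp only: erase_down_Suc)
  qed
  have i_set: "i k \<in> set_pmf (q k)" if "1 \<le> k" "k \<le> n" for k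
    using that(2,1)
  proof (induction k rule: inc_induct)
    case base then show ?case using True i_n by simp
  next
    case (step k)
    then show ?case unfolding i_step[OF step.hyps(2)]
      using eraser_le[OF e] by (intro erase_set_q) auto
  qed
  \<comment> \<open>The indices \<open>(k, i k)\<close> differ in their level, so \<open>C\<close>
    prescribes distinct, independent draws and has a product as its probability.\<close>
  define C where "C = {\<omega> \<in> space W. \<forall>j\<in>(\<lambda>k. (k, i k)) ` {1..<n}. \<omega> j \<in> {(i (Suc (fst j)), e (fst j))}}"
  have "W.prob ({\<omega> \<in> space W. \<forall>k\<in>{1..<n}. chain_eta k \<omega> = e k} \<inter> {\<omega> \<in> space W. chain n \<omega> = J}) = W.prob C"
  proof (rule W.finite_measure_eq_AE[OF _ event_prefix_chain[OF n]])
    show "C \<in> W.events" unfolding C_def by (rule sets.sets_Collect_finite_All) (auto intro: event_component)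
    show "AE \<omega> in W. \<omega> \<in> {\<omega> \<in> space W. \<forall>k\<in>{1..<n}. chain_eta k \<omega> = e k} \<inter> {\<omega> \<in> space W. chain n \<omega> = J} \<longleftrightarrow> \<omega> \<in> C"
      using AE_supported AE_space
    proof eventually_elim
      case (elim \<omega>)
      have "(\<forall>k\<in>{1..<n}. chain_eta k \<omega> = e k) \<and> chain n \<omega> = J \<longleftrightarrow> (\<forall>k\<in>{1..<n}. \<omega> (k, i k) = (i (Suc k), e k))"
      proof
        assume a: "(\<forall>k\<in>{1..<n}. chain_eta k \<omega> = e k) \<and> chain n \<omega> = J"
        have ci: "chain k \<omega> = i k" if k: "1 \<le> k" "k \<le> n" for k
        proof -
          have "chain k \<omega> = erase_down (\<lambda>m. chain_eta m \<omega>) k (n - k) (chain (k + (n - k)) \<omega>)"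
            by (rule erased_path.J_erase_down[OF erased_path_chain[OF elim(1)] k(1)])
          also have "\<dots> = erase_down e k (n - k) J" using a k by (simp, intro erase_down_cong) auto
          finally show ?thesis by (simp add: i_def)
        qed
        show "\<forall>k\<in>{1..<n}. \<omega> (k, i k) = (i (Suc k), e k)"
        proof
          fix k assume k: "k \<in> {1..<n}"
          have "\<omega> (k, chain k \<omega>) = (chain (Suc k) \<omega>, chain_eta k \<omega>)" using k by (intro chain_step(1)[OF elim(1)]) simp
          then show "\<omega> (k, i k) = (i (Suc k), e k)" using ci[of k] ci[of "Suc k"] a k by simp
        qed
      next
        assume a: "\<forall>k\<in>{1..<n}. \<omega> (k, i k) = (i (Suc k), e k)"
        have ci: "k \<le> n \<longrightarrow> chain k \<omega> = i k" if "1 \<le> k" for k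
          using that
        proof (induction k rule: nat_induct_at_least)
          case base
          show ?case using i_set[of 1] n set_q_1 by simp
        next
          case (Suc k)
          show ?case
          proof
            assume le: "Suc k \<le> n"
            have "i (Suc k) \<in> InSy (Suc k)" using i_set[of "Suc k"] q_InSy[of "Suc k"] le by auto
            then show "chain (Suc k) \<omega> = i (Suc k)" using Suc le a by (simp add: clamp_def)
          qed
        qed
        then show "(\<forall>k\<in>{1..<n}. chain_eta k \<omega> = e k) \<and> chain n \<omega> = J"
          using a n i_n by (auto simp: chain_eta_def)
      qed
      then show ?case using elim(2) by (simp add: C_def)
    qed
  qed
  also have "W.prob C = (\<Prod>k\<in>{1..<n}. pmf (step_pmf k (i k)) (i (Suc k), e k))"
  proof -
    have inj: "inj_on (\<lambda>k. (k, i k)) {1..<n}" by (auto simp: inj_on_def)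
    have "emeasure W C = (\<Prod>j\<in>(\<lambda>k. (k, i k)) ` {1..<n}. emeasure (measure_pmf (step_pmf (fst j) (snd j))) {(i (Suc (fst j)), e (fst j))})"
      unfolding C_def W_def by (rule P.emeasure_PiM_Collect) auto
    also have "\<dots> = (\<Prod>k\<in>{1..<n}. ennreal (pmf (step_pmf k (i k)) (i (Suc k), e k)))"
      by (subst prod.reindex[OF inj]) (simp add: emeasure_pmf_single)
    also have "\<dots> = ennreal (\<Prod>k\<in>{1..<n}. pmf (step_pmf k (i k)) (i (Suc k), e k))"
      by (rule prod_ennreal) simp
    finally show ?thesis by (simp add: W.emeasure_eq_measure prod_nonneg)
  qed
  also have "\<dots> = pmf (q n) (i n) / fact n"
  proof -
    have "m \<le> n \<longrightarrow> (\<Prod>k\<in>{1..<m}. pmf (step_pmf k (i k)) (i (Suc k), e k)) = pmf (q m) (i m) / fact m" if "1 \<le> m" for m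
      using that
    proof (induction m rule: nat_induct_at_least)
      case base
      have "q 1 = return_pmf {{}, {1}}" using set_q_1 set_pmf_subset_singleton[of "q 1" "{{}, {1}}"] by blast
      moreover have "i 1 = {{}, {1}}" using i_set[of 1] n set_q_1 by simp
      ultimately show ?case by simp
    next
      case (Suc m)
      show ?case
      proof
        assume le: "Suc m \<le> n"
        have im: "i m \<in> set_pmf (q m)" using i_set[of m] Suc.hyps le by simp
        then have p: "pmf (q m) (i m) \<noteq> 0" by (simp add: set_pmf_iff)
        have "pmf (step_pmf m (i m)) (i (Suc m), e m) = pmf (q (Suc m)) (i (Suc m)) / real (Suc m) / pmf (q m) (i m)"
          using le Suc.hyps eraser_le[OF e, of m] i_step[of m] by (intro pmf_step_pmf im) auto
        moreover have "{1..<Suc m} = insert m {1..<m}" using Suc.hyps by auto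
        ultimately have "(\<Prod>k\<in>{1..<Suc m}. pmf (step_pmf k (i k)) (i (Suc k), e k)) =
            pmf (q (Suc m)) (i (Suc m)) / real (Suc m) / pmf (q m) (i m) * (pmf (q m) (i m) / fact m)"
          using Suc.IH le by simp
        also have "\<dots> = pmf (q (Suc m)) (i (Suc m)) / fact (Suc m)" using p by simp
        finally show "(\<Prod>k\<in>{1..<Suc m}. pmf (step_pmf k (i k)) (i (Suc k), e k)) = pmf (q (Suc m)) (i (Suc m)) / fact (Suc m)" .
      qed
    qed
    then show ?thesis using n by blast
  qed
  finally show ?thesis unfolding i_n .
qed

lemma prob_chain:
  assumes n: "1 \<le> n" shows "W.prob {\<omega> \<in> space W. chain n \<omega> = J} = pmf (q n) J"
proof -
  define B where "B e = {\<omega> \<in> space W. \<forall>k\<in>{1..<n}. chain_eta k \<omega> = e k} \<inter> {\<omega> \<in> space W. chain n \<omega> = J}" for e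
  have "W.prob {\<omega> \<in> space W. chain n \<omega> = J} = W.prob (\<Union>e\<in>erasers n. B e)"
  proof (rule W.finite_measure_eq_AE[OF _ event_chain[OF n]])
    show "(\<Union>e\<in>erasers n. B e) \<in> W.events"
      unfolding B_def using event_prefix_chain[OF n] by (intro sets.finite_UN finite_erasers) blast
    show "AE \<omega> in W. \<omega> \<in> {\<omega> \<in> space W. chain n \<omega> = J} \<longleftrightarrow> \<omega> \<in> (\<Union>e\<in>erasers n. B e)"
      using AE_supported
    proof eventually_elim
      case (elim \<omega>)
      have "restrict (\<lambda>m. chain_eta m \<omega>) {1..<n} \<in> erasers n" using chain_step(2)[OF elim] by (auto simp: PiE_iff)
      moreover have "\<omega> \<in> {\<omega> \<in> space W. chain n \<omega> = J} \<Longrightarrow> \<omega> \<in> B (restrict (\<lambda>m. chain_eta m \<omega>) {1..<n})"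
        unfolding B_def by simp
      moreover have "\<omega> \<in> B e \<Longrightarrow> \<omega> \<in> {\<omega> \<in> space W. chain n \<omega> = J}" for e unfolding B_def by simp
      ultimately show ?case by blast
    qed
  qed
  also have "\<dots> = (\<Sum>e\<in>erasers n. W.prob (B e))"
  proof (rule W.finite_measure_finite_Union[OF finite_erasers])
    show "B ` erasers n \<subseteq> W.events" using event_prefix_chain[OF n] unfolding B_def by blast
    show "disjoint_family_on B (erasers n)"
      unfolding disjoint_family_on_def
    proof (intro ballI impI)
      fix e e' assume e: "e \<in> erasers n" "e' \<in> erasers n" "e \<noteq> e'"
      show "B e \<inter> B e' = {}"
      proof (rule ccontr)
        assume "B e \<inter> B e' \<noteq> {}"
        then obtain \<omega> where "\<omega> \<in> B e" "\<omega> \<in> B e'" by blast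
        then have "e k = e' k" if "k \<in> {1..<n}" for k using that unfolding B_def by auto
        then show False using PiE_ext[OF e(1,2)] e(3) by blast
      qed
    qed
  qed
  also have "\<dots> = (\<Sum>e\<in>erasers n. pmf (q n) J / fact n)"
    unfolding B_def by (rule sum.cong[OF refl]) (rule prob_path[OF n])
  also have "\<dots> = real (card (erasers n)) * (pmf (q n) J / fact n)" by (rule sum_constant)
  also have "\<dots> = pmf (q n) J" unfolding card_erasers by simp
  finally show ?thesis .
qed

sublocale chain: eraser_law W chain chain_eta
proof
  show "AE \<omega> in W. erased_path (\<lambda>n. chain n \<omega>) (\<lambda>m. chain_eta m \<omega>)"
    using AE_supported by eventually_elim (rule erased_path_chain)
qed (auto simp: measurable_chain prob_path prob_chain simp del: One_nat_def)

lemma eip_chain: "eip W chain chain_eta"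
  by (rule eipI[OF chain.erased_interval_process])

text \<open>Both masses at \<open>G\<close> are the same sum over \<open>J\<close>: the weight
  \<open>pmf (q n) J\<close> times the proportion of eraser sequences that relabel \<open>J\<close>
  to \<open>G\<close>.\<close>

lemma distr_hypergraph_chain:
  assumes n: "1 \<le> n"
  shows "distr W (count_space UNIV) (hypergraph_process chain chain_eta n) = measure_pmf (label_law n (q n))"
proof -
  note meas = eip.measurable_hypergraph_process[OF eip_chain n]
  have "AE \<omega> in W. hypergraph_process chain chain_eta n \<omega> \<in> InHy n"
    using eip.exchangeable_hypergraph_process[OF eip_chain] n unfolding exchangeable_interval_hypergraph_def by blast
  then obtain p where p: "measure_pmf p = distr W (count_space UNIV) (hypergraph_process chain chain_eta n)"
    using pmf_of_finite_distr[OF W.prob_space_axioms meas finite_InHy] by metis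
  have "p = label_law n (q n)"
  proof (rule pmf_eqI)
    fix G
    have "pmf p G = W.prob {\<omega> \<in> space W. permute_hypergraph (perm_of (\<lambda>m. chain_eta m \<omega>) n) (chain n \<omega>) = G}"
      unfolding pmf.rep_eq p
      by (subst measure_distr[OF meas]) (auto intro!: arg_cong[where f = "W.prob"] simp: hypergraph_process_def)
    also have "\<dots> = (\<Sum>J\<in>InSy n. W.prob {\<omega> \<in> space W. chain n \<omega> = J} * real (card {e \<in> erasers n. permute_hypergraph (perm_of e n) J = G}) / fact n)"
    proof (rule chain.prob_prefix_I[OF n])
      fix h h' :: "nat \<Rightarrow> nat" and J assume "\<And>k. 1 \<le> k \<Longrightarrow> k < n \<Longrightarrow> h k = h' k"
      then have "perm_of h n = perm_of h' n" by (rule perm_of_cong)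
      then show "(permute_hypergraph (perm_of h n) J = G) = (permute_hypergraph (perm_of h' n) J = G)" by simp
    qed
    also have "\<dots> = (\<Sum>J\<in>InSy n. pmf (map_pmf (\<lambda>e. permute_hypergraph (perm_of e n) J) (eraser_pmf n)) G * pmf (q n) J)"
    proof (rule sum.cong[OF refl])
      fix J
      have "pmf (map_pmf (\<lambda>e. permute_hypergraph (perm_of e n) J) (eraser_pmf n)) G =
        real (card (erasers n \<inter> (\<lambda>e. permute_hypergraph (perm_of e n) J) -` {G})) / real (card (erasers n))"
        unfolding pmf_map eraser_pmf_def by (rule measure_pmf_of_set[OF erasers_nonempty finite_erasers])
      also have "erasers n \<inter> (\<lambda>e. permute_hypergraph (perm_of e n) J) -` {G} = {e \<in> erasers n. permute_hypergraph (perm_of e n) J = G}"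
        by auto
      finally show "W.prob {\<omega> \<in> space W. chain n \<omega> = J} * real (card {e \<in> erasers n. permute_hypergraph (perm_of e n) J = G}) / fact n =
        pmf (map_pmf (\<lambda>e. permute_hypergraph (perm_of e n) J) (eraser_pmf n)) G * pmf (q n) J"
        unfolding prob_chain[OF n] card_erasers by simp
    qed
    also have "\<dots> = pmf (label_law n (q n)) G"
      unfolding label_law_def by (rule pmf_bind_finite[OF finite_InSy q_InSy[OF n], symmetric])
    finally show "pmf p G = pmf (label_law n (q n)) G" .
  qed
  then show ?thesis using p by simp
qed

end

text \<open>By consistency the first \<open>N\<close> hypergraphs are almost surely restrictions of
  the one at level \<open>N\<close>. Thus the laws at single levels determine all cylinder
  probabilities, and with them the law of the process.\<close>

lemma emeasure_exchangeable_law: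
  assumes H: "exchangeable_interval_hypergraph M H" and N: "1 \<le> N"
  shows "emeasure (process_law M InHy H) {x \<in> PiE {1..} InHy. \<forall>k\<in>{1..N}. x k \<in> B k} =
    emeasure (distr M (count_space UNIV) (H N)) {G. \<forall>k\<in>{1..N}. restrict_hypergraph G k \<in> B k}"
proof -
  have m: "\<And>n. 1 \<le> n \<Longrightarrow> H n \<in> measurable M (count_space UNIV)"
    and a: "\<And>n. 1 \<le> n \<Longrightarrow> AE \<omega> in M. H n \<omega> \<in> InHy n"
    and r: "\<And>n. 1 \<le> n \<Longrightarrow> AE \<omega> in M. H n \<omega> = restrict_hypergraph (H (n + 1) \<omega>) n"
    using H unfolding exchangeable_interval_hypergraph_def by blast+
  obtain Y where Y: "Y \<in> measurable M (path_space InHy)" and YX: "AE \<omega> in M. \<forall>n\<ge>1. H n \<omega> = Y \<omega> n"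
    and eq: "process_law M InHy H = distr M (path_space InHy) Y"
    by (rule process_law_patch[of H M InHy, OF m InHy_nonempty a])
  let ?C = "{x \<in> PiE {1..} InHy. \<forall>k\<in>{1..N}. x k \<in> B k}" and ?D = "{G. \<forall>k\<in>{1..N}. restrict_hypergraph G k \<in> B k}"
  have C: "?C \<in> sets (path_space InHy)"
    by (rule sets_path_cylinder[OF finite_InHy, where N = N]) simp
  have "AE \<omega> in M. \<forall>n. 1 \<le> n \<longrightarrow> H n \<omega> = restrict_hypergraph (H (n + 1) \<omega>) n" "AE \<omega> in M. \<forall>n. 1 \<le> n \<longrightarrow> H n \<omega> \<in> InHy n"
    unfolding AE_all_countable using a r by (auto intro: AE_impI)
  then have res: "AE \<omega> in M. \<forall>k\<in>{1..N}. H k \<omega> = restrict_hypergraph (H N \<omega>) k"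
  proof eventually_elim
    case (elim \<omega>)
    have self: "restrict_hypergraph (H n \<omega>) n = H n \<omega>" if n: "1 \<le> n" for n
    proof -
      have "{1..n} \<inter> e = e" if "e \<in> H n \<omega>" for e
        using elim(2) n that unfolding InHy_def interval_hypergraph_wrt_def interval_wrt_def by blast
      then show ?thesis unfolding restrict_hypergraph_def by (simp add: Setcompr_eq_image)
    qed
    show ?case
    proof
      fix k assume "k \<in> {1..N}"
      then have k: "1 \<le> k" "k \<le> N" by auto
      have "H k \<omega> = restrict_hypergraph (H n \<omega>) k" if "k \<le> n" for n
        using that
      proof (induction n rule: dec_induct)
        case base then show ?case using self[OF k(1)] by simp
      next
        case (step n)
        have "H n \<omega> = restrict_hypergraph (H (Suc n) \<omega>) n" using elim(1) k step by (metis Suc_eq_plus1 le_trans)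
        then have "H k \<omega> = restrict_hypergraph (restrict_hypergraph (H (Suc n) \<omega>) n) k" using step.IH by metis
        then show ?case using restrict_hypergraph_restrict[OF step.hyps(1)] by metis
      qed
      then show "H k \<omega> = restrict_hypergraph (H N \<omega>) k" using k by blast
    qed
  qed
  have "emeasure (process_law M InHy H) ?C = emeasure M (Y -` ?C \<inter> space M)" unfolding eq by (rule emeasure_distr[OF Y C])
  also have "\<dots> = emeasure M (H N -` ?D \<inter> space M)"
  proof (rule emeasure_eq_AE)
    show "Y -` ?C \<inter> space M \<in> sets M" by (rule measurable_sets[OF Y C])
    show "H N -` ?D \<inter> space M \<in> sets M" by (rule measurable_sets[OF m[OF N]]) simp
    show "AE \<omega> in M. \<omega> \<in> Y -` ?C \<inter> space M \<longleftrightarrow> \<omega> \<in> H N -` ?D \<inter> space M"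
      using YX res AE_space
    proof eventually_elim
      case (elim \<omega>)
      have "Y \<omega> \<in> PiE {1..} InHy" using measurable_space[OF Y elim(3)] by (simp add: space_path_space)
      moreover have "Y \<omega> k = restrict_hypergraph (H N \<omega>) k" if "k \<in> {1..N}" for k
        using elim(1,2) that by (metis atLeastAtMost_iff)
      ultimately show ?case using elim(3) by simp
    qed
  qed
  also have "\<dots> = emeasure (distr M (count_space UNIV) (H N)) ?D"
    by (rule emeasure_distr[OF m[OF N], symmetric]) simp
  finally show ?thesis .
qed

lemma process_law_eqI:
  assumes H: "exchangeable_interval_hypergraph M H" and H': "exchangeable_interval_hypergraph M' H'"
    and eq: "\<And>n. 1 \<le> n \<Longrightarrow> distr M (count_space UNIV) (H n) = distr M' (count_space UNIV) (H' n)"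
  shows "process_law M InHy H = process_law M' InHy H'"
proof (rule path_measure_eqI)
  have "prob_space (process_law M InHy H)"
  proof -
    obtain Y where Y: "Y \<in> measurable M (path_space InHy)" "process_law M InHy H = distr M (path_space InHy) Y"
      using process_law_patch[of H M InHy thesis] H InHy_nonempty unfolding exchangeable_interval_hypergraph_def by metis
    moreover have "prob_space M" using H by (simp add: exchangeable_interval_hypergraph_def)
    ultimately show ?thesis using prob_space.prob_space_distr by metis
  qed
  then show "finite_measure (process_law M InHy H)" by (simp add: prob_space.finite_measure)
  show "sets (process_law M InHy H) = sets (path_space InHy)" "sets (process_law M' InHy H') = sets (path_space InHy)"
    by (simp_all add: process_law_def)
  fix N and B :: "nat \<Rightarrow> nat set set set"
  \<comment> \<open>Passing to \<open>Suc N\<close> with a vacuous last condition covers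
    \<open>N = 0\<close>, where there would be no admissible level.\<close>
  have "{x \<in> PiE {1..} InHy. \<forall>k\<in>{1..N}. x k \<in> B k} = {x \<in> PiE {1..} InHy. \<forall>k\<in>{1..Suc N}. x k \<in> (if k \<le> N then B k else UNIV)}"
    by (auto simp: le_Suc_eq)
  then show "emeasure (process_law M InHy H) {x \<in> PiE {1..} InHy. \<forall>k\<in>{1..N}. x k \<in> B k} =
      emeasure (process_law M' InHy H') {x \<in> PiE {1..} InHy. \<forall>k\<in>{1..N}. x k \<in> B k}"
    using emeasure_exchangeable_law[OF H, of "Suc N" "\<lambda>k. if k \<le> N then B k else UNIV"]
      emeasure_exchangeable_law[OF H', of "Suc N" "\<lambda>k. if k \<le> N then B k else UNIV"] eq[of "Suc N"] by simp
qed

lemma hypergraph_law_surj: "ExInHy \<subseteq> hypergraph_law ` ErInPr"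
proof
  fix \<nu> assume "\<nu> \<in> ExInHy"
  then obtain M :: "(nat \<Rightarrow> nat set set) measure" and H where H: "exchangeable_interval_hypergraph M H"
    and \<nu>: "\<nu> = process_law M InHy H" by (auto simp: ExInHy_def)
  obtain h where h: "\<And>n. 1 \<le> n \<Longrightarrow> measure_pmf (h n) = distr M (count_space UNIV) (H n)"
    and h': "\<And>n. 1 \<le> n \<Longrightarrow> set_pmf (h n) \<subseteq> InHy n"
    "\<And>n p. 1 \<le> n \<Longrightarrow> p permutes {1..n} \<Longrightarrow> map_pmf (permute_hypergraph p) (h n) = h n"
    "\<And>n. 1 \<le> n \<Longrightarrow> map_pmf (\<lambda>G. restrict_hypergraph G n) (h (Suc n)) = h n"
    using exchangeable_pmfs[OF H] by blast
  obtain q where q: "\<And>n. 1 \<le> n \<Longrightarrow> set_pmf (q n) \<subseteq> InSy n" "\<And>n. 1 \<le> n \<Longrightarrow> label_law n (q n) = h n"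
    "\<And>n. 1 \<le> n \<Longrightarrow> q n = erase_law n (q (Suc n))"
    using consistent_interval_laws[OF h'] by blast
  interpret interval_laws q by unfold_locales (rule q(1,3); assumption)+
  let ?\<mu> = "process_law W EIP_states (pair_process chain chain_eta)"
  have "hypergraph_law ?\<mu> = process_law W InHy (hypergraph_process chain chain_eta)"
    by (rule eip.hypergraph_law_process_law[OF eip_chain])
  also have "\<dots> = \<nu>"
    unfolding \<nu>
  proof (rule process_law_eqI[OF eip.exchangeable_hypergraph_process[OF eip_chain] H])
    fix n :: nat assume n: "1 \<le> n"
    show "distr W (count_space UNIV) (hypergraph_process chain chain_eta n) = distr M (count_space UNIV) (H n)"
      unfolding distr_hypergraph_chain[OF n] q(2)[OF n] h[OF n] ..
  qed
  finally have "\<nu> = hypergraph_law ?\<mu>" ..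
  moreover have "?\<mu> \<in> ErInPr" by (rule eip.process_law_in_ErInPr[OF eip_chain])
  ultimately show "\<nu> \<in> hypergraph_law ` ErInPr" by (rule image_eqI)
qed

theorem theorem2p5:
  shows "(\<forall>(M :: 'a measure) I \<eta>. erased_interval_process M I \<eta> \<longrightarrow>
      (AE \<omega> in M. scaling_limit (\<lambda>n. I n \<omega>) (limit_system (\<lambda>n. I n \<omega>))) \<and>
      (\<forall>n\<ge>1. AE \<omega> in M.
         hypergraph_process I \<eta> n \<omega> =
           {{j \<in> {1..n}. x < U_of (\<lambda>m. \<eta> m \<omega>) j \<and> U_of (\<lambda>m. \<eta> m \<omega>) j < y} | x y.
              (x, y) \<in> limit_system (\<lambda>n. I n \<omega>)}
           \<union> {{j} | j. j \<in> {1..n}} \<union> {{}}) \<and>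
      exchangeable_interval_hypergraph M (hypergraph_process I \<eta>) \<and>
      process_law M EIP_states (pair_process I \<eta>) \<in> ErInPr \<and>
      hypergraph_law (process_law M EIP_states (pair_process I \<eta>)) =
        process_law M InHy (hypergraph_process I \<eta>)) \<and>
    continuous_map (weak_topology (path_topology EIP_states) ErInPr)
      (weak_topology (path_topology InHy) ExInHy) hypergraph_law \<and>
    affine_map_on ErInPr hypergraph_law \<and>
    hypergraph_law ` ErInPr = ExInHy"
proof (intro conjI continuous_hypergraph_law affine_hypergraph_law)
  show "hypergraph_law ` ErInPr = ExInHy" using hypergraph_law_in_ExInHy hypergraph_law_surj by blast
qed (intro allI impI conjI eip.scaling_limit_and_formula eip.exchangeable_hypergraph_process
  eip.process_law_in_ErInPr eip.hypergraph_law_process_law eipI; assumption)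

end
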